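(* Let $L\ge0$ be fixed and for each $N$ let $G$ be an $N\times N$ matrix from the complex induced Ginibre ensemble with rectangularity index $L$, with minimum modulus $r_{min}^{(N)}(G)$. In the limit $N\to\infty$, the left tail of the distribution of $r_{min}^{(N)}(G)$ is the Weibull distribution with shape parameter $\kappa=2(L+1)$ and scale parameter $\lambda=\left((L+1)!\right)^{1/\kappa}$, in the following precise sense: as $r\to0^+$, $$\lim_{N\to+\infty}P\left(r_{min}^{(N)}(G)<r\right)=1-\exp\left[-\frac{r^{2(L+1)}}{(L+1)!}\right]+O\left(r^{2(L+2)}\right).$$
   Context: The complex induced Ginibre ensemble with rectangularity index $L\ge0$ is the set of $N\times N$ complex matrices $G$ with density (with respect to Lebesgue measure on the entries) proportional to $\left(\det G^\dagger G\right)^{L}\exp\left(-\mathrm{Tr}\,G^\dagger G\right)$. The joint density of its eigenvalues $\lambda_1,\dots,\lambda_N\in\mathbb C$ is $\frac{1}{Z_N}\prod_{j<k}|\lambda_k-\lambda_j|^2\prod_{j=1}^N|\lambda_j|^{2L}\exp\left(-\sum_{j=1}^N|\lambda_j|^2\right)$ with $Z_N=N!\,\pi^N\prod_{k=1}^N\Gamma(k+L)$. The minimum modulus is $r_{min}^{(N)}(G)=\min_j|\lambda_j|$. For non-integer $L$, $(L+1)!$ means $\Gamma(L+2)$. The Weibull distribution with shape $\kappa$ and scale $\lambda$ has cumulative distribution function $1-e^{-(r/\lambda)^\kappa}$ for $r\ge0$. *)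

theory Defs
  imports
    "HOL-Probability.Probability"
    "HOL-Library.Landau_Symbols"
    "Jordan_Normal_Form.Schur_Decomposition"
    "Jordan_Normal_Form.Spectral_Radius"
begin

definition mat_trace :: "complex mat \<Rightarrow> complex" where
  "mat_trace A = (\<Sum>i<dim_row A. A $$ (i, i))"

text \<open>
  The size of a random matrix is a number that varies in the limit, and there is no
  sigma-algebra on the type of matrices. An N-by-N matrix is therefore identified with the family
  of its entries, and Lebesgue measure is the product of N * N copies of Lebesgue measure on
  the complex plane.
\<close>

definition entry_lebesgue :: "nat \<Rightarrow> (nat \<times> nat \<Rightarrow> complex) measure" where
  "entry_lebesgue N = (\<Pi>\<^sub>M ij\<in>{..<N} \<times> {..<N}. lborel)"

definition entries :: "nat \<Rightarrow> complex mat \<Rightarrow> nat \<times> nat \<Rightarrow> complex" where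
  "entries N A = (\<lambda>ij\<in>{..<N} \<times> {..<N}. A $$ ij)"

text \<open>
  Both the determinant and the trace below are nonnegative reals, so taking real parts is only
  a change of type. For L = 0 the convention that 0 powr 0 is 0 alters the weight only on the
  null set of singular matrices.
\<close>

definition induced_ginibre_weight :: "real \<Rightarrow> complex mat \<Rightarrow> real" where
  "induced_ginibre_weight L A =
     Re (Determinant.det (mat_adjoint A * A)) powr L * exp (- Re (mat_trace (mat_adjoint A * A)))"

text \<open>
  G is a random N-by-N matrix on the probability space M whose density is proportional to the
  weight; the constant is determined by normalization.
\<close>

definition induced_ginibre ::
    "real \<Rightarrow> nat \<Rightarrow> 'a measure \<Rightarrow> ('a \<Rightarrow> complex mat) \<Rightarrow> bool" where
  "induced_ginibre L N M G \<longleftrightarrow>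
     prob_space M \<and>
     (\<forall>\<omega>\<in>space M. G \<omega> \<in> carrier_mat N N) \<and>
     (\<exists>c>0. distributed M (entry_lebesgue N) (\<lambda>\<omega>. entries N (G \<omega>))
        (\<lambda>x. ennreal (c * induced_ginibre_weight L (Matrix.mat N N x))))"

definition min_modulus :: "complex mat \<Rightarrow> real" where
  "min_modulus A = Min (cmod ` spectrum A)"

definition weibull_cdf :: "real \<Rightarrow> real \<Rightarrow> real \<Rightarrow> real" where
  "weibull_cdf k s r = (if r < 0 then 0 else 1 - exp (- ((r / s) powr k)))"

end

theory Submission
  imports Defs "HOL-Complex_Analysis.Complex_Analysis"
begin

text \<open>
  If \<open>(z, 1)\<close> is an eigenvector of \<open>A\<close> with eigenvalue \<open>\<lambda>\<close>, then \<open>A = S M S\<inverse>\<close> with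
  \<open>M = [[A', 0], [w, \<lambda>]]\<close> and \<open>S = [[1, z], [0, 1]]\<close>. Almost every \<open>A\<close> of size \<open>n + 1\<close> arises from
  exactly \<open>n + 1\<close> tuples \<open>(A', z, w, \<lambda>)\<close>, and the Jacobian of the map is \<open>|det (\<lambda> - A')|\<^sup>2\<close>; all of its
  nonlinearity sits in one complex variable, namely the corner of \<open>A\<close> as a rational function of \<open>\<lambda>\<close>.
  Replacing \<open>S\<close> by the unitary factor of its QR decomposition shows that the Gaussian weight factors
  as well, so that the integrals over \<open>z\<close> and \<open>w\<close> only contribute a constant.

  Iterating this and normalizing, the probability that all eigenvalues have modulus at least \<open>r\<close> is the
  quotient of the integrals of \<open>|\<Delta>|\<^sup>2 \<Prod> |\<lambda>\<^sub>j|\<^bsup>2L\<^esup> exp (- |\<lambda>\<^sub>j|\<^sup>2)\<close> over \<open>|\<lambda>\<^sub>j| \<ge> r\<close> and over the whole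
  space, with \<open>\<Delta>\<close> the Vandermonde determinant. Rotation invariance makes the powers of \<open>\<lambda>\<close> orthogonal, which
  turns this into \<open>\<Prod>\<^sub>k\<^sub><\<^sub>N P(X\<^sub>k \<ge> r\<^sup>2)\<close> with \<open>X\<^sub>k\<close> Gamma distributed with shape \<open>k + L + 1\<close>. As \<open>r \<rightarrow> 0\<close>
  the factor \<open>k = 0\<close> gives the leading term, and the remaining factors together contribute
  \<open>O(r\<^bsup>2(L+2)\<^esup>)\<close>.
\<close>

section \<open>Change of variables for rational functions\<close>

text \<open>No joint law of the eigenvalues is formed: only integrals of functions of the matrix are
  transported, so neither a measurable choice nor an ordering of eigenvalues nor Haar measure on the
  unitary group occurs. Nor is a change of variables made in all \<open>n^2\<close> dimensions at
  once. Deflation is composed of \<open>blockshift\<close>, a shear of Jacobian 1 that produces the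
  leading block B; of \<open>colsub\<close>, a linear map of the last column with Jacobian |det
  (\<lambda> - B)|^2; and of the rational substitution in the corner, with derivative det (\<lambda>
  - A') / det (\<lambda> - B). The denominators cancel. The count n + 1 is the degree of that
  rational function, which presupposes a coprime numerator and denominator; hence the section on
  eigenvalues shared with the leading block. The Jacobian that is left couples \<lambda> to all
  eigenvalues of A', so the formula does not iterate by itself: the induction runs over weights with
  additional factors |det (m - A)|^2 for a list of points m, and the factors collected in this way
  make up the Vandermonde product.\<close>

definition vec2c :: "real^2 \<Rightarrow> complex" where "vec2c v = Complex (v $ 1) (v $ 2)"
definition c2vec :: "complex \<Rightarrow> real^2" where "c2vec z = vector [Re z, Im z]"

lemma vec2c_c2vec [simp]: "vec2c (c2vec z) = z"
  by (simp add: vec2c_def c2vec_def)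

lemma c2vec_vec2c [simp]: "c2vec (vec2c v) = v"
  by (simp add: vec2c_def c2vec_def Finite_Cartesian_Product.vec_eq_iff forall_2)

lemma bounded_linear_vec2c: "bounded_linear vec2c"
  by (intro linear_conv_bounded_linear[THEN iffD1] linearI) (auto simp: vec2c_def complex_eq_iff)

lemma bounded_linear_c2vec: "bounded_linear c2vec"
  by (intro linear_conv_bounded_linear[THEN iffD1] linearI) (auto simp: c2vec_def Finite_Cartesian_Product.vec_eq_iff forall_2)

lemma measurable_vec2c [measurable]: "vec2c \<in> borel_measurable borel"
  by (intro borel_measurable_continuous_onI linear_continuous_on bounded_linear_vec2c)

text \<open>The Jacobian theorem applied below lives on \<open>real^2\<close>; this equality brings
  its conclusion back to the plane. Boxes correspond to boxes, and Lebesgue measure is determined by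
  its values on them.\<close>

lemma distr_vec2c: "distr lborel borel vec2c = (lborel :: complex measure)"
proof (rule lborel_eqI[symmetric])
  fix l u :: complex
  assume le: "\<And>b. b \<in> Basis \<Longrightarrow> l \<bullet> b \<le> u \<bullet> b"
  have le': "Re l \<le> Re u" "Im l \<le> Im u"
    using le[of 1] le[of \<i>] by (auto simp: Basis_complex_def inner_complex_def)
  have B2: "(Basis :: (real^2) set) = {axis 1 1, axis 2 1}"
    by (auto simp: Basis_vec_def UNIV_2)
  have ne: "axis 1 (1::real) \<noteq> (axis 2 1 :: real^2)"
    by (simp add: axis_eq_axis)
  have "vec2c -` box l u = box (c2vec l) (c2vec u)"
    by (auto simp: vec2c_def c2vec_def mem_box Basis_complex_def B2 inner_complex_def inner_axis)
  then have "emeasure (distr lborel borel vec2c) (box l u) = emeasure lborel (box (c2vec l) (c2vec u))"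
    by (simp add: emeasure_distr)
  also have "\<dots> = ennreal (\<Prod>b\<in>Basis. (c2vec u - c2vec l) \<bullet> b)"
    by (subst emeasure_lborel_box) (auto simp: B2 c2vec_def inner_axis le')
  also have "(\<Prod>b\<in>Basis. (c2vec u - c2vec l) \<bullet> b) = (Re u - Re l) * (Im u - Im l)"
    using ne by (simp add: B2 c2vec_def inner_axis)
  also have "(Re u - Re l) * (Im u - Im l) = (\<Prod>b\<in>Basis. (u - l) \<bullet> b)"
    by (simp add: Basis_complex_def inner_complex_def)
  finally show "emeasure (distr lborel borel vec2c) (box l u) = ennreal (\<Prod>b\<in>Basis. (u - l) \<bullet> b)" .
qed simp

text \<open>By the Cauchy-Riemann equations the real Jacobian determinant is |f'|^2. The bounds on
  \<open>W\<close> and \<open>f'\<close> make this density integrable over \<open>E\<close>, as the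
  theorem on \<open>real^2\<close> demands; unbounded domains are reached by the countable
  decomposition in \<open>nn_integral_rational_fibre\<close>.\<close>

lemma emeasure_inj_holomorphic_image:
  fixes f f' :: "complex \<Rightarrow> complex"
  assumes W: "open W" "bounded W"
    and der: "\<And>x. x \<in> W \<Longrightarrow> (f has_field_derivative f' x) (at x)"
    and [measurable]: "f \<in> borel_measurable borel" "f' \<in> borel_measurable borel"
    and bd: "\<And>x. x \<in> W \<Longrightarrow> cmod (f' x) \<le> C"
    and inj: "inj_on f W"
    and E: "E \<in> sets borel" "E \<subseteq> W"
  shows "f ` E \<in> sets borel"
    and "emeasure lborel (f ` E) = (\<integral>\<^sup>+x. ennreal ((cmod (f' x))\<^sup>2) * indicator E x \<partial>lborel)"
proof -
  have hol: "f holomorphic_on W"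
    using der W holomorphic_on_open by blast
  obtain g where g: "g holomorphic_on (f ` W)" "\<And>z. z \<in> W \<Longrightarrow> g (f z) = z"
    using holomorphic_has_inverse[OF hol W(1) inj] by metis
  have opfW: "open (f ` W)"
    by (rule open_mapping_thm3[OF hol W(1) inj])
  \<comment> \<open>Through the holomorphic inverse \<open>g\<close>, extended by 0 outside the open
    image of \<open>W\<close>, the image of \<open>E\<close> becomes a preimage and is therefore
    Borel.\<close>
  have eq: "f ` E = (\<lambda>y. if y \<in> f ` W then g y else 0) -` E \<inter> f ` W"
  proof (intro equalityI subsetI)
    fix y assume "y \<in> f ` E"
    then obtain x where x: "x \<in> E" "y = f x" by auto
    then have "x \<in> W" "g y = x" using E(2) g(2) by auto
    then show "y \<in> (\<lambda>y. if y \<in> f ` W then g y else 0) -` E \<inter> f ` W" using x by simp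
  next
    fix y assume y: "y \<in> (\<lambda>y. if y \<in> f ` W then g y else 0) -` E \<inter> f ` W"
    then obtain x where x: "x \<in> W" "y = f x" by auto
    have "g y \<in> E" using y by (auto split: if_splits)
    moreover have "g y = x" using x g(2) by simp
    ultimately show "y \<in> f ` E" using x by blast
  qed
  have "(\<lambda>y. if y \<in> f ` W then g y else 0) \<in> borel_measurable borel"
    using borel_measurable_continuous_on_if[of "f ` W" g "\<lambda>_. 0"] opfW
      holomorphic_on_imp_continuous_on[OF g(1)] by auto
  then show fE: "f ` E \<in> sets borel"
    unfolding eq using opfW by (intro sets.Int measurable_sets_borel[OF _ E(1)]) auto
  define S where "S = vec2c -` E"
  define F where "F v = c2vec (f (vec2c v))" for v
  define F' where "F' v h = c2vec (f' (vec2c v) * vec2c h)" for v h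
  have S[measurable]: "S \<in> sets borel"
    unfolding S_def using E(1) by (intro measurable_sets_borel[OF measurable_vec2c])
  have FS: "F ` S = vec2c -` (f ` E)"
  proof (intro equalityI subsetI)
    fix x assume "x \<in> vec2c -` (f ` E)"
    then obtain e where e: "vec2c x = f e" "e \<in> E" by auto
    have "x = F (c2vec e)" by (simp add: F_def e(1)[symmetric])
    moreover have "c2vec e \<in> S" by (simp add: S_def e)
    ultimately show "x \<in> F ` S" by blast
  qed (auto simp: F_def S_def)
  have FSb: "F ` S \<in> sets borel"
    unfolding FS by (intro measurable_sets_borel[OF measurable_vec2c] fE)
  have derF: "(F has_derivative F' v) (at v within S)" if "v \<in> S" for v
  proof -
    have "vec2c v \<in> W" using that E unfolding S_def by auto
    then have "(f has_derivative (\<lambda>h. f' (vec2c v) * h)) (at (vec2c v))"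
      using der has_field_derivative_def by blast
    from has_derivative_compose[OF bounded_linear_imp_has_derivative[OF bounded_linear_vec2c] this]
    have "((\<lambda>v. c2vec (f (vec2c v))) has_derivative (\<lambda>h. c2vec (f' (vec2c v) * vec2c h))) (at v)"
      by (rule bounded_linear.has_derivative[OF bounded_linear_c2vec])
    then show ?thesis
      unfolding F_def F'_def by (rule has_derivative_at_withinI)
  qed
  have injF: "inj_on F S"
    unfolding F_def S_def using inj E(2)
    by (intro inj_onI) (metis c2vec_vec2c inj_onD subsetD vec2c_c2vec vimage_eq)
  \<comment> \<open>Multiplication by a + b i has the matrix [[a, -b], [b, a]], of determinant a^2 +
    b^2.\<close>
  have det: "\<bar>Determinants.det (matrix (F' v))\<bar> = (cmod (f' (vec2c v)))\<^sup>2" for v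
    unfolding cmod_power2
    by (simp add: det_2 matrix_def F'_def c2vec_def vec2c_def axis_def) (simp add: power2_eq_square)
  define G where "G v = (cmod (f' (vec2c v)))\<^sup>2" for v
  have [measurable]: "G \<in> borel_measurable borel" unfolding G_def by measurable
  have bdS: "bounded S"
  proof -
    have "S \<subseteq> c2vec ` E" unfolding S_def by (auto simp: image_iff) (metis c2vec_vec2c)
    moreover have "bounded (c2vec ` E)"
      using W(2) E(2) bounded_subset bounded_linear_image bounded_linear_c2vec by blast
    ultimately show ?thesis using bounded_subset by blast
  qed
  have Sfin: "emeasure lborel S < \<infinity>"
    using bdS emeasure_bounded_finite by blast
  have bdG: "G v \<le> C\<^sup>2" if "v \<in> S" for v
    unfolding G_def using bd[of "vec2c v"] that E(2) unfolding S_def by (auto intro!: power_mono)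
  have "integrable lborel (\<lambda>v. indicat_real S v * G v)"
  proof (rule Bochner_Integration.integrable_bound)
    show "integrable lborel (\<lambda>v. C\<^sup>2 * indicat_real S v)"
      using Sfin S by (intro integrable_mult_right integrable_real_indicator) auto
    show "AE v in lborel. norm (indicat_real S v * G v) \<le> norm (C\<^sup>2 * indicat_real S v)"
      using bdG by (auto simp: indicator_def G_def)
  qed auto
  then have si: "set_integrable lborel S G" by (simp add: set_integrable_def)
  then have hi: "(G has_integral (LINT v:S|lborel. G v)) S"
    using set_borel_integral_eq_integral[OF si] by (simp add: integrable_integral)
  then have "F ` S \<in> lmeasurable \<and> measure lebesgue (F ` S) = (LINT v:S|lborel. G v)"
    using has_measure_differentiable_image[of S F F' "LINT v:S|lborel. G v"] derF injF S
    unfolding det G_def[symmetric] by auto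
  then have "emeasure lebesgue (F ` S) = ennreal (LINT v:S|lborel. G v)"
    by (simp add: emeasure_eq_measure2 fmeasurableD2)
  also have "emeasure lebesgue (F ` S) = emeasure lborel (F ` S)"
    using FSb by simp
  also have "\<dots> = emeasure lborel (f ` E)"
    using fE by (subst distr_vec2c[symmetric]) (simp add: emeasure_distr FS)
  also have "ennreal (LINT v:S|lborel. G v) = (\<integral>\<^sup>+v. ennreal (indicat_real S v * G v) \<partial>lborel)"
    using si unfolding set_lebesgue_integral_def set_integrable_def
    by (subst nn_integral_eq_integral) (auto simp: G_def)
  also have "\<dots> = (\<integral>\<^sup>+v. ennreal ((cmod (f' (vec2c v)))\<^sup>2) * indicator E (vec2c v) \<partial>lborel)"
    by (intro nn_integral_cong) (auto simp: G_def S_def indicator_def)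
  also have "\<dots> = (\<integral>\<^sup>+x. ennreal ((cmod (f' x))\<^sup>2) * indicator E x \<partial>lborel)"
    using E(1) nn_integral_distr[of vec2c lborel borel "\<lambda>x. ennreal ((cmod (f' x))\<^sup>2) * indicator E x"]
    by (simp add: distr_vec2c)
  finally show "emeasure lborel (f ` E) = (\<integral>\<^sup>+x. ennreal ((cmod (f' x))\<^sup>2) * indicator E x \<partial>lborel)" .
qed

text \<open>The previous lemma read as an equality of measures: \<open>f\<close> pushes the density
  |f'|^2 on \<open>E\<close> forward to Lebesgue measure on the image of \<open>E\<close>.
  Integrating \<open>F\<close> against both sides gives the formula.\<close>

lemma nn_integral_inj_holomorphic_image:
  fixes f f' :: "complex \<Rightarrow> complex" and F :: "complex \<Rightarrow> ennreal"
  assumes W: "open W" "bounded W"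
    and der: "\<And>x. x \<in> W \<Longrightarrow> (f has_field_derivative f' x) (at x)"
    and [measurable]: "f \<in> borel_measurable borel" "f' \<in> borel_measurable borel"
    and bd: "\<And>x. x \<in> W \<Longrightarrow> cmod (f' x) \<le> C"
    and inj: "inj_on f W"
    and E: "E \<in> sets borel" "E \<subseteq> W"
    and [measurable]: "F \<in> borel_measurable borel"
  shows "(\<integral>\<^sup>+x. F (f x) * ennreal ((cmod (f' x))\<^sup>2) * indicator E x \<partial>lborel)
    = (\<integral>\<^sup>+y. F y * indicator (f ` E) y \<partial>lborel)"
proof -
  note im = emeasure_inj_holomorphic_image[OF W der _ _ bd inj]
  note [measurable] = E(1)
  have fEb: "f ` E \<in> sets borel"
    by (rule im(1)[OF _ _ _ _ E]) simp_all
  let ?w = "\<lambda>x. ennreal ((cmod (f' x))\<^sup>2) * indicator E x"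
  have "distr (density lborel ?w) borel f = density lborel (indicator (f ` E))"
  proof (rule measure_eqI)
    fix B assume "B \<in> sets (distr (density lborel ?w) borel f)"
    then have [measurable]: "B \<in> sets borel" by simp
    have EB: "E \<inter> f -` B \<in> sets borel" by measurable
    have "emeasure (distr (density lborel ?w) borel f) B = (\<integral>\<^sup>+x. ?w x * indicator (f -` B) x \<partial>lborel)"
      using measurable_sets_borel[OF \<open>f \<in> borel_measurable borel\<close> \<open>B \<in> sets borel\<close>]
      by (subst emeasure_distr) (auto simp: emeasure_density)
    also have "\<dots> = (\<integral>\<^sup>+x. ennreal ((cmod (f' x))\<^sup>2) * indicator (E \<inter> f -` B) x \<partial>lborel)"
      by (intro nn_integral_cong) (auto simp: indicator_def)
    also have "\<dots> = emeasure lborel (f ` (E \<inter> f -` B))"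
      using E EB by (intro im(2)[symmetric]) auto
    also have "f ` (E \<inter> f -` B) = f ` E \<inter> B" by auto
    also have "emeasure lborel (f ` E \<inter> B) = emeasure (density lborel (indicator (f ` E))) B"
      using fEb by (subst emeasure_density) (simp_all add: indicator_inter_arith[symmetric] nn_integral_indicator)
    finally show "emeasure (distr (density lborel ?w) borel f) B = emeasure (density lborel (indicator (f ` E))) B" .
  qed simp
  then have "integral\<^sup>N (distr (density lborel ?w) borel f) F = integral\<^sup>N (density lborel (indicator (f ` E))) F"
    by (rule arg_cong)
  also have "integral\<^sup>N (distr (density lborel ?w) borel f) F = integral\<^sup>N (density lborel ?w) (\<lambda>x. F (f x))"
    by (rule nn_integral_distr) auto
  also have "\<dots> = (\<integral>\<^sup>+x. ?w x * F (f x) \<partial>lborel)"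
    by (rule nn_integral_density) auto
  also have "integral\<^sup>N (density lborel (indicator (f ` E))) F = (\<integral>\<^sup>+y. indicator (f ` E) y * F y \<partial>lborel)"
    using fEb by (intro nn_integral_density) simp_all
  finally have *: "(\<integral>\<^sup>+x. ?w x * F (f x) \<partial>lborel) = (\<integral>\<^sup>+y. indicator (f ` E) y * F y \<partial>lborel)" .
  have "(\<integral>\<^sup>+x. F (f x) * ennreal ((cmod (f' x))\<^sup>2) * indicator E x \<partial>lborel) = (\<integral>\<^sup>+x. ?w x * F (f x) \<partial>lborel)"
    by (intro nn_integral_cong) (simp only: mult_ac)
  also note *
  also have "(\<integral>\<^sup>+y. indicator (f ` E) y * F y \<partial>lborel) = (\<integral>\<^sup>+y. F y * indicator (f ` E) y \<partial>lborel)"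
    by (intro nn_integral_cong) (rule mult.commute)
  finally show ?thesis .
qed

text \<open>For all but finitely many y the polynomial P - y Q has \<open>degree P\<close> distinct
  roots. The plane without poles and critical points is cut into countably many Borel pieces on
  which P / Q is injective; adding up the injective formula over the pieces weights y with its
  number of preimages.\<close>

lemma nn_integral_rational_fibre:
  fixes P Q :: "complex poly" and F :: "complex \<Rightarrow> ennreal"
  assumes deg: "degree Q < degree P"
    and cop: "\<And>z. poly P z = 0 \<Longrightarrow> poly Q z \<noteq> 0"
    and [measurable]: "F \<in> borel_measurable borel"
  shows "(\<integral>\<^sup>+z. F (poly P z / poly Q z) *
      ennreal ((cmod (poly (pderiv P * Q - P * pderiv Q) z / (poly Q z)\<^sup>2))\<^sup>2) \<partial>lborel)
    = of_nat (degree P) * (\<integral>\<^sup>+y. F y \<partial>lborel)"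
proof -
  define W where "W = pderiv P * Q - P * pderiv Q"
  define f where "f z = poly P z / poly Q z" for z
  define f' where "f' z = poly W z / (poly Q z)\<^sup>2" for z
  have [measurable]: "poly R \<in> borel_measurable borel" for R :: "complex poly"
    by (intro borel_measurable_continuous_onI continuous_intros)
  have [measurable]: "f \<in> borel_measurable borel" "f' \<in> borel_measurable borel"
    unfolding f_def f'_def by measurable
  have P0: "P \<noteq> 0" using deg by auto
  have Q0: "Q \<noteq> 0"
  proof
    assume "Q = 0"
    have "degree P \<noteq> 0" using deg by linarith
    then have "\<not> constant (poly P)" by (simp only: constant_degree not_False_eq_True)
    from Fundamental_Theorem_Algebra.fundamental_theorem_of_algebra[OF this] obtain z where "poly P z = 0" ..
    with cop have "poly Q z \<noteq> 0" .
    with \<open>Q = 0\<close> show False by simp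
  qed
  \<comment> \<open>The coefficient of \<open>W\<close> in degree
    \<open>degree P + degree Q - 1\<close> is (degree P - degree Q) times both leading coefficients.
    A constant Q is treated apart because then \<open>pderiv Q = 0\<close> and its degree is not one
    less than that of Q.\<close>
  have W0: "W \<noteq> 0"
  proof (cases "degree Q = 0")
    case True
    then have "pderiv Q = 0" by (simp add: pderiv_eq_0_iff)
    moreover have "pderiv P \<noteq> 0" using deg by (simp add: pderiv_eq_0_iff)
    ultimately show ?thesis using Q0 by (simp add: W_def)
  next
    case False
    let ?k = "degree P + degree Q - 1"
    have k1: "?k = degree (pderiv P) + degree Q" and k2: "?k = degree P + degree (pderiv Q)"
      using deg False by (auto simp: degree_pderiv)
    have "coeff (pderiv P * Q) ?k = coeff (pderiv P) (degree (pderiv P)) * lead_coeff Q"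
      unfolding k1 by (rule coeff_mult_degree_sum)
    also have "\<dots> = of_nat (degree P) * lead_coeff P * lead_coeff Q"
      using deg by (simp add: degree_pderiv coeff_pderiv)
    finally have 1: "coeff (pderiv P * Q) ?k = of_nat (degree P) * lead_coeff P * lead_coeff Q" .
    have "coeff (P * pderiv Q) ?k = lead_coeff P * coeff (pderiv Q) (degree (pderiv Q))"
      unfolding k2 by (rule coeff_mult_degree_sum)
    also have "\<dots> = of_nat (degree Q) * lead_coeff P * lead_coeff Q"
      using False by (simp add: degree_pderiv coeff_pderiv)
    finally have 2: "coeff (P * pderiv Q) ?k = of_nat (degree Q) * lead_coeff P * lead_coeff Q" .
    have "coeff W ?k = (of_nat (degree P) - of_nat (degree Q)) * lead_coeff P * lead_coeff Q"
      unfolding W_def coeff_diff 1 2 by (simp add: algebra_simps)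
    moreover have "(of_nat (degree P) :: complex) \<noteq> of_nat (degree Q)" using deg by auto
    ultimately have "coeff W ?k \<noteq> 0" using P0 Q0 by simp
    then show ?thesis by auto
  qed
  define V where "V = {z. poly Q z \<noteq> 0 \<and> poly W z \<noteq> 0}"
  have Vco: "V = - ({z. poly Q z = 0} \<union> {z. poly W z = 0})"
    by (auto simp: V_def)
  have V: "open V"
    unfolding Vco by (intro open_Compl finite_imp_closed finite_UnI poly_roots_finite Q0 W0)
  have der: "(f has_field_derivative f' z) (at z)" if "poly Q z \<noteq> 0" for z
    unfolding f_def f'_def W_def using that
    by (auto intro!: derivative_eq_intros simp: power2_eq_square field_simps)
  have hol: "f holomorphic_on V"
    using der V by (auto simp: holomorphic_on_open V_def)
  define good where "good B \<longleftrightarrow> open B \<and> bounded B \<and> B \<subseteq> V \<and> inj_on f B \<and> (\<exists>C. \<forall>x\<in>B. cmod (f' x) \<le> C)" for B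
  have ex: "\<exists>B. good B \<and> z \<in> B" if zV: "z \<in> V" for z
  proof -
    have "f' z \<noteq> 0" using zV by (auto simp: f'_def V_def)
    moreover have "deriv f z = f' z" using der zV by (auto simp: V_def intro: DERIV_imp_deriv)
    ultimately obtain r where r: "r > 0" "ball z r \<subseteq> V" "inj_on f (ball z r)"
      using has_complex_derivative_locally_injective[OF hol zV V] by auto
    have sub: "cball z (r / 2) \<subseteq> ball z r" using r by (auto simp: cball_subset_ball_iff)
    have nz: "poly Q x \<noteq> 0" if "x \<in> cball z (r / 2)" for x
    proof -
      have "x \<in> V" using that sub r(2) by blast
      then show ?thesis by (simp add: V_def)
    qed
    have "continuous_on (cball z (r / 2)) f'"
      unfolding f'_def by (intro continuous_intros) (simp add: nz)
    from compact_imp_bounded[OF compact_continuous_image[OF this compact_cball]]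
    obtain C where C: "\<forall>x\<in>cball z (r / 2). cmod (f' x) \<le> C"
      unfolding bounded_iff by auto
    have sub': "ball z (r / 2) \<subseteq> cball z (r / 2)" by (rule ball_subset_cball)
    have "ball z (r / 2) \<subseteq> V" using sub sub' r(2) by blast
    moreover have "inj_on f (ball z (r / 2))" using inj_on_subset[OF r(3)] sub sub' by blast
    moreover have "\<exists>C. \<forall>x\<in>ball z (r / 2). cmod (f' x) \<le> C" using C sub' by blast
    ultimately have "good (ball z (r / 2))"
      unfolding good_def by simp
    then show ?thesis using r(1) by (auto intro!: exI[of _ "ball z (r / 2)"])
  qed
  obtain \<B> where \<B>: "\<B> \<subseteq> Collect good" "countable \<B>" "\<Union>\<B> = \<Union>(Collect good)"
    using Lindelof[of "Collect good"] by (auto simp: good_def)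
  have UB: "\<Union>\<B> = V"
    using \<B>(3) ex by (auto simp: good_def)
  have "V \<noteq> {}"
  proof
    assume "V = {}"
    then have "UNIV = {z. poly Q z = 0} \<union> {z. poly W z = 0}" using Vco by auto
    then have "finite (UNIV :: complex set)"
      using poly_roots_finite[OF Q0] poly_roots_finite[OF W0] by (metis finite_Un)
    then show False using infinite_UNIV_char_0 by blast
  qed
  then have "\<B> \<noteq> {}" using UB by auto
  define b where "b = from_nat_into \<B>"
  have b: "range b = \<B>" unfolding b_def using \<B>(2) \<open>\<B> \<noteq> {}\<close> by (rule range_from_nat_into[rotated])
  have gb: "good (b k)" for k using b \<B>(1) by auto
  \<comment> \<open>The pieces are made disjoint so that every preimage is counted once.\<close>
  define E where "E = disjointed b"
  have E: "E k \<subseteq> b k" "E k \<in> sets borel" for k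
  proof -
    show "E k \<subseteq> b k" unfolding E_def disjointed_def by auto
    have "\<And>j. b j \<in> sets borel" using gb by (auto simp: good_def)
    then show "E k \<in> sets borel" unfolding E_def disjointed_def by (intro sets.Diff sets.finite_UN) auto
  qed
  note [measurable] = E(2)
  have disj: "disjoint_family E" unfolding E_def by (rule disjoint_family_disjointed)
  have UE: "(\<Union>k. E k) = V" unfolding E_def UN_disjointed_eq using b UB by auto
  have fE[measurable]: "f ` E k \<in> sets borel" and
    int: "(\<integral>\<^sup>+x. F (f x) * ennreal ((cmod (f' x))\<^sup>2) * indicator (E k) x \<partial>lborel)
      = (\<integral>\<^sup>+y. F y * indicator (f ` E k) y \<partial>lborel)" for k
  proof -
    obtain C where C: "\<And>x. x \<in> b k \<Longrightarrow> cmod (f' x) \<le> C" using gb[of k] by (auto simp: good_def)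
    have k: "open (b k)" "bounded (b k)" "\<And>x. x \<in> b k \<Longrightarrow> (f has_field_derivative f' x) (at x)" "inj_on f (b k)"
      using gb[of k] der by (auto simp: good_def V_def)
    show "f ` E k \<in> sets borel"
      by (rule emeasure_inj_holomorphic_image(1)[OF k(1-3) _ _ C k(4) E(2,1)]) auto
    show "(\<integral>\<^sup>+x. F (f x) * ennreal ((cmod (f' x))\<^sup>2) * indicator (E k) x \<partial>lborel)
      = (\<integral>\<^sup>+y. F y * indicator (f ` E k) y \<partial>lborel)"
      by (rule nn_integral_inj_holomorphic_image[OF k(1-3) _ _ C k(4) E(2,1)]) auto
  qed
  \<comment> \<open>At a zero of Q the division by zero in \<open>f'\<close> yields 0, so poles as
    well as critical points drop out of the integral.\<close>
  have f'0: "f' z = 0" if "z \<notin> V" for z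
    using that by (auto simp: V_def f'_def)
  have "(\<integral>\<^sup>+z. F (f z) * ennreal ((cmod (f' z))\<^sup>2) \<partial>lborel)
    = (\<integral>\<^sup>+z. (\<Sum>k. F (f z) * ennreal ((cmod (f' z))\<^sup>2) * indicator (E k) z) \<partial>lborel)"
    by (intro nn_integral_cong)
       (auto simp: ennreal_suminf_cmult suminf_indicator[OF disj] UE f'0 split: split_indicator)
  also have "\<dots> = (\<Sum>k. \<integral>\<^sup>+z. F (f z) * ennreal ((cmod (f' z))\<^sup>2) * indicator (E k) z \<partial>lborel)"
    by (rule nn_integral_suminf) measurable
  also have "\<dots> = (\<Sum>k. \<integral>\<^sup>+y. F y * indicator (f ` E k) y \<partial>lborel)"
    by (simp only: int)
  also have "\<dots> = (\<integral>\<^sup>+y. (\<Sum>k. F y * indicator (f ` E k) y) \<partial>lborel)"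
    by (rule nn_integral_suminf[symmetric]) measurable
  also have "\<dots> = (\<integral>\<^sup>+y. F y * of_nat (degree P) \<partial>lborel)"
  proof (rule nn_integral_cong_AE)
    have "finite (f ` {z. poly W z = 0})" using poly_roots_finite[OF W0] by auto
    then have "AE y in lborel. y \<notin> f ` {z. poly W z = 0}"
      by (intro AE_not_in finite_imp_null_set_lborel)
    then show "AE y in lborel. (\<Sum>k. F y * indicator (f ` E k) y) = F y * of_nat (degree P)"
    proof eventually_elim
      case (elim y)
      define R where "R = {z. poly (P - Polynomial.smult y Q) z = 0}"
      have degR: "degree (P - Polynomial.smult y Q) = degree P"
        using degree_add_eq_left[of "- Polynomial.smult y Q" P] le_less_trans[OF degree_smult_le deg] by simp
      have R: "z \<in> R \<longleftrightarrow> poly Q z \<noteq> 0 \<and> f z = y" for z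
        using cop[of z] by (auto simp: R_def f_def)
      have RV: "R \<subseteq> V" using elim R by (auto simp: V_def)
      \<comment> \<open>A double root a would satisfy P = y Q and P' = y Q' at a, hence W = 0 there,
        and y would be one of the excluded critical values.\<close>
      have "rsquarefree (P - Polynomial.smult y Q)"
        unfolding rsquarefree_roots
      proof safe
        fix a assume a: "poly (P - Polynomial.smult y Q) a = 0" "poly (pderiv (P - Polynomial.smult y Q)) a = 0"
        then have "a \<in> R" by (simp add: R_def)
        have "poly P a = y * poly Q a" "poly (pderiv P) a = y * poly (pderiv Q) a"
          using a by (auto simp: pderiv_diff pderiv_smult)
        then have "poly W a = 0" by (simp add: W_def)
        then show False using RV \<open>a \<in> R\<close> by (auto simp: V_def)
      qed
      then have "Polynomial.smult (lead_coeff (P - Polynomial.smult y Q)) (\<Prod>z\<in>R. [:-z, 1:]) = P - Polynomial.smult y Q"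
        unfolding R_def by (rule complex_poly_decompose_rsquarefree)
      then have "degree (\<Prod>z\<in>R. [:-z, 1:]) = degree P"
        using degR deg by (metis degree_smult_eq leading_coeff_0_iff degree_0 not_less0)
      then have cR: "card R = degree P"
        by (subst (asm) degree_prod_sum_eq) auto
      have finR: "finite R" using cR deg by (auto intro: card_ge_0_finite)
      \<comment> \<open>By injectivity the piece \<open>E k\<close> holds at most one preimage of y,
        so the indicator of its image counts the preimages in it.\<close>
      have ind: "indicator (f ` E k) y = (\<Sum>z\<in>R. indicator (E k) z :: ennreal)" for k
      proof (cases "y \<in> f ` E k")
        case True
        then obtain z where z: "z \<in> E k" "y = f z" by auto
        have "E k \<inter> R = {z}"
        proof -
          have sub: "E k \<subseteq> V" and inj: "inj_on f (E k)"
            using E(1)[of k] gb[of k] inj_on_subset by (auto simp: good_def)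
          have "z \<in> V" using z(1) sub by blast
          then have "z \<in> R" using z(2) by (simp add: R V_def)
          moreover have "z' = z" if "z' \<in> E k" "z' \<in> R" for z'
            using inj_onD[OF inj _ that(1) z(1)] that(2) z(2) by (simp add: R)
          ultimately show ?thesis using z(1) by blast
        qed
        then have "card (R \<inter> E k) = 1" by (simp add: Int_commute)
        then have "(\<Sum>z\<in>R. indicator (E k) z :: ennreal) = 1"
          using finR by (simp add: indicator_def sum.If_cases)
        then show ?thesis using True by simp
      next
        case False
        then have "z \<notin> E k" if "z \<in> R" for z using R that by auto
        then show ?thesis using False by (simp add: indicator_def)
      qed
      have "(\<Sum>k. F y * indicator (f ` E k) y) = F y * (\<Sum>k. \<Sum>z\<in>R. indicator (E k) z)"
        unfolding ind by (simp add: ennreal_suminf_cmult)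
      also have "(\<Sum>k. \<Sum>z\<in>R. indicator (E k) z :: ennreal) = (\<Sum>z\<in>R. \<Sum>k. indicator (E k) z)"
        by (rule suminf_sum) auto
      also have "\<dots> = (\<Sum>z\<in>R. 1)"
        using RV by (intro sum.cong) (auto simp: suminf_indicator[OF disj] UE)
      finally show ?case using cR by simp
    qed
  qed
  also have "\<dots> = of_nat (degree P) * (\<integral>\<^sup>+y. F y \<partial>lborel)"
    by (simp add: nn_integral_multc mult.commute)
  finally show ?thesis unfolding f_def f'_def W_def .
qed

text \<open>The fibre formula for a numerator of degree 1 and denominator 1.\<close>

lemma nn_integral_complex_affine:
  fixes f :: "complex \<Rightarrow> ennreal"
  assumes "f \<in> borel_measurable borel" "c \<noteq> 0"
  shows "(\<integral>\<^sup>+z. f (c * z + t) * ennreal ((cmod c)\<^sup>2) \<partial>lborel) = (\<integral>\<^sup>+z. f z \<partial>lborel)"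
proof -
  have "pderiv [:t, c:] = [:c:]" by (simp add: pderiv_pCons)
  then show ?thesis
    using nn_integral_rational_fibre[of 1 "[:t, c:]" f] assms(2)[THEN not_sym] assms
    by (simp add: add.commute[of t] mult.commute[of _ c])
qed

section \<open>Lebesgue measure on families of complex numbers\<close>

abbreviation LC :: "'i set \<Rightarrow> ('i \<Rightarrow> complex) measure" where
  "LC I \<equiv> PiM I (\<lambda>_. lborel :: complex measure)"

interpretation LC: product_sigma_finite "\<lambda>_ :: 'i. lborel :: complex measure"
  by standard

lemma space_LC: "x \<in> space (LC I) \<longleftrightarrow> x \<in> extensional I"
  by (simp add: space_PiM PiE_UNIV_domain PiE_def)

lemma LC_coordinate_measurable [measurable]: "i \<in> I \<Longrightarrow> (\<lambda>x. x i) \<in> borel_measurable (LC I)"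
  using measurable_component_singleton[of i I "\<lambda>_. lborel :: complex measure"] by simp

lemma LC_restrictI:
  assumes "\<And>i. i \<in> I \<Longrightarrow> X i \<in> borel_measurable N"
  shows "(\<lambda>x. \<lambda>i\<in>I. X i x) \<in> measurable N (LC I)"
  using assms by (intro measurable_restrict) auto

text \<open>Tonelli with coordinate i innermost. Substitutions in a single matrix entry, the other
  entries being frozen at almost every value, go through this lemma.\<close>

lemma nn_integral_LC_coordinate:
  assumes I: "finite I" "i \<in> I"
    and [measurable]: "f \<in> borel_measurable (LC I)" "g \<in> borel_measurable (LC I)"
    and eq: "AE x in LC (I - {i}). (\<integral>\<^sup>+t. f (x(i := t)) \<partial>lborel) = (\<integral>\<^sup>+t. g (x(i := t)) \<partial>lborel)"
  shows "integral\<^sup>N (LC I) f = integral\<^sup>N (LC I) g"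
proof -
  have ins: "insert i (I - {i}) = I" using I by auto
  have "integral\<^sup>N (LC I) h = (\<integral>\<^sup>+x. \<integral>\<^sup>+t. h (x(i := t)) \<partial>lborel \<partial>LC (I - {i}))"
    if "h \<in> borel_measurable (LC I)" for h
    using LC.product_nn_integral_insert[of "I - {i}" i h, unfolded ins] that I by simp
  then show ?thesis
    using eq by (simp add: nn_integral_cong_AE)
qed

lemma nn_integral_LC_block:
  assumes I: "finite I" "J \<subseteq> I"
    and [measurable]: "f \<in> borel_measurable (LC I)" 
  shows "integral\<^sup>N (LC I) f = (\<integral>\<^sup>+x. \<integral>\<^sup>+y. f (merge (I - J) J (x, y)) \<partial>LC J \<partial>LC (I - J))"
proof -
  have *: "(I - J) \<union> J = I" using I by auto
  show ?thesis
    by (rule LC.product_nn_integral_fold[of "I - J" J f, unfolded *])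
      (use I finite_subset[OF I(2,1)] in auto)
qed

text \<open>If the truth of P does not depend on coordinate i, the exceptional set is a union of
  full lines in that direction. Each such line has infinite measure, so a null exceptional set has a
  null projection.\<close>

lemma AE_LC_drop_coordinate:
  assumes I: "finite I" "i \<in> I"
    and [measurable]: "Measurable.pred (LC I) P"
    and AE: "AE x in LC I. P x"
    and ind: "\<And>x s t. x \<in> space (LC (I - {i})) \<Longrightarrow> P (x(i := s)) \<Longrightarrow> P (x(i := t))"
  shows "AE x in LC (I - {i}). \<forall>t. P (x(i := t))"
proof -
  have ins: "insert i (I - {i}) = I" using I by auto
  let ?Q = "\<lambda>x. indicator {x. \<not> P x} x :: ennreal"
  have [measurable]: "?Q \<in> borel_measurable (LC I)" by measurable
  have "(\<integral>\<^sup>+x. ?Q x \<partial>LC I) = 0"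
    using AE by (subst nn_integral_0_iff_AE) (auto simp: indicator_def)
  then have "(\<integral>\<^sup>+x. \<integral>\<^sup>+t. ?Q (x(i := t)) \<partial>lborel \<partial>LC (I - {i})) = 0"
    using LC.product_nn_integral_insert[of "I - {i}" i ?Q, unfolded ins] I by simp
  moreover have "(\<lambda>x. \<integral>\<^sup>+t. ?Q (x(i := t)) \<partial>lborel) \<in> borel_measurable (LC (I - {i}))"
  proof -
    have "(\<lambda>(x, t). x(i := t)) \<in> measurable (LC (I - {i}) \<Otimes>\<^sub>M lborel) (LC (insert i (I - {i})))"
      by measurable
    then have [measurable]: "(\<lambda>(x, t). x(i := t)) \<in> measurable (LC (I - {i}) \<Otimes>\<^sub>M lborel) (LC I)"
      unfolding ins .
    have "(\<lambda>p. ?Q ((\<lambda>(x, t). x(i := t)) p)) \<in> borel_measurable (LC (I - {i}) \<Otimes>\<^sub>M lborel)"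
      by (rule measurable_compose[OF \<open>(\<lambda>(x, t). x(i := t)) \<in> measurable (LC (I - {i}) \<Otimes>\<^sub>M lborel) (LC I)\<close>]) measurable
    then show ?thesis by (intro lborel.borel_measurable_nn_integral) (simp add: case_prod_beta')
  qed
  ultimately have "AE x in LC (I - {i}). (\<integral>\<^sup>+t. ?Q (x(i := t)) \<partial>lborel) = 0"
    by (subst (asm) nn_integral_0_iff_AE) auto
  with AE_space[of "LC (I - {i})"] show ?thesis
  proof eventually_elim
    case (elim x)
    show ?case
    proof (intro allI, rule ccontr)
      fix t assume n: "\<not> P (x(i := t))"
      have "?Q (x(i := s)) = 1" for s using ind[OF elim(1), of s t] n by (auto simp: indicator_def)
      then have "(\<integral>\<^sup>+t. ?Q (x(i := t)) \<partial>lborel) = emeasure lborel (UNIV :: complex set)" by simp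
      with elim(2) show False by simp
    qed
  qed
qed

text \<open>With the other coordinates frozen, \<open>g\<close> is constant and the update is an
  affine map of the plane.\<close>

lemma nn_integral_LC_update:
  assumes I: "finite I" "i \<in> I"
    and f[measurable]: "f \<in> borel_measurable (LC I)"
    and c: "c \<noteq> 0"
    and g[measurable]: "g \<in> borel_measurable (LC I)"
    and ind: "\<And>x t. g (x(i := t)) = g x"
  shows "(\<integral>\<^sup>+x. f (x(i := c * x i + g x)) \<partial>LC I) * ennreal ((cmod c)\<^sup>2) = integral\<^sup>N (LC I) f"
proof -
  have [measurable]: "(\<lambda>x. x(i := c * x i + g x)) \<in> measurable (LC I) (LC I)"
    using I by (intro measurable_fun_upd[where J=I]) auto
  have "(\<integral>\<^sup>+x. f (x(i := c * x i + g x)) \<partial>LC I) * ennreal ((cmod c)\<^sup>2)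
    = (\<integral>\<^sup>+x. f (x(i := c * x i + g x)) * ennreal ((cmod c)\<^sup>2) \<partial>LC I)"
    by (simp add: nn_integral_multc)
  also have "\<dots> = integral\<^sup>N (LC I) f"
  proof (rule nn_integral_LC_coordinate[OF I])
    show "AE x in LC (I - {i}). (\<integral>\<^sup>+t. f ((x(i := t))(i := c * (x(i := t)) i + g (x(i := t)))) * ennreal ((cmod c)\<^sup>2) \<partial>lborel)
      = (\<integral>\<^sup>+t. f (x(i := t)) \<partial>lborel)"
    proof (rule AE_I2)
      fix x assume x: "x \<in> space (LC (I - {i}))"
      have "insert i (I - {i}) = I" using I by auto
      then have [measurable]: "(\<lambda>t. x(i := t)) \<in> measurable borel (LC I)"
        using measurable_component_update[OF x, of i] by (simp cong: measurable_cong_sets)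
      show "(\<integral>\<^sup>+t. f ((x(i := t))(i := c * (x(i := t)) i + g (x(i := t)))) * ennreal ((cmod c)\<^sup>2) \<partial>lborel)
        = (\<integral>\<^sup>+t. f (x(i := t)) \<partial>lborel)"
        using nn_integral_complex_affine[of "\<lambda>t. f (x(i := t))" c "g x"] c by (simp add: ind)
    qed
  qed measurable
  finally show ?thesis .
qed

text \<open>The simultaneous update equals a sequence of single updates in increasing
  \<open>ord\<close>: when coordinate k has its turn, \<open>g k\<close> reads only coordinates
  outside \<open>J\<close> or of larger \<open>ord\<close>, and none of these has been changed
  yet.\<close>

lemma nn_integral_LC_triangular:
  fixes ord :: "'i \<Rightarrow> nat"
  assumes I: "finite I" and J: "J \<subseteq> I" and ord: "inj_on ord J"
    and f[measurable]: "f \<in> borel_measurable (LC I)"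
    and c: "\<And>k. k \<in> J \<Longrightarrow> c k \<noteq> 0"
    and g[measurable]: "\<And>k. k \<in> J \<Longrightarrow> g k \<in> borel_measurable (LC I)"
    and ind: "\<And>k x y. k \<in> J \<Longrightarrow> (\<And>i. i \<in> I \<Longrightarrow> i \<notin> J \<or> ord k < ord i \<Longrightarrow> x i = y i) \<Longrightarrow> g k x = g k y"
  shows "(\<integral>\<^sup>+x. f (\<lambda>k\<in>I. if k \<in> J then c k * x k + g k x else x k) \<partial>LC I)
      * ennreal (\<Prod>k\<in>J. (cmod (c k))\<^sup>2) = integral\<^sup>N (LC I) f"
proof -
  have finJ: "finite J" using I J finite_subset by auto
  define K where "K m = {k \<in> J. ord k < m}" for m
  define T where "T m x = (\<lambda>k\<in>I. if k \<in> K m then c k * x k + g k x else x k)" for m x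
  have KJ: "K m \<subseteq> J" for m by (auto simp: K_def)
  have Tm[measurable]: "T m \<in> measurable (LC I) (LC I)" for m
    unfolding T_def
  proof (rule LC_restrictI)
    fix k assume "k \<in> I"
    then show "(\<lambda>x. if k \<in> K m then c k * x k + g k x else x k) \<in> borel_measurable (LC I)"
      using KJ[of m] by (cases "k \<in> K m") auto
  qed
  have main: "(\<integral>\<^sup>+x. f (T m x) \<partial>LC I) * ennreal (\<Prod>k\<in>K m. (cmod (c k))\<^sup>2) = integral\<^sup>N (LC I) f"
    if "f \<in> borel_measurable (LC I)" for m f
    using that
  proof (induction m arbitrary: f)
    case 0
    have "K 0 = {}" by (auto simp: K_def)
    moreover have "T 0 x = x" if "x \<in> space (LC I)" for x
      using that by (auto simp: T_def \<open>K 0 = {}\<close> space_LC extensional_def)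
    ultimately show ?case by (simp cong: nn_integral_cong)
  next
    case (Suc m)
    note [measurable] = Suc.prems
    show ?case
    proof (cases "\<exists>k\<in>J. ord k = m")
      case False
      then have "K (Suc m) = K m" by (auto simp: K_def less_Suc_eq)
      then show ?thesis using Suc by (simp add: T_def)
    next
      case True
      then obtain k where k: "k \<in> J" "ord k = m" by auto
      have kI: "k \<in> I" using k J by auto
      have K: "K (Suc m) = insert k (K m)" "k \<notin> K m"
        using k ord by (auto simp: K_def less_Suc_eq dest: inj_onD)
      define U where "U x = x(k := c k * x k + g k x)" for x
      have [measurable]: "g k \<in> borel_measurable (LC I)" using k g by auto
      have [measurable]: "U \<in> measurable (LC I) (LC I)"
        unfolding U_def using kI by (intro measurable_fun_upd[where J=I]) auto
      have TU: "T (Suc m) x = U (T m x)" if "x \<in> space (LC I)" for x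
      proof -
        have "g k (T m x) = g k x"
          using k by (intro ind) (auto simp: T_def K_def)
        then show ?thesis
          using kI K by (auto simp: U_def T_def)
      qed
      have "(\<integral>\<^sup>+x. f (T (Suc m) x) \<partial>LC I) * ennreal (\<Prod>k\<in>K (Suc m). (cmod (c k))\<^sup>2)
        = ((\<integral>\<^sup>+x. f (U (T m x)) \<partial>LC I) * ennreal (\<Prod>k\<in>K m. (cmod (c k))\<^sup>2)) * ennreal ((cmod (c k))\<^sup>2)"
        using K finite_subset[OF KJ[of m] finJ]
        by (simp add: TU ennreal_mult prod_nonneg mult_ac cong: nn_integral_cong)
      also have "\<dots> = (\<integral>\<^sup>+x. f (U x) \<partial>LC I) * ennreal ((cmod (c k))\<^sup>2)"
        \<comment> \<open>The induction hypothesis for the function f o U removes the inner map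
          \<open>T m\<close>; the one-coordinate lemma then removes \<open>U\<close>.\<close>
        using Suc.IH[of "\<lambda>x. f (U x)"] by simp
      also have "\<dots> = integral\<^sup>N (LC I) f"
        unfolding U_def using k by (intro nn_integral_LC_update I kI c ind) auto
      finally show ?thesis .
    qed
  qed
  have "K (Suc (Max (ord ` J))) = J"
    using finJ by (auto simp: K_def less_Suc_eq_le)
  with main[OF f, of "Suc (Max (ord ` J))"] show ?thesis
    by (simp add: T_def)
qed

text \<open>A product of unit discs serves as a set by whose measure one may divide, both to compute
  a scaling factor and to see that it is unique.\<close>

lemma LC_test_set:
  assumes "finite I"
  obtains B where "B \<in> sets (LC I)" "emeasure (LC I) B \<noteq> 0" "emeasure (LC I) B \<noteq> \<infinity>"
proof -
  interpret L: finite_product_sigma_finite "\<lambda>_. lborel :: complex measure" I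
    by standard (rule assms)
  define B where "B = PiE I (\<lambda>_. ball (0::complex) 1)"
  have "B \<in> sets (LC I)"
    unfolding B_def using assms by (intro sets_PiM_I_finite) auto
  have "emeasure (LC I) B = (\<Prod>i\<in>I. emeasure lborel (ball (0::complex) 1))"
    unfolding B_def by (rule L.measure_times) auto
  moreover have "emeasure lborel (ball (0::complex) 1) \<noteq> \<infinity>"
    using emeasure_bounded_finite[of "ball (0::complex) 1"] by auto
  moreover have "emeasure lborel (ball (0::complex) 1) \<noteq> 0"
    using content_ball_pos[of 1 "0::complex"] by (auto simp: measure_def)
  ultimately show thesis
    using that[OF \<open>B \<in> sets (LC I)\<close>] assms by (auto simp: power_eq_top_ennreal)
qed

text \<open>Fubini's theorem applied to \<open>f (T x) * 1\<^sub>B (y + T x)\<close>: a translation-equivariant bijection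
  can change Lebesgue measure only by a constant factor.\<close>

lemma nn_integral_LC_additive:
  assumes I: "finite I"
    and T[measurable]: "T \<in> measurable (LC I) (LC I)" and S[measurable]: "S \<in> measurable (LC I) (LC I)"
    and TS: "\<And>x. x \<in> space (LC I) \<Longrightarrow> T (S x) = x"
    and add: "\<And>x y. x \<in> space (LC I) \<Longrightarrow> y \<in> space (LC I) \<Longrightarrow> T (\<lambda>k\<in>I. x k + y k) = (\<lambda>k\<in>I. T x k + T y k)"
  shows "\<exists>\<kappa>. \<forall>f\<in>borel_measurable (LC I). (\<integral>\<^sup>+x. f (T x) \<partial>LC I) = \<kappa> * integral\<^sup>N (LC I) f"
proof -
  obtain ord :: "'a \<Rightarrow> nat" where ord: "inj_on ord I"
    using I finite_imp_inj_to_nat_seg by blast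
  have sp: "(\<lambda>k\<in>I. h k) \<in> space (LC I)" for h by (simp add: space_LC)
  have Tsp: "T x \<in> space (LC I)" if "x \<in> space (LC I)" for x
    using measurable_space[OF T that] .
  have Ssp: "S x \<in> space (LC I)" if "x \<in> space (LC I)" for x
    using measurable_space[OF S that] .
  \<comment> \<open>Used for translations (e = 1) and for the reflections y -> a - y (e =
    -1).\<close>
  have aff: "(\<integral>\<^sup>+x. f (\<lambda>k\<in>I. e * x k + a k) \<partial>LC I) = integral\<^sup>N (LC I) f"
    if "f \<in> borel_measurable (LC I)" "cmod e = 1" for f a e
  proof -
    have "(\<integral>\<^sup>+x. f (\<lambda>k\<in>I. if k \<in> I then e * x k + a k else x k) \<partial>LC I)
      * ennreal (\<Prod>k\<in>I. (cmod e)\<^sup>2) = integral\<^sup>N (LC I) f"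
      using that by (intro nn_integral_LC_triangular[where ord = ord] I ord) auto
    moreover have "(\<lambda>k\<in>I. if k \<in> I then e * x k + a k else x k) = (\<lambda>k\<in>I. e * x k + a k)" for x
      by auto
    ultimately show ?thesis using that by simp
  qed
  interpret L: finite_product_sigma_finite "\<lambda>_. lborel :: complex measure" I
    by standard (rule I)
  interpret P: pair_sigma_finite "LC I" "LC I" ..
  obtain B where B[measurable]: "B \<in> sets (LC I)" and mB: "emeasure (LC I) B \<noteq> 0" "emeasure (LC I) B \<noteq> \<infinity>"
    using LC_test_set[OF I] .
  define \<kappa> where "\<kappa> = (\<integral>\<^sup>+x. indicator B (T x) \<partial>LC I) / emeasure (LC I) B"
  have "(\<integral>\<^sup>+x. f (T x) \<partial>LC I) = \<kappa> * integral\<^sup>N (LC I) f" if f[measurable]: "f \<in> borel_measurable (LC I)" for f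
  proof -
    have madd[measurable]: "(\<lambda>(x, y). \<lambda>k\<in>I. y k + T x k) \<in> measurable (LC I \<Otimes>\<^sub>M LC I) (LC I)"
      unfolding split_beta by (rule LC_restrictI) measurable
    have msub[measurable]: "(\<lambda>(x, y). \<lambda>k\<in>I. - 1 * y k + T x k) \<in> measurable (LC I \<Otimes>\<^sub>M LC I) (LC I)"
      unfolding split_beta by (rule LC_restrictI) measurable
    have "(\<integral>\<^sup>+x. f (T x) \<partial>LC I) * emeasure (LC I) B
      = (\<integral>\<^sup>+x. f (T x) * (\<integral>\<^sup>+y. indicator B y \<partial>LC I) \<partial>LC I)"
      by (simp add: nn_integral_multc)
    also have "\<dots> = (\<integral>\<^sup>+x. \<integral>\<^sup>+y. f (T x) * indicator B (\<lambda>k\<in>I. y k + T x k) \<partial>LC I \<partial>LC I)"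
    proof (intro nn_integral_cong)
      fix x assume x: "x \<in> space (LC I)"
      have "(\<integral>\<^sup>+y. indicator B y \<partial>LC I) = (\<integral>\<^sup>+y. indicator B (\<lambda>k\<in>I. y k + T x k) \<partial>LC I)"
        using aff[of "indicator B" 1 "T x"] by simp
      moreover have "(\<lambda>y. indicator B (\<lambda>k\<in>I. y k + T x k) :: ennreal) \<in> borel_measurable (LC I)"
        using x by measurable
      ultimately show "f (T x) * (\<integral>\<^sup>+y. indicator B y \<partial>LC I)
        = (\<integral>\<^sup>+y. f (T x) * indicator B (\<lambda>k\<in>I. y k + T x k) \<partial>LC I)"
        by (simp add: nn_integral_cmult)
    qed
    also have "\<dots> = (\<integral>\<^sup>+y. \<integral>\<^sup>+x. f (T x) * indicator B (\<lambda>k\<in>I. y k + T x k) \<partial>LC I \<partial>LC I)"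
      by (rule P.Fubini') measurable
    also have "\<dots> = (\<integral>\<^sup>+y. \<integral>\<^sup>+x. f (\<lambda>k\<in>I. - 1 * y k + T x k) * indicator B (T x) \<partial>LC I \<partial>LC I)"
    proof (rule nn_integral_cong)
      fix y assume y: "y \<in> space (LC I)"
      \<comment> \<open>A preimage of -y under \<open>T\<close>: translating x by it replaces T x by
        T x - y, which moves the variable y from the indicator into f.\<close>
      define a where "a = S (\<lambda>k\<in>I. - y k)"
      have a: "a \<in> space (LC I)" unfolding a_def by (intro Ssp sp)
      have Ta: "T a = (\<lambda>k\<in>I. - y k)" unfolding a_def by (intro TS sp)
      have *: "(\<lambda>x. f (T x) * indicator B (\<lambda>k\<in>I. y k + T x k)) \<in> borel_measurable (LC I)"
        using y by measurable
      have "(\<integral>\<^sup>+x. f (T x) * indicator B (\<lambda>k\<in>I. y k + T x k) \<partial>LC I)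
        = (\<integral>\<^sup>+x. f (T (\<lambda>k\<in>I. 1 * x k + a k)) * indicator B (\<lambda>k\<in>I. y k + T (\<lambda>k\<in>I. 1 * x k + a k) k) \<partial>LC I)"
        using aff[OF *, of 1 a] by simp
      also have "\<dots> = (\<integral>\<^sup>+x. f (\<lambda>k\<in>I. - 1 * y k + T x k) * indicator B (T x) \<partial>LC I)"
      proof (intro nn_integral_cong)
        fix x assume x: "x \<in> space (LC I)"
        have eq: "T (\<lambda>k\<in>I. 1 * x k + a k) = (\<lambda>k\<in>I. - 1 * y k + T x k)"
          using add[OF x a] by (auto simp: Ta restrict_def)
        have "(\<lambda>k\<in>I. y k + T (\<lambda>k\<in>I. 1 * x k + a k) k) = T x"
          unfolding eq using Tsp[OF x] by (auto simp: restrict_def space_LC extensional_def)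
        then show "f (T (\<lambda>k\<in>I. 1 * x k + a k)) * indicator B (\<lambda>k\<in>I. y k + T (\<lambda>k\<in>I. 1 * x k + a k) k)
          = f (\<lambda>k\<in>I. - 1 * y k + T x k) * indicator B (T x)" by (simp only: eq)
      qed
      finally show "(\<integral>\<^sup>+x. f (T x) * indicator B (\<lambda>k\<in>I. y k + T x k) \<partial>LC I)
        = (\<integral>\<^sup>+x. f (\<lambda>k\<in>I. - 1 * y k + T x k) * indicator B (T x) \<partial>LC I)" .
    qed
    also have "\<dots> = (\<integral>\<^sup>+x. \<integral>\<^sup>+y. f (\<lambda>k\<in>I. - 1 * y k + T x k) * indicator B (T x) \<partial>LC I \<partial>LC I)"
      by (rule P.Fubini'[symmetric]) measurable
    also have "\<dots> = (\<integral>\<^sup>+x. integral\<^sup>N (LC I) f * indicator B (T x) \<partial>LC I)"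
    proof (intro nn_integral_cong)
      fix x assume x: "x \<in> space (LC I)"
      have "(\<lambda>y. f (\<lambda>k\<in>I. - 1 * y k + T x k)) \<in> borel_measurable (LC I)"
        using x by measurable
      then show "(\<integral>\<^sup>+y. f (\<lambda>k\<in>I. - 1 * y k + T x k) * indicator B (T x) \<partial>LC I) = integral\<^sup>N (LC I) f * indicator B (T x)"
        using aff[OF f, of "-1" "T x"] by (simp add: nn_integral_multc)
    qed
    also have "\<dots> = (\<integral>\<^sup>+x. indicator B (T x) \<partial>LC I) * integral\<^sup>N (LC I) f"
    proof -
      have "(\<lambda>x. indicator B (T x) :: ennreal) \<in> borel_measurable (LC I)" by measurable
      from nn_integral_cmult[OF this, of "integral\<^sup>N (LC I) f"] show ?thesis by (simp only: mult.commute)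
    qed
    finally have "(\<integral>\<^sup>+x. f (T x) \<partial>LC I) * emeasure (LC I) B = (\<integral>\<^sup>+x. indicator B (T x) \<partial>LC I) * integral\<^sup>N (LC I) f" .
    then have "(\<integral>\<^sup>+x. f (T x) \<partial>LC I) * emeasure (LC I) B / emeasure (LC I) B
      = (\<integral>\<^sup>+x. indicator B (T x) \<partial>LC I) * integral\<^sup>N (LC I) f / emeasure (LC I) B" by simp
    then show ?thesis
      unfolding \<kappa>_def using mB
      by (simp add: ennreal_mult_divide_eq ennreal_divide_times ennreal_times_divide)
  qed
  then show ?thesis by blast
qed

section \<open>Deflation of one eigenvalue\<close>

text \<open>An array of entries is read only through its leading n-by-n block, so
  \<open>cpol n x\<close> and \<open>cpol (Suc n) x\<close> compare a matrix with its own principal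
  block without any restriction map.\<close>

definition cpol :: "nat \<Rightarrow> (nat \<times> nat \<Rightarrow> complex) \<Rightarrow> complex poly" where
  "cpol n x = char_poly (Matrix.mat n n x)"

abbreviation cp :: "nat \<Rightarrow> (nat \<times> nat \<Rightarrow> complex) \<Rightarrow> complex \<Rightarrow> complex" where
  "cp n x z \<equiv> poly (cpol n x) z"

lemma degree_cpol [simp]: "degree (cpol n x) = n" and lead_coeff_cpol: "coeff (cpol n x) n = 1"
  unfolding cpol_def using degree_monic_char_poly[of "Matrix.mat n n x" n] by auto

lemma cpol_nonzero [simp]: "cpol n x \<noteq> 0"
  using lead_coeff_cpol[of n x] by auto

lemma cp_det: "cp n x z = Determinant.det (Matrix.mat n n (\<lambda>(i, j). (if i = j then z else 0) - x (i, j)))"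
proof -
  have "cp n x z = Determinant.det (- (char_matrix (Matrix.mat n n x) z))"
    unfolding cpol_def by (rule char_poly_matrix[of _ n]) simp
  also have "- (char_matrix (Matrix.mat n n x) z) = Matrix.mat n n (\<lambda>(i, j). (if i = j then z else 0) - x (i, j))"
    by (rule eq_matI) (auto simp: char_matrix_def)
  finally show ?thesis .
qed

lemma cp_cong:
  assumes "\<And>i j. i < n \<Longrightarrow> j < n \<Longrightarrow> x (i, j) = y (i, j)"
  shows "cpol n x = cpol n y"
proof -
  have "Matrix.mat n n x = Matrix.mat n n y" using assms by (intro cong_mat) auto
  then show ?thesis by (simp add: cpol_def)
qed

lemma cp_Leibniz:
  "cp n x z = (\<Sum>p | p permutes {0..<n}. of_int (sign p) * (\<Prod>i=0..<n. (if i = p i then z else 0) - x (i, p i)))"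
proof -
  have "p i < n" if "p permutes {0..<n}" "i < n" for p i
    using permutes_in_image[OF that(1), of i] that(2) by simp
  then show ?thesis
    unfolding cp_det by (subst det_def'[of _ n]) (auto intro!: sum.cong prod.cong)
qed

lemma norm_det_cp: "cmod (Determinant.det (Matrix.mat n n x)) = cmod (cp n x 0)"
proof -
  have "cp n x 0 = Determinant.det (- 1 \<cdot>\<^sub>m Matrix.mat n n x)"
    unfolding cp_det by (intro arg_cong[where f = Determinant.det] eq_matI) auto
  then show ?thesis by (simp add: norm_mult norm_power)
qed

text \<open>In the expansion along the last row the cofactors do not see that row, and the cofactor
  of the corner is the characteristic polynomial of the leading block. Consequently the corner that
  makes z an eigenvalue is a rational function of z.\<close>

lemma cp_corner_affine:
  "cp (Suc n) (x((n, n) := a)) z = cp (Suc n) (x((n, n) := 0)) z - a * cp n x z"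
proof -
  let ?M = "\<lambda>b. Matrix.mat (Suc n) (Suc n) (\<lambda>(i, j). (if i = j then z else 0) - (x((n, n) := b)) (i, j))"
  define C where "C j = cofactor (?M 0) n j" for j
  have c: "cofactor (?M b) n j = C j" for j b
  proof -
    have "mat_delete (?M b) n j = mat_delete (?M 0) n j"
      by (rule eq_matI) (auto simp: mat_delete_def)
    then show ?thesis by (simp add: cofactor_def C_def)
  qed
  have del: "mat_delete (?M 0) n n = Matrix.mat n n (\<lambda>(i, j). (if i = j then z else 0) - x (i, j))"
    by (rule eq_matI) (auto simp: mat_delete_def)
  have Cn: "C n = cp n x z"
    unfolding C_def cofactor_def del cp_det by simp
  have "Determinant.det (?M b) = (\<Sum>j<Suc n. ?M b $$ (n, j) * C j)" for b
    unfolding c[of b, symmetric] by (rule laplace_expansion_row) auto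
  then have *: "Determinant.det (?M b) = (\<Sum>j<n. - x (n, j) * C j) + (z - b) * C n" for b
    by simp
  show ?thesis
    unfolding Cn[symmetric] cp_det[of "Suc n"] *[of a] *[of 0] by (simp add: algebra_simps)
qed

lemma cpol_corner_affine:
  "cpol (Suc n) (x((n, n) := a)) = cpol (Suc n) (x((n, n) := 0)) - Polynomial.smult a (cpol n x)"
  by (intro poly_eq_poly_eq_iff[THEN iffD1] ext) (simp add: cp_corner_affine[of n x a])

text \<open>\<open>deflate n x\<close> is \<open>S * M * S\<inverse>\<close> for \<open>M = [[A', 0], [w, \<lambda>]]\<close> and \<open>S = [[1, z], [0, 1]]\<close>, where
  the blocks \<open>A'\<close>, \<open>z\<close>, \<open>w\<close> and \<open>\<lambda>\<close> of \<open>x\<close> are the leading block, the last column, the last row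
  and the corner. The vector \<open>(z, 1)\<close> is an eigenvector for \<open>\<lambda>\<close>.\<close>

definition deflate :: "nat \<Rightarrow> (nat \<times> nat \<Rightarrow> complex) \<Rightarrow> nat \<times> nat \<Rightarrow> complex" where
  "deflate n x = (\<lambda>(i, j)\<in>{..<Suc n} \<times> {..<Suc n}.
     let B = (\<lambda>i j. x (i, j) + x (i, n) * x (n, j)) in
     if i < n then
       if j < n then B i j else x (n, n) * x (i, n) - (\<Sum>k<n. B i k * x (k, n))
     else if j < n then x (n, j) else x (n, n) - (\<Sum>k<n. x (n, k) * x (k, n)))"

section \<open>The similarity behind deflation and the factorization of the characteristic
  polynomial\<close>

definition shear_mat :: "nat \<Rightarrow> (nat \<Rightarrow> complex) \<Rightarrow> complex mat" where
  "shear_mat n z = Matrix.mat (Suc n) (Suc n) (\<lambda>(i, j). if i = j then 1 else if j = n then z i else 0)"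

definition block_tri :: "nat \<Rightarrow> (nat \<times> nat \<Rightarrow> complex) \<Rightarrow> complex mat" where
  "block_tri n x = Matrix.mat (Suc n) (Suc n) (\<lambda>(i, j). if i < n \<and> j = n then 0 else x (i, j))"

lemma shear_mat_carrier [simp]: "shear_mat n z \<in> carrier_mat (Suc n) (Suc n)"
  and block_tri_carrier [simp]: "block_tri n x \<in> carrier_mat (Suc n) (Suc n)"
  by (simp_all add: shear_mat_def block_tri_def)

lemma shear_mat_mult_index:
  assumes "X \<in> carrier_mat (Suc n) (Suc n)" "i \<le> n" "j \<le> n"
  shows "(shear_mat n z * X) $$ (i, j) = X $$ (i, j) + (if i < n then z i * X $$ (n, j) else 0)"
proof -
  have "(shear_mat n z * X) $$ (i, j) = (\<Sum>k<Suc n. shear_mat n z $$ (i, k) * X $$ (k, j))"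
    using assms by (auto simp: scalar_prod_def shear_mat_def atLeast0LessThan intro!: sum.cong)
  also have "\<dots> = (\<Sum>k<n. (if i = k then X $$ (k, j) else 0)) + shear_mat n z $$ (i, n) * X $$ (n, j)"
  proof -
    have "shear_mat n z $$ (i, k) * X $$ (k, j) = (if i = k then X $$ (k, j) else 0)" if "k < n" for k
      using assms(2) that by (auto simp: shear_mat_def)
    then show ?thesis by simp
  qed
  also have "(\<Sum>k<n. (if i = k then X $$ (k, j) else 0)) = (if i < n then X $$ (i, j) else 0)" by simp
  also have "shear_mat n z $$ (i, n) = (if i < n then z i else 1)"
    using assms(2) by (auto simp: shear_mat_def)
  finally show ?thesis using assms(2) by (cases "i < n") (simp_all del: index_mult_mat)
qed

lemma mult_shear_mat_index:
  assumes "X \<in> carrier_mat (Suc n) (Suc n)" "i \<le> n" "j \<le> n"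
  shows "(X * shear_mat n z) $$ (i, j) = X $$ (i, j) + (if j = n then \<Sum>k<n. X $$ (i, k) * z k else 0)"
proof -
  have "(X * shear_mat n z) $$ (i, j) = (\<Sum>k<Suc n. X $$ (i, k) * shear_mat n z $$ (k, j))"
    using assms by (auto simp: scalar_prod_def shear_mat_def atLeast0LessThan intro!: sum.cong)
  also have "\<dots> = (\<Sum>k<n. X $$ (i, k) * shear_mat n z $$ (k, j)) + X $$ (i, n) * (if j = n then 1 else 0)"
    using assms(3) by (auto simp: shear_mat_def)
  also have "(\<Sum>k<n. X $$ (i, k) * shear_mat n z $$ (k, j))
    = (\<Sum>k<n. (if k = j then X $$ (i, k) else 0) + (if j = n then X $$ (i, k) * z k else 0))"
  proof (rule sum.cong)
    fix k assume "k \<in> {..<n}"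
    then show "X $$ (i, k) * shear_mat n z $$ (k, j) = (if k = j then X $$ (i, k) else 0) + (if j = n then X $$ (i, k) * z k else 0)"
      using assms(3) by (auto simp: shear_mat_def)
  qed simp
  also have "\<dots> = (if j < n then X $$ (i, j) else 0) + (if j = n then \<Sum>k<n. X $$ (i, k) * z k else 0)"
    by (simp add: sum.distrib)
  finally show ?thesis using assms(3) by (cases "j = n") (simp_all del: index_mult_mat)
qed

lemma shear_mat_inverse: "shear_mat n z * shear_mat n (\<lambda>i. - z i) = 1\<^sub>m (Suc n)"
proof (rule eq_matI)
  fix i j assume "i < dim_row (1\<^sub>m (Suc n) :: complex mat)" "j < dim_col (1\<^sub>m (Suc n) :: complex mat)"
  then have ij: "i \<le> n" "j \<le> n" by auto
  show "(shear_mat n z * shear_mat n (\<lambda>i. - z i)) $$ (i, j) = (1\<^sub>m (Suc n) :: complex mat) $$ (i, j)"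
    using ij by (subst shear_mat_mult_index) (auto simp: shear_mat_def)
qed (auto simp: shear_mat_def)

lemma deflate_eq:
  "Matrix.mat (Suc n) (Suc n) (deflate n x)
    = shear_mat n (\<lambda>i. x (i, n)) * block_tri n x * shear_mat n (\<lambda>i. - x (i, n))"
proof (rule eq_matI)
  let ?S = "shear_mat n (\<lambda>i. x (i, n))" and ?S' = "shear_mat n (\<lambda>i. - x (i, n))"
  have c: "?S * block_tri n x \<in> carrier_mat (Suc n) (Suc n)" by (rule mult_carrier_mat[of _ _ "Suc n"]) auto
  fix i j assume "i < dim_row (?S * block_tri n x * ?S')" "j < dim_col (?S * block_tri n x * ?S')"
  then have ij: "i \<le> n" "j \<le> n" by (auto simp: shear_mat_def)
  have SB: "(?S * block_tri n x) $$ (i, k) =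
    (if i < n then if k < n then x (i, k) + x (i, n) * x (n, k) else x (i, n) * x (n, n) else x (n, k))"
    if "i \<le> n" "k \<le> n" for i k
    using that by (subst shear_mat_mult_index) (auto simp: block_tri_def)
  show "Matrix.mat (Suc n) (Suc n) (deflate n x) $$ (i, j) = (?S * block_tri n x * ?S') $$ (i, j)"
    using ij by (subst mult_shear_mat_index[OF c])
      (auto simp: SB less_imp_le deflate_def Let_def mult.commute sum_negf simp del: index_mult_mat intro!: sum.cong)
qed (auto simp: shear_mat_def)

text \<open>Similarity passes to the block triangular matrix. Its last column vanishes above the
  corner, so the expansion along that column has a single term.\<close>

lemma cpol_deflate: "cpol (Suc n) (deflate n x) = [:- x (n, n), 1:] * cpol n x"
proof -
  let ?S = "shear_mat n (\<lambda>i. x (i, n))" and ?S' = "shear_mat n (\<lambda>i. - x (i, n))"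
  let ?y = "\<lambda>(i, j). if i < n \<and> j = n then 0 else x (i, j)"
  have "similar_mat (Matrix.mat (Suc n) (Suc n) (deflate n x)) (block_tri n x)"
    using shear_mat_inverse[of n "\<lambda>i. x (i, n)"] shear_mat_inverse[of n "\<lambda>i. - x (i, n)"]
    by (intro similar_matI[of _ _ ?S ?S' "Suc n"]) (auto simp: deflate_eq intro!: mult_carrier_mat[of _ _ "Suc n"])
  then have "cpol (Suc n) (deflate n x) = cpol (Suc n) ?y"
    unfolding cpol_def block_tri_def by (rule char_poly_similar)
  also have "\<dots> = [:- x (n, n), 1:] * cpol n x"
  proof (intro poly_eq_poly_eq_iff[THEN iffD1] ext)
    fix z
    let ?M = "Matrix.mat (Suc n) (Suc n) (\<lambda>(i, j). (if i = j then z else 0) - ?y (i, j))"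
    have "cp (Suc n) ?y z = Determinant.det ?M" by (rule cp_det)
    also have "\<dots> = (\<Sum>i<Suc n. ?M $$ (i, n) * cofactor ?M i n)"
      by (rule laplace_expansion_column) auto
    also have "\<dots> = ?M $$ (n, n) * cofactor ?M n n" by simp
    also have "mat_delete ?M n n = Matrix.mat n n (\<lambda>(i, j). (if i = j then z else 0) - x (i, j))"
      by (rule eq_matI) (auto simp: mat_delete_def)
    then have "cofactor ?M n n = cp n x z" by (simp add: cofactor_def cp_det)
    finally show "cp (Suc n) ?y z = poly ([:- x (n, n), 1:] * cpol n x) z" by (simp add: algebra_simps)
  qed
  finally show ?thesis .
qed

section \<open>Linear maps\<close>

text \<open>For an invertible linear T the number \<kappa> is the reciprocal of the absolute real
  Jacobian determinant. Defined through integrals it is visibly multiplicative under composition,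
  and involutions and inverse pairs determine it without any computation.\<close>

definition scales :: "'i set \<Rightarrow> (('i \<Rightarrow> complex) \<Rightarrow> 'i \<Rightarrow> complex) \<Rightarrow> ennreal \<Rightarrow> bool" where
  "scales I T \<kappa> \<longleftrightarrow> T \<in> measurable (LC I) (LC I) \<and>
    (\<forall>f\<in>borel_measurable (LC I). (\<integral>\<^sup>+x. f (T x) \<partial>LC I) = \<kappa> * integral\<^sup>N (LC I) f)"

lemma scales_comp:
  assumes "scales I T \<kappa>" "scales I S \<mu>"
  shows "scales I (\<lambda>x. T (S x)) (\<kappa> * \<mu>)"
  unfolding scales_def
proof (intro conjI ballI)
  have [measurable]: "T \<in> measurable (LC I) (LC I)" "S \<in> measurable (LC I) (LC I)"
    using assms by (auto simp: scales_def)
  show "(\<lambda>x. T (S x)) \<in> measurable (LC I) (LC I)" by measurable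
  fix f :: "_ \<Rightarrow> ennreal" assume [measurable]: "f \<in> borel_measurable (LC I)"
  have "(\<lambda>x. f (T x)) \<in> borel_measurable (LC I)" by measurable
  then have "(\<integral>\<^sup>+x. f (T (S x)) \<partial>LC I) = \<mu> * (\<integral>\<^sup>+x. f (T x) \<partial>LC I)"
    by (rule assms(2)[unfolded scales_def, THEN conjunct2, THEN bspec])
  also have "(\<integral>\<^sup>+x. f (T x) \<partial>LC I) = \<kappa> * integral\<^sup>N (LC I) f"
    using assms(1) \<open>f \<in> _\<close> unfolding scales_def by blast
  finally show "(\<integral>\<^sup>+x. f (T (S x)) \<partial>LC I) = \<kappa> * \<mu> * integral\<^sup>N (LC I) f"
    by (simp add: mult_ac)
qed

lemma scales_cong:
  assumes "scales I T \<kappa>" "\<And>x. x \<in> space (LC I) \<Longrightarrow> T x = S x"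
  shows "scales I S \<kappa>"
  using assms unfolding scales_def
  by (auto cong: measurable_cong nn_integral_cong)

lemma scales_unique:
  assumes "finite I" "scales I T \<kappa>" "scales I T \<mu>"
  shows "\<kappa> = \<mu>"
proof -
  obtain B where B: "B \<in> sets (LC I)" "emeasure (LC I) B \<noteq> 0" "emeasure (LC I) B \<noteq> \<infinity>"
    using LC_test_set[OF assms(1)] .
  have "indicator B \<in> borel_measurable (LC I)" using B(1) by simp
  then have "\<kappa> * emeasure (LC I) B = \<mu> * emeasure (LC I) B"
    using assms(2,3) B(1) unfolding scales_def by (metis nn_integral_indicator)
  then show ?thesis
    using B(2,3) by (simp add: mult.commute[of _ "emeasure (LC I) B"] ennreal_mult_cancel_left)
qed

lemma scales_id: "scales I (\<lambda>x. x) 1"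
  by (simp add: scales_def)

lemma scales_additive:
  assumes "finite I" "T \<in> measurable (LC I) (LC I)" "S \<in> measurable (LC I) (LC I)"
    and "\<And>x. x \<in> space (LC I) \<Longrightarrow> T (S x) = x"
    and "\<And>x y. x \<in> space (LC I) \<Longrightarrow> y \<in> space (LC I) \<Longrightarrow> T (\<lambda>k\<in>I. x k + y k) = (\<lambda>k\<in>I. T x k + T y k)"
  obtains \<kappa> where "scales I T \<kappa>"
  using nn_integral_LC_additive[OF assms] assms(2) unfolding scales_def by blast

lemma scales_inverse:
  assumes "finite I" "scales I T \<kappa>" "scales I S \<mu>" "\<And>x. x \<in> space (LC I) \<Longrightarrow> T (S x) = x"
  shows "\<kappa> * \<mu> = 1"
  using scales_unique[OF assms(1) scales_cong[OF scales_comp[OF assms(2,3)] assms(4)] scales_id] .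

lemma ennreal_square_eq_1: "x * x = 1 \<Longrightarrow> x = (1 :: ennreal)"
proof (cases x)
  case (real r)
  assume "x * x = 1"
  then have "r * r = 1" using real by (simp flip: ennreal_mult add: ennreal_eq_1)
  then have "r = 1" using real by (simp add: square_eq_1_iff)
  then show ?thesis using real by simp
qed (simp add: ennreal_top_mult)

section \<open>Conjugation of a square matrix preserves Lebesgue measure\<close>

definition sq :: "nat \<Rightarrow> (nat \<times> nat) set" where "sq n = {..<n} \<times> {..<n}"

lemma finite_sq [simp]: "finite (sq n)" by (simp add: sq_def)

definition conj_act :: "nat \<Rightarrow> (nat \<Rightarrow> nat \<Rightarrow> complex) \<Rightarrow> (nat \<Rightarrow> nat \<Rightarrow> complex) \<Rightarrow>
    (nat \<times> nat \<Rightarrow> complex) \<Rightarrow> nat \<times> nat \<Rightarrow> complex" where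
  "conj_act n G H x = (\<lambda>(i, j)\<in>sq n. \<Sum>k<n. \<Sum>l<n. G i k * x (k, l) * H l j)"

lemma LC_restrict_sq:
  assumes "\<And>i j. i < n \<Longrightarrow> j < n \<Longrightarrow> X i j \<in> borel_measurable N"
  shows "(\<lambda>x. \<lambda>(i, j)\<in>sq n. X i j x) \<in> measurable N (LC (sq n))"
  using assms by (intro LC_restrictI) (auto simp: sq_def)

lemma conj_act_measurable: "conj_act n G H \<in> measurable (LC (sq n)) (LC (sq n))"
  unfolding conj_act_def 
  by (intro LC_restrict_sq borel_measurable_sum borel_measurable_times borel_measurable_const LC_coordinate_measurable)
    (auto simp: sq_def)

text \<open>G (H x G) H = (G H) x (G H), so the single relation G H = 1 serves on both
  sides.\<close>

lemma conj_act_inverse: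
  assumes GH: "\<And>i j. i < n \<Longrightarrow> j < n \<Longrightarrow> (\<Sum>k<n. G i k * H k j) = (if i = j then 1 else 0)"
    and x: "x \<in> space (LC (sq n))"
  shows "conj_act n G H (conj_act n H G x) = x"
proof
  fix p :: "nat \<times> nat"
  obtain i j where p: "p = (i, j)" by (cases p)
  show "conj_act n G H (conj_act n H G x) p = x p"
  proof (cases "i < n \<and> j < n")
    case False
    then have "p \<notin> sq n" by (auto simp: p sq_def)
    then show ?thesis using x by (auto simp: p conj_act_def space_LC extensional_def)
  next
    case True
    have "conj_act n G H (conj_act n H G x) p
      = (\<Sum>k<n. \<Sum>l<n. G i k * (\<Sum>k'<n. \<Sum>l'<n. H k k' * x (k', l') * G l' l) * H l j)"
      using True by (simp add: conj_act_def p sq_def)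
    also have "\<dots> = (\<Sum>k<n. \<Sum>l<n. \<Sum>k'<n. \<Sum>l'<n. (G i k * H k k') * (x (k', l') * (G l' l * H l j)))"
      by (simp add: sum_distrib_left sum_distrib_right mult_ac)
    also have "\<dots> = (\<Sum>k'<n. \<Sum>l'<n. \<Sum>k<n. \<Sum>l<n. (G i k * H k k') * (x (k', l') * (G l' l * H l j)))"
    proof -
      have sw: "(\<Sum>k<n. \<Sum>l<n. \<Sum>k'<n. \<Sum>l'<n. h k l k' l') = (\<Sum>k'<n. \<Sum>l'<n. \<Sum>k<n. \<Sum>l<n. h k l k' l')"
        for h :: "nat \<Rightarrow> nat \<Rightarrow> nat \<Rightarrow> nat \<Rightarrow> complex"
      proof -
        have "(\<Sum>k<n. \<Sum>l<n. \<Sum>k'<n. \<Sum>l'<n. h k l k' l')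
          = (\<Sum>p\<in>{..<n}\<times>{..<n}. \<Sum>q\<in>{..<n}\<times>{..<n}. h (fst p) (snd p) (fst q) (snd q))"
          by (simp add: sum.cartesian_product' )
        also have "\<dots> = (\<Sum>q\<in>{..<n}\<times>{..<n}. \<Sum>p\<in>{..<n}\<times>{..<n}. h (fst p) (snd p) (fst q) (snd q))"
          by (rule sum.swap)
        also have "\<dots> = (\<Sum>k'<n. \<Sum>l'<n. \<Sum>k<n. \<Sum>l<n. h k l k' l')"
          by (simp add: sum.cartesian_product' )
        finally show ?thesis .
      qed
      show ?thesis by (rule sw)
    qed
    also have "\<dots> = (\<Sum>k'<n. \<Sum>l'<n. (\<Sum>k<n. G i k * H k k') * (x (k', l') * (\<Sum>l<n. G l' l * H l j)))"
    proof (intro sum.cong refl)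
      fix k' l'
      show "(\<Sum>k<n. \<Sum>l<n. (G i k * H k k') * (x (k', l') * (G l' l * H l j)))
        = (\<Sum>k<n. G i k * H k k') * (x (k', l') * (\<Sum>l<n. G l' l * H l j))"
        by (simp only: sum_distrib_left[of "x (k', l')"] sum_product)
    qed
    also have "\<dots> = (\<Sum>k'<n. \<Sum>l'<n. (if i = k' then 1 else 0) * (x (k', l') * (if l' = j then 1 else 0)))"
      using True by (intro sum.cong) (auto simp: GH)
    also have "\<dots> = (\<Sum>k'<n. if i = k' then x (k', j) else 0)"
      using True by (intro sum.cong) (auto simp: if_distrib cong: if_cong)
    also have "\<dots> = x p" using True by (simp add: p)
    finally show ?thesis .
  qed
qed

text \<open>If \<open>G\<close> and \<open>H = G\<inverse>\<close> are Hermitian, taking adjoints turns \<open>A \<mapsto> G A H\<close> into its own inverse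
  \<open>A \<mapsto> H A G\<close>; hence both have the same scaling factor, whose square is 1.\<close>

lemma nn_integral_conj_act:
  assumes GH: "\<And>i j. i < n \<Longrightarrow> j < n \<Longrightarrow> (\<Sum>k<n. G i k * H k j) = (if i = j then 1 else 0)"
    and HG: "\<And>i j. i < n \<Longrightarrow> j < n \<Longrightarrow> (\<Sum>k<n. H i k * G k j) = (if i = j then 1 else 0)"
    and herm: "\<And>i j. cnj (G i j) = G j i" "\<And>i j. cnj (H i j) = H j i"
    and f: "f \<in> borel_measurable (LC (sq n))"
  shows "(\<integral>\<^sup>+x. f (conj_act n G H x) \<partial>LC (sq n)) = integral\<^sup>N (LC (sq n)) f"
proof -
  have add: "conj_act n G H (\<lambda>k\<in>sq n. x k + y k) = (\<lambda>k\<in>sq n. conj_act n G H x k + conj_act n G H y k)" for G H x y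
    by (auto simp: conj_act_def sq_def algebra_simps sum.distrib intro!: sum.cong)
  define adj where "adj x = (\<lambda>(i, j)\<in>sq n. cnj (x (j, i)))" for x :: "nat \<times> nat \<Rightarrow> complex"
  have adjm: "adj \<in> measurable (LC (sq n)) (LC (sq n))"
    unfolding adj_def
    by (intro LC_restrict_sq borel_measurable_continuous_on[where f = cnj] continuous_on_cnj
        continuous_on_id LC_coordinate_measurable) (simp add: sq_def)
  have adjadj: "adj (adj x) = x" if "x \<in> space (LC (sq n))" for x
    using that by (auto simp: adj_def space_LC sq_def extensional_def)
  have adjadd: "adj (\<lambda>k\<in>sq n. x k + y k) = (\<lambda>k\<in>sq n. adj x k + adj y k)" for x y
    by (auto simp: adj_def sq_def)
  obtain \<kappa> where \<kappa>: "scales (sq n) (conj_act n G H) \<kappa>"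
    by (rule scales_additive[OF finite_sq conj_act_measurable conj_act_measurable conj_act_inverse[OF GH] add])
  \<comment> \<open>Taking adjoints is only conjugate-linear, which is covered because the existence
    of a scaling factor rests on additivity alone.\<close>
  obtain \<mu> where \<mu>: "scales (sq n) adj \<mu>"
    by (rule scales_additive[OF finite_sq adjm adjm adjadj adjadd])
  have \<mu>1: "\<mu> = 1"
    by (rule ennreal_square_eq_1) (rule scales_inverse[OF finite_sq \<mu> \<mu> adjadj])
  have eq: "adj (conj_act n G H (adj x)) = conj_act n H G x" if "x \<in> space (LC (sq n))" for x
  proof
    fix p :: "nat \<times> nat"
    obtain i j where p: "p = (i, j)" by (cases p)
    have "(\<Sum>k<n. \<Sum>l<n. G j k * cnj (x (l, k)) * H l i) = (\<Sum>l<n. \<Sum>k<n. G j k * cnj (x (l, k)) * H l i)"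
      by (rule sum.swap)
    then show "adj (conj_act n G H (adj x)) p = conj_act n H G x p"
      by (auto simp: p adj_def conj_act_def sq_def herm mult_ac)
  qed
  have "scales (sq n) (conj_act n H G) (\<mu> * (\<kappa> * \<mu>))"
    using scales_cong[OF scales_comp[OF \<mu> scales_comp[OF \<kappa> \<mu>]] eq] .
  then have "\<kappa> * (\<mu> * (\<kappa> * \<mu>)) = 1"
    using scales_inverse[OF finite_sq \<kappa> _ conj_act_inverse[OF GH]] by blast
  then have "\<kappa> * \<kappa> = 1" using \<mu>1 by simp
  then have "\<kappa> = 1" by (rule ennreal_square_eq_1)
  then show ?thesis using \<kappa> f by (simp add: scales_def)
qed

section \<open>Multiplication of one column by a fixed matrix\<close>

definition colset :: "nat \<Rightarrow> nat \<Rightarrow> (nat \<times> nat) set" where "colset n m = {..<n} \<times> {m}"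

lemma finite_colset [simp]: "finite (colset n m)" by (simp add: colset_def)

definition colmult :: "nat \<Rightarrow> nat \<Rightarrow> complex mat \<Rightarrow> (nat \<times> nat \<Rightarrow> complex) \<Rightarrow> nat \<times> nat \<Rightarrow> complex" where
  "colmult n m A y = (\<lambda>p\<in>colset n m. \<Sum>k<n. A $$ (fst p, k) * y (k, m))"

lemma colmult_measurable: "colmult n m A \<in> measurable (LC (colset n m)) (LC (colset n m))"
  unfolding colmult_def
  by (intro LC_restrictI borel_measurable_sum borel_measurable_times borel_measurable_const LC_coordinate_measurable)
    (auto simp: colset_def)

lemma colmult_mult:
  assumes "A \<in> carrier_mat n n" "B \<in> carrier_mat n n"
  shows "colmult n m A (colmult n m B y) = colmult n m (A * B) y"
proof
  fix p :: "nat \<times> nat"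
  show "colmult n m A (colmult n m B y) p = colmult n m (A * B) y p"
  proof (cases "p \<in> colset n m")
    case True
    then obtain i where p: "p = (i, m)" "i < n" by (auto simp: colset_def)
    have "colmult n m A (colmult n m B y) p = (\<Sum>k<n. \<Sum>l<n. A $$ (i, k) * B $$ (k, l) * y (l, m))"
      using p by (simp add: colmult_def colset_def sum_distrib_left mult_ac)
    also have "\<dots> = (\<Sum>l<n. \<Sum>k<n. A $$ (i, k) * B $$ (k, l) * y (l, m))"
      by (rule sum.swap)
    also have "\<dots> = (\<Sum>l<n. (A * B) $$ (i, l) * y (l, m))"
    proof (rule sum.cong)
      fix l assume "l \<in> {..<n}"
      then have "(A * B) $$ (i, l) = (\<Sum>k<n. A $$ (i, k) * B $$ (k, l))"
        using assms p by (auto simp: scalar_prod_def atLeast0LessThan)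
      then show "(\<Sum>k<n. A $$ (i, k) * B $$ (k, l) * y (l, m)) = (A * B) $$ (i, l) * y (l, m)"
        by (simp add: sum_distrib_right)
    qed simp
    finally show ?thesis using p by (simp add: colmult_def colset_def)
  qed (simp add: colmult_def)
qed

lemma colmult_one:
  assumes "y \<in> space (LC (colset n m))"
  shows "colmult n m (1\<^sub>m n) y = y"
proof
  fix p :: "nat \<times> nat"
  show "colmult n m (1\<^sub>m n) y p = y p"
  proof (cases "p \<in> colset n m")
    case True
    then obtain i where p: "p = (i, m)" "i < n" by (auto simp: colset_def)
    have "colmult n m (1\<^sub>m n) y p = (\<Sum>k<n. (if i = k then 1 else 0) * y (k, m))"
      using p by (simp add: colmult_def colset_def)
    also have "\<dots> = (\<Sum>k<n. if i = k then y (k, m) else 0)"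
      by (intro sum.cong) auto
    finally show ?thesis using p by simp
  next
    case False
    then show ?thesis using extensional_arb[of y "colset n m" p] assms by (simp add: colmult_def space_LC)
  qed
qed

lemma colmult_scales:
  assumes "A \<in> carrier_mat n n" "B \<in> carrier_mat n n" "A * B = 1\<^sub>m n"
  obtains \<kappa> where "scales (colset n m) (colmult n m A) \<kappa>"
proof (rule scales_additive[OF finite_colset colmult_measurable colmult_measurable])
  show "colmult n m A (colmult n m B x) = x" if "x \<in> space (LC (colset n m))" for x
    using colmult_mult[OF assms(1,2)] colmult_one[OF that] assms(3) by simp
  show "colmult n m A (\<lambda>k\<in>colset n m. x k + y k) = (\<lambda>k\<in>colset n m. colmult n m A x k + colmult n m A y k)" for x y
    by (auto simp: colmult_def colset_def algebra_simps sum.distrib intro!: sum.cong)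
qed (rule that)

text \<open>Entry i of B y involves y i and entries of larger index only, which is a triangular
  update ordered by the row index; the diagonal of B multiplies to its determinant.\<close>

lemma nn_integral_colmult_upper_triangular:
  assumes B: "B \<in> carrier_mat n n" "upper_triangular B" "Determinant.det B \<noteq> 0"
    and f: "f \<in> borel_measurable (LC (colset n m))"
  shows "(\<integral>\<^sup>+y. f (colmult n m B y) \<partial>LC (colset n m)) * ennreal ((cmod (Determinant.det B))\<^sup>2)
    = integral\<^sup>N (LC (colset n m)) f"
proof -
  let ?J = "colset n m"
  have det: "Determinant.det B = (\<Prod>i<n. B $$ (i, i))"
    using det_upper_triangular[OF B(2,1)] B(1) by (simp add: prod_list_diag_prod atLeast0LessThan)
  have diag: "B $$ (i, i) \<noteq> 0" if "i < n" for i
    using B(3) that by (simp add: det)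
  let ?g = "\<lambda>p y. \<Sum>k\<in>{fst p<..<n}. B $$ (fst p, k) * y (k, m)"
  have T: "(\<lambda>p\<in>?J. if p \<in> ?J then B $$ (fst p, fst p) * y p + ?g p y else y p) = colmult n m B y" for y
  proof
    fix p :: "nat \<times> nat"
    show "(\<lambda>p\<in>?J. if p \<in> ?J then B $$ (fst p, fst p) * y p + ?g p y else y p) p = colmult n m B y p"
    proof (cases "p \<in> ?J")
      case True
      then obtain i where p: "p = (i, m)" "i < n" by (auto simp: colset_def)
      have "{..<n} = {..<i} \<union> insert i {i<..<n}" using p by auto
      then have "(\<Sum>k<n. B $$ (i, k) * y (k, m)) = (\<Sum>k\<in>{..<i} \<union> insert i {i<..<n}. B $$ (i, k) * y (k, m))"
        by (rule sum.cong) (rule refl)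
      also have "\<dots> = (\<Sum>k<i. B $$ (i, k) * y (k, m)) + (\<Sum>k\<in>insert i {i<..<n}. B $$ (i, k) * y (k, m))"
        by (rule sum.union_disjoint) auto
      also have "(\<Sum>k<i. B $$ (i, k) * y (k, m)) = 0"
        using upper_triangularD[OF B(2)] B(1) p by (intro sum.neutral) auto
      also have "0 + (\<Sum>k\<in>insert i {i<..<n}. B $$ (i, k) * y (k, m))
        = B $$ (i, i) * y (i, m) + (\<Sum>k\<in>{i<..<n}. B $$ (i, k) * y (k, m))" by simp
      finally have "(\<Sum>k<n. B $$ (i, k) * y (k, m)) = B $$ (i, i) * y (i, m) + (\<Sum>k\<in>{i<..<n}. B $$ (i, k) * y (k, m))" .
      moreover have "(i, m) \<in> ?J" using True p(1) by simp
      ultimately show ?thesis unfolding p(1) colmult_def by (simp only: restrict_apply if_True fst_conv)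
    qed (simp only: colmult_def restrict_apply if_False)
  qed
  have "(\<integral>\<^sup>+y. f (\<lambda>p\<in>?J. if p \<in> ?J then B $$ (fst p, fst p) * y p + ?g p y else y p) \<partial>LC ?J)
    * ennreal (\<Prod>p\<in>?J. (cmod (B $$ (fst p, fst p)))\<^sup>2) = integral\<^sup>N (LC ?J) f"
  proof (rule nn_integral_LC_triangular[where ord = fst])
    show "inj_on fst ?J" by (auto simp: colset_def inj_on_def)
    show "B $$ (fst p, fst p) \<noteq> 0" if "p \<in> ?J" for p using that diag by (auto simp: colset_def)
    show "?g p \<in> borel_measurable (LC ?J)" if "p \<in> ?J" for p
      by (intro borel_measurable_sum borel_measurable_times borel_measurable_const LC_coordinate_measurable)
        (auto simp: colset_def)
    show "?g p x = ?g p y" if "p \<in> ?J" "\<And>i. i \<in> ?J \<Longrightarrow> i \<notin> ?J \<or> fst p < fst i \<Longrightarrow> x i = y i" for p x y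
      using that(2) by (intro sum.cong) (auto simp: colset_def)
  qed (use f in auto)
  moreover have "(\<Prod>p\<in>?J. (cmod (B $$ (fst p, fst p)))\<^sup>2) = (cmod (Determinant.det B))\<^sup>2"
  proof -
    have "(\<Prod>p\<in>?J. (cmod (B $$ (fst p, fst p)))\<^sup>2) = (\<Prod>i<n. (cmod (B $$ (i, i)))\<^sup>2)"
      by (rule prod.reindex_bij_witness[of _ "\<lambda>i. (i, m)" fst]) (auto simp: colset_def)
    then show ?thesis by (simp add: det prod_norm[symmetric] prod_power_distrib)
  qed
  ultimately show ?thesis unfolding T by simp
qed

text \<open>By Schur triangularisation only triangular matrices matter: the factors of the change of
  basis and of its inverse cancel.\<close>

lemma nn_integral_colmult:
  assumes A: "A \<in> carrier_mat n n" "Determinant.det A \<noteq> 0"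
    and f: "f \<in> borel_measurable (LC (colset n m))"
  shows "(\<integral>\<^sup>+y. f (colmult n m A y) \<partial>LC (colset n m)) * ennreal ((cmod (Determinant.det A))\<^sup>2)
    = integral\<^sup>N (LC (colset n m)) f"
proof -
  obtain es where es: "char_poly A = (\<Prod>e\<leftarrow>es. [:- e, 1:])"
    using char_poly_factorized[OF A(1)] by blast
  obtain B P Q where "schur_decomposition A es = (B, P, Q)"
    by (cases "schur_decomposition A es") auto
  from schur_decomposition[OF A(1) es this]
  have wit: "similar_mat_wit A B P Q" and ut: "upper_triangular B" by auto
  note w = similar_mat_witD2[OF A(1) wit]
  have PQ: "P * Q = 1\<^sub>m n" "Q * P = 1\<^sub>m n" "A = P * B * Q"
    and [simp]: "B \<in> carrier_mat n n" "P \<in> carrier_mat n n" "Q \<in> carrier_mat n n"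
    by (fact w)+
  have detB: "Determinant.det A = Determinant.det B"
    by (rule det_similar) (use wit in \<open>unfold similar_mat_def, blast\<close>)
  obtain p where p: "scales (colset n m) (colmult n m P) p"
    using colmult_scales[OF _ _ PQ(1)] by auto
  obtain q where q: "scales (colset n m) (colmult n m Q) q"
    using colmult_scales[OF _ _ PQ(2)] by auto
  have "colmult n m P (colmult n m Q y) = y" if "y \<in> space (LC (colset n m))" for y
    by (simp only: colmult_mult[OF \<open>P \<in> carrier_mat n n\<close> \<open>Q \<in> carrier_mat n n\<close>] PQ(1) colmult_one[OF that])
  then have pq: "p * q = 1"
    by (rule scales_inverse[OF finite_colset p q])
  have d: "Determinant.det B \<noteq> 0" using A(2) detB by simp
  \<comment> \<open>The factor of the triangular matrix, to be sandwiched between the factors p and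
    q of the change of basis with p q = 1.\<close>
  define \<beta> where "\<beta> = inverse (ennreal ((cmod (Determinant.det B))\<^sup>2))"
  have d0: "ennreal ((cmod (Determinant.det B))\<^sup>2) \<noteq> 0" "ennreal ((cmod (Determinant.det B))\<^sup>2) \<noteq> \<top>"
    using d by auto
  have "scales (colset n m) (colmult n m B) \<beta>"
    unfolding scales_def
  proof (intro conjI ballI colmult_measurable)
    fix f :: "_ \<Rightarrow> ennreal" assume "f \<in> borel_measurable (LC (colset n m))"
    from nn_integral_colmult_upper_triangular[OF _ ut d this]
    have "integral\<^sup>N (LC (colset n m)) f
      = (\<integral>\<^sup>+y. f (colmult n m B y) \<partial>LC (colset n m)) * ennreal ((cmod (Determinant.det B))\<^sup>2)" by simp
    then show "(\<integral>\<^sup>+y. f (colmult n m B y) \<partial>LC (colset n m)) = \<beta> * integral\<^sup>N (LC (colset n m)) f"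
      unfolding \<beta>_def using d0 
      by (simp add: mult.commute[of "inverse _"] divide_ennreal_def[symmetric] ennreal_mult_divide_eq)
  qed
  from scales_comp[OF p scales_comp[OF this q]]
  have "scales (colset n m) (\<lambda>y. colmult n m P (colmult n m B (colmult n m Q y))) (p * (\<beta> * q))" .
  moreover have "colmult n m P (colmult n m B (colmult n m Q y)) = colmult n m A y" for y
  proof -
    have "colmult n m P (colmult n m B (colmult n m Q y)) = colmult n m (P * (B * Q)) y"
    proof -
      have "B * Q \<in> carrier_mat n n" by (rule mult_carrier_mat[of _ _ n]) simp_all
      then show ?thesis by (simp only: colmult_mult w)
    qed
    also have "P * (B * Q) = P * B * Q" by (rule assoc_mult_mat[OF w(6) w(5) w(7), symmetric])
    also have "\<dots> = A" by (rule PQ(3)[symmetric])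
    finally show ?thesis .
  qed
  ultimately have "(\<integral>\<^sup>+y. f (colmult n m A y) \<partial>LC (colset n m)) = p * (\<beta> * q) * integral\<^sup>N (LC (colset n m)) f"
    using f by (simp add: scales_def)
  also have "p * (\<beta> * q) = \<beta>"
    using pq by (metis mult.commute mult.left_commute mult.right_neutral)
  finally have "(\<integral>\<^sup>+y. f (colmult n m A y) \<partial>LC (colset n m)) * ennreal ((cmod (Determinant.det B))\<^sup>2)
    = (ennreal ((cmod (Determinant.det B))\<^sup>2) * \<beta>) * integral\<^sup>N (LC (colset n m)) f"
    by (simp only: mult_ac)
  also have "ennreal ((cmod (Determinant.det B))\<^sup>2) * \<beta> = 1"
    unfolding \<beta>_def divide_ennreal_def[symmetric] using d0 by (simp add: less_top)
  finally show ?thesis by (simp add: detB)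
qed

section \<open>Almost every matrix has no eigenvalue in common with its leading block\<close>

lemma cp_measurable:
  assumes "\<And>i j. i < n \<Longrightarrow> j < n \<Longrightarrow> (\<lambda>w. x w (i, j)) \<in> borel_measurable M" "z \<in> borel_measurable M"
  shows "(\<lambda>w. cp n (x w) (z w)) \<in> borel_measurable M"
proof -
  have p: "p i < n" if "p permutes {0..<n}" "i < n" for p i
    using permutes_in_image[OF that(1), of i] that(2) by simp
  have m: "(\<lambda>w. (if i = p i then z w else 0) - x w (i, p i)) \<in> borel_measurable M"
    if "p permutes {0..<n}" "i \<in> {0..<n}" for p i
  proof -
    have "i < n" "p i < n" using that p by auto
    then have "(\<lambda>w. x w (i, p i)) \<in> borel_measurable M" by (rule assms(1))
    moreover have "(\<lambda>w. if b then z w else 0) \<in> borel_measurable M" for b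
      using assms(2) by (cases b) (simp_all only: if_True if_False borel_measurable_const)
    ultimately show ?thesis by (intro borel_measurable_diff)
  qed
  show ?thesis unfolding cp_Leibniz
    by (intro borel_measurable_sum borel_measurable_times borel_measurable_const borel_measurable_prod)
      (rule m, simp_all)
qed

text \<open>The quantifier over the ball is reduced to countably many points: by compactness a continuous
  function has a zero in the open ball iff it takes arbitrarily small values on a countable dense
  subset of some smaller ball.\<close>

lemma measurable_ex_zero_ball:
  fixes h :: "'w \<Rightarrow> complex \<Rightarrow> real"
  assumes cont: "\<And>w. w \<in> space M \<Longrightarrow> continuous_on UNIV (h w)"
    and meas: "\<And>q. (\<lambda>w. h w q) \<in> borel_measurable M"
  shows "{w \<in> space M. \<exists>z\<in>ball 0 r. h w z = 0} \<in> sets M"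
proof -
  obtain D :: "complex set" where D: "countable D" "\<And>X. open X \<Longrightarrow> X \<noteq> {} \<Longrightarrow> \<exists>d\<in>D. d \<in> X"
    using countable_dense_exists by blast
  let ?small = "\<lambda>q k. {w \<in> space M. \<bar>h w q\<bar> < 1 / real (Suc k)}"
  have eq: "{w \<in> space M. \<exists>z\<in>ball 0 r. h w z = 0}
    = (\<Union>m. {w \<in> space M. \<forall>k. w \<in> (\<Union>q\<in>D \<inter> ball 0 (r - 1 / real (Suc m)). ?small q k)})"
  proof (intro equalityI subsetI)
    fix w assume "w \<in> {w \<in> space M. \<exists>z\<in>ball 0 r. h w z = 0}"
    then obtain z where w: "w \<in> space M" and z: "cmod z < r" "h w z = 0" by auto
    obtain m where m: "1 / real (Suc m) < r - cmod z"
      using nat_approx_posE[of "r - cmod z"] z by auto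
    have "\<exists>q\<in>D \<inter> ball 0 (r - 1 / real (Suc m)). w \<in> ?small q k" for k
    proof -
      have "open {q. \<bar>h w q\<bar> < 1 / real (Suc k)}"
        using cont[OF w] by (intro open_Collect_less continuous_on_rabs continuous_intros) 
      then have "open ({q. \<bar>h w q\<bar> < 1 / real (Suc k)} \<inter> ball 0 (r - 1 / real (Suc m)))" by auto
      moreover have "z \<in> {q. \<bar>h w q\<bar> < 1 / real (Suc k)} \<inter> ball 0 (r - 1 / real (Suc m))"
        using z m by (simp del: of_nat_Suc)
      ultimately show ?thesis using D(2) w by blast
    qed
    then show "w \<in> (\<Union>m. {w \<in> space M. \<forall>k. w \<in> (\<Union>q\<in>D \<inter> ball 0 (r - 1 / real (Suc m)). ?small q k)})"
      using w by blast
  next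
    fix w assume "w \<in> (\<Union>m. {w \<in> space M. \<forall>k. w \<in> (\<Union>q\<in>D \<inter> ball 0 (r - 1 / real (Suc m)). ?small q k)})"
    then obtain m where w: "w \<in> space M"
      and "\<forall>k. \<exists>q. q \<in> D \<inter> ball 0 (r - 1 / real (Suc m)) \<and> w \<in> ?small q k" by blast
    then obtain q where q: "\<And>k. q k \<in> ball 0 (r - 1 / real (Suc m))" "\<And>k. \<bar>h w (q k)\<bar> < 1 / real (Suc k)"
      by (auto dest!: choice)
    have "\<forall>k. q k \<in> cball 0 (r - 1 / real (Suc m))" using q(1) by (auto simp: less_imp_le)
    then obtain l \<phi> where l: "l \<in> cball 0 (r - 1 / real (Suc m))" "strict_mono (\<phi> :: nat \<Rightarrow> nat)" "(q \<circ> \<phi>) \<longlonglongrightarrow> l"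
      using compact_cball[unfolded compact_def] by blast
    have "(\<lambda>k. h w (q (\<phi> k))) \<longlonglongrightarrow> h w l"
      using cont[OF w] l(3)[unfolded o_def] by (intro continuous_on_tendsto_compose[of UNIV "h w"]) auto
    moreover have "(\<lambda>k. h w (q (\<phi> k))) \<longlonglongrightarrow> 0"
    proof (rule Lim_null_comparison)
      show "\<forall>\<^sub>F k in sequentially. norm (h w (q (\<phi> k))) \<le> 1 / real (Suc k)"
      proof (rule always_eventually, rule allI)
        fix k
        have "1 / real (Suc (\<phi> k)) \<le> 1 / real (Suc k)"
          using seq_suble[OF l(2), of k] by (simp add: divide_simps)
        then show "norm (h w (q (\<phi> k))) \<le> 1 / real (Suc k)"
          using q(2)[of "\<phi> k"] by simp
      qed
      show "(\<lambda>k. 1 / real (Suc k)) \<longlonglongrightarrow> 0"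
        using LIMSEQ_inverse_real_of_nat by (simp add: inverse_eq_divide)
    qed
    ultimately have "h w l = 0" by (rule LIMSEQ_unique)
    moreover have "l \<in> ball 0 r"
    proof -
      have "cmod l \<le> r - 1 / real (Suc m)" "0 < 1 / real (Suc m)" using l(1) by simp_all
      then show ?thesis unfolding mem_ball dist_0_norm by linarith
    qed
    ultimately show "w \<in> {w \<in> space M. \<exists>z\<in>ball 0 r. h w z = 0}" using w by blast
  qed
  have small: "?small q k \<in> sets M" for q k
  proof -
    have "{w \<in> space M. \<bar>h w q\<bar> < 1 / real (Suc k)} = (\<lambda>w. h w q) -` {t. \<bar>t\<bar> < 1 / real (Suc k)} \<inter> space M"
      by auto
    moreover have "{t::real. \<bar>t\<bar> < 1 / real (Suc k)} \<in> sets borel"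
      by (intro borel_open open_Collect_less continuous_on_rabs continuous_on_id continuous_on_const)
    ultimately show ?thesis using measurable_sets[OF meas] by metis
  qed
  have "countable (D \<inter> ball 0 t)" for t using D(1) by auto
  then have [measurable]: "(\<Union>q\<in>D \<inter> ball 0 t. ?small q k) \<in> sets M" for t k
    by (rule sets.countable_UN''[OF _ small])
  show ?thesis unfolding eq by measurable
qed

lemma continuous_cp: "continuous_on A (cp n x)"
  by (intro continuous_intros)

lemma cp_LC_measurable:
  assumes "sq n \<subseteq> J"
  shows "(\<lambda>x. cp n x z) \<in> borel_measurable (LC J)"
proof (rule cp_measurable[where x = "\<lambda>x. x" and z = "\<lambda>_. z"])
  fix i j assume "i < n" "j < n"
  then have "(i, j) \<in> J" using assms by (auto simp: sq_def)
  then show "(\<lambda>x. x (i, j)) \<in> borel_measurable (LC J)" by (rule LC_coordinate_measurable)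
qed (rule borel_measurable_const)

lemma sets_eigenvalue_ball:
  "{x \<in> space (LC (sq n)). \<exists>z\<in>ball 0 r. cp n x z = 0} \<in> sets (LC (sq n))"
proof -
  have "{x \<in> space (LC (sq n)). \<exists>z\<in>ball 0 r. cmod (cp n x z) = 0} \<in> sets (LC (sq n))"
    by (rule measurable_ex_zero_ball[where h = "\<lambda>x z. cmod (cp n x z)"])
      (rule continuous_on_norm[OF continuous_cp], rule measurable_compose[OF cp_LC_measurable[OF order_refl] borel_measurable_norm])
  then show ?thesis by simp
qed

text \<open>The exceptional set in the larger space is a cylinder over a null set.\<close>

lemma AE_LC_extend:
  assumes I: "finite I" "K \<subseteq> I"
    and [measurable]: "Measurable.pred (LC K) P"
    and AE: "AE x in LC K. P x"
  shows "AE x in LC I. P (restrict x K)"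
proof -
  have [measurable]: "(\<lambda>x. restrict x K) \<in> measurable (LC I) (LC K)"
    using I by (intro measurable_restrict_subset)
  let ?Q = "indicator {y. \<not> P y} :: _ \<Rightarrow> ennreal"
  have [measurable]: "?Q \<in> borel_measurable (LC K)" by measurable
  have "(\<lambda>x. ?Q (restrict x K)) \<in> borel_measurable (LC I)" by measurable
  from nn_integral_LC_block[OF I this]
  have "(\<integral>\<^sup>+x. ?Q (restrict x K) \<partial>LC I) = (\<integral>\<^sup>+x. \<integral>\<^sup>+y. ?Q (restrict (merge (I - K) K (x, y)) K) \<partial>LC K \<partial>LC (I - K))" .
  also have "\<dots> = (\<integral>\<^sup>+x. \<integral>\<^sup>+y. ?Q y \<partial>LC K \<partial>LC (I - K))"
  proof (intro nn_integral_cong)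
    fix x y assume "y \<in> space (LC K)"
    then have "restrict (merge (I - K) K (x, y)) K = y"
      by (simp add: space_LC extensional_restrict)
    then show "?Q (restrict (merge (I - K) K (x, y)) K) = ?Q y" by simp
  qed
  also have "(\<integral>\<^sup>+y. ?Q y \<partial>LC K) = 0"
    using AE by (subst nn_integral_0_iff_AE) (auto simp: indicator_def)
  also have "(\<integral>\<^sup>+x. 0 \<partial>LC (I - K)) = (0 :: ennreal)" by simp
  finally have "(\<integral>\<^sup>+x. ?Q (restrict x K) \<partial>LC I) = 0" .
  then have "AE x in LC I. ?Q (restrict x K) = 0"
    by (subst (asm) nn_integral_0_iff_AE) auto
  then show ?thesis by (auto simp: indicator_def split: if_splits)
qed

text \<open>Sections of the exceptional set in direction i are finite, hence null in the plane, and
  Tonelli applies.\<close>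

lemma AE_LC_coordinate:
  assumes I: "finite I" "i \<in> I"
    and [measurable]: "Measurable.pred (LC I) P"
    and fin: "AE x in LC (I - {i}). finite {t. \<not> P (x(i := t))}"
  shows "AE x in LC I. P x"
proof -
  let ?Q = "indicator {y. \<not> P y} :: _ \<Rightarrow> ennreal"
  have [measurable]: "?Q \<in> borel_measurable (LC I)" by measurable
  have "integral\<^sup>N (LC I) ?Q = (\<integral>\<^sup>+x. 0 \<partial>LC I)"
  proof (rule nn_integral_LC_coordinate[OF I])
    show "AE x in LC (I - {i}). (\<integral>\<^sup>+t. ?Q (x(i := t)) \<partial>lborel) = (\<integral>\<^sup>+t. 0 \<partial>lborel)"
      using fin
    proof eventually_elim
      case (elim x)
      have "(\<integral>\<^sup>+t. ?Q (x(i := t)) \<partial>lborel) = (\<integral>\<^sup>+t. indicator {t. \<not> P (x(i := t))} t \<partial>lborel)"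
        by (intro nn_integral_cong) (auto simp: indicator_def)
      also have "\<dots> = 0"
        using finite_imp_null_set_lborel[OF elim] by (simp add: null_sets_def)
      finally show ?case by simp
    qed
  qed simp_all
  then have "integral\<^sup>N (LC I) ?Q = 0" by simp
  then have "AE x in LC I. ?Q x = 0"
    by (subst (asm) nn_integral_0_iff_AE) auto
  then show ?thesis by (auto simp: indicator_def split: if_splits)
qed

text \<open>A common zero is a zero of |p| + |q|, a single continuous function; the plane is
  exhausted by balls of integer radius.\<close>

lemma pred_no_common_zero:
  fixes p q :: "'w \<Rightarrow> complex \<Rightarrow> complex"
  assumes "\<And>w. w \<in> space M \<Longrightarrow> continuous_on UNIV (p w)" "\<And>w. w \<in> space M \<Longrightarrow> continuous_on UNIV (q w)"
    and "\<And>z. (\<lambda>w. p w z) \<in> borel_measurable M" "\<And>z. (\<lambda>w. q w z) \<in> borel_measurable M"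
  shows "Measurable.pred M (\<lambda>w. \<forall>z. \<not> (p w z = 0 \<and> q w z = 0))"
proof -
  have "{w \<in> space M. \<exists>z\<in>ball 0 (real k). cmod (p w z) + cmod (q w z) = 0} \<in> sets M" for k
  proof (rule measurable_ex_zero_ball[where h = "\<lambda>w z. cmod (p w z) + cmod (q w z)"])
    show "continuous_on UNIV (\<lambda>z. cmod (p w z) + cmod (q w z))" if "w \<in> space M" for w
      by (intro continuous_on_add continuous_on_norm assms(1,2) that)
    show "(\<lambda>w. cmod (p w z) + cmod (q w z)) \<in> borel_measurable M" for z
      by (rule borel_measurable_add[OF measurable_compose[OF assms(3) borel_measurable_norm]
          measurable_compose[OF assms(4) borel_measurable_norm]])
  qed
  then have *: "(\<Union>k. {w \<in> space M. \<exists>z\<in>ball 0 (real k). cmod (p w z) + cmod (q w z) = 0}) \<in> sets M" by auto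
  have "{w \<in> space M. \<forall>z. \<not> (p w z = 0 \<and> q w z = 0)}
    = space M - (\<Union>k. {w \<in> space M. \<exists>z\<in>ball 0 (real k). cmod (p w z) + cmod (q w z) = 0})" (is "?A = ?B")
  proof (intro equalityI subsetI)
    fix w assume w: "w \<in> ?B"
    have False if "p w z = 0" "q w z = 0" for z
    proof -
      obtain k where "cmod z < real k" using reals_Archimedean2 by blast
      then have "z \<in> ball 0 (real k)" "cmod (p w z) + cmod (q w z) = 0" using that by auto
      with w show False by blast
    qed
    then show "w \<in> ?A" using w by blast
  qed (auto simp: add_nonneg_eq_0_iff)
  with * show ?thesis unfolding pred_def by simp
qed

text \<open>The submatrix left after deleting row n and column n + 1 from a matrix of size n + 2,
  except for its corner, which is set to 0 here and restored in
  \<open>cp_two_entries\<close>.\<close>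

definition skip_row :: "nat \<Rightarrow> (nat \<times> nat \<Rightarrow> complex) \<Rightarrow> nat \<times> nat \<Rightarrow> complex" where
  "skip_row n x = (\<lambda>(i, j). if i < n then x (i, j) else if j < n then x (Suc n, j) else 0)"

text \<open>A common root of two consecutive leading characteristic polynomials can be destroyed by moving
  the entries \<open>(n, n + 1)\<close> and \<open>(n + 1, n)\<close>, whose product has the characteristic polynomial of a smaller
  block as its coefficient.\<close>

lemma cp_two_entries:
  "cp (Suc (Suc n)) (x((n, Suc n) := s)) z = cp (Suc (Suc n)) (x((n, Suc n) := 0)) z
    + s * (cp (Suc n) (skip_row n x) z - (z + x (Suc n, n)) * cp n x z)"
proof -
  let ?N = "Suc (Suc n)"
  let ?M = "\<lambda>b. Matrix.mat ?N ?N (\<lambda>(i, j). (if i = j then z else 0) - (x((n, Suc n) := b)) (i, j))"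
  define C where "C j = cofactor (?M 0) n j" for j
  have c: "cofactor (?M b) n j = C j" for j b
  proof -
    have "mat_delete (?M b) n j = mat_delete (?M 0) n j"
      by (rule eq_matI) (auto simp: mat_delete_def)
    then show ?thesis by (simp add: cofactor_def C_def)
  qed
  have "Determinant.det (?M b) = (\<Sum>j<?N. ?M b $$ (n, j) * C j)" for b
    unfolding c[of b, symmetric] by (rule laplace_expansion_row) auto
  also have "(\<Sum>j<?N. ?M b $$ (n, j) * C j) = (\<Sum>j<Suc n. ((if n = j then z else 0) - x (n, j)) * C j) - b * C (Suc n)" for b
  proof -
    have "(\<Sum>j<Suc n. ?M b $$ (n, j) * C j) = (\<Sum>j<Suc n. ((if n = j then z else 0) - x (n, j)) * C j)"
      by (rule sum.cong) auto
    then show ?thesis by (subst sum.lessThan_Suc) simp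
  qed
  finally have *: "Determinant.det (?M b) = (\<Sum>j<Suc n. ((if n = j then z else 0) - x (n, j)) * C j) - b * C (Suc n)" for b .
  \<comment> \<open>The corner of this minor is -x (n + 1, n), with no diagonal z in it. To read the
    minor as z minus a matrix, that matrix needs the corner z + x (n + 1, n).\<close>
  let ?y = "(skip_row n x)((n, n) := z + x (Suc n, n))"
  have "mat_delete (?M 0) n (Suc n) = Matrix.mat (Suc n) (Suc n) (\<lambda>(i, j). (if i = j then z else 0) - ?y (i, j))"
    by (rule eq_matI) (auto simp: mat_delete_def skip_row_def less_Suc_eq)
  then have "C (Suc n) = - cp (Suc n) ?y z"
    unfolding C_def cofactor_def cp_det by simp
  also have "cp (Suc n) ?y z = cp (Suc n) ((skip_row n x)((n, n) := 0)) z - (z + x (Suc n, n)) * cp n (skip_row n x) z"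
    by (rule cp_corner_affine)
  also have "(skip_row n x)((n, n) := 0) = skip_row n x" by (auto simp: skip_row_def)
  also have "cpol n (skip_row n x) = cpol n x" by (rule cp_cong) (simp add: skip_row_def)
  finally have Cn: "C (Suc n) = - (cp (Suc n) (skip_row n x) z - (z + x (Suc n, n)) * cp n x z)" .
  show ?thesis unfolding cp_det[of "?N"] *[of s] *[of 0] Cn by (simp add: algebra_simps)
qed

lemma sq_mono: "n \<le> m \<Longrightarrow> sq n \<subseteq> sq m" by (auto simp: sq_def)

text \<open>Let the polynomials of sizes n and n + 1 have no common root. At each of the finitely
  many roots z of the latter, \<open>?\<beta>\<close> is affine in the entry (n + 1, n) with slope
  minus the value of the former at z, which is nonzero; so only finitely many entries make
  \<open>?\<beta>\<close> vanish at some root. Then the polynomial of size n + 2 is affine in the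
  entry (n, n + 1) with slope \<open>?\<beta>\<close>, and again only finitely many entries produce
  a common root.\<close>

lemma AE_no_common_root:
  "AE x in LC (sq (Suc n)). \<forall>z. \<not> (cp n x z = 0 \<and> cp (Suc n) x z = 0)"
proof (induction n)
  case 0
  have "cpol 0 x = 1" for x
    using degree_cpol[of 0 x] lead_coeff_cpol[of 0 x] by (metis degree_0_id one_pCons)
  then show ?case by simp
next
  case (Suc n)
  let ?N = "Suc (Suc n)"
  let ?I = "sq ?N" and ?a = "(n, Suc n)" and ?w = "(Suc n, n)"
  let ?\<beta> = "\<lambda>x z. cp (Suc n) (skip_row n x) z - (z + x ?w) * cp n x z"
  have sub: "sq (Suc n) \<subseteq> ?I - {?a} - {?w}" "sq (Suc n) \<subseteq> ?I - {?a}" "sq n \<subseteq> ?I - {?a}" "sq (Suc n) \<subseteq> ?I"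
    "sq n \<subseteq> sq (Suc n)"
    by (auto simp: sq_def)
  have 0: "AE x in LC (?I - {?a} - {?w}). \<forall>z. \<not> (cp n (restrict x (sq (Suc n))) z = 0 \<and> cp (Suc n) (restrict x (sq (Suc n))) z = 0)"
  proof (rule AE_LC_extend[OF _ sub(1) _ Suc.IH])
    show "Measurable.pred (LC (sq (Suc n))) (\<lambda>x. \<forall>z. \<not> (cp n x z = 0 \<and> cp (Suc n) x z = 0))"
      by (intro pred_no_common_zero[where p = "cp n" and q = "cp (Suc n)"] continuous_cp cp_LC_measurable sub order_refl)
  qed (intro finite_Diff finite_sq)
  have cpr: "cpol n (restrict x (sq (Suc n))) = cpol n x" "cpol (Suc n) (restrict x (sq (Suc n))) = cpol (Suc n) x" for x
    by (intro cp_cong; simp add: sq_def)+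
  have 1: "AE x in LC (?I - {?a}). \<forall>z. \<not> (cp (Suc n) x z = 0 \<and> ?\<beta> x z = 0)"
  proof (rule AE_LC_coordinate[where i = ?w])
    have "(\<lambda>x. cp (Suc n) (skip_row n x) z) \<in> borel_measurable (LC (?I - {?a}))" for z
    proof (rule cp_measurable[where x = "skip_row n" and z = "\<lambda>_. z"])
      fix i j assume "i < Suc n" "j < Suc n"
      then have "(\<lambda>x. skip_row n x (i, j)) = (\<lambda>x. x (i, j)) \<and> i < n
        \<or> (\<lambda>x. skip_row n x (i, j)) = (\<lambda>x. x (Suc n, j)) \<or> (\<lambda>x. skip_row n x (i, j)) = (\<lambda>x. 0)"
        by (cases "i < n"; cases "j < n") (simp_all add: skip_row_def)
      then show "(\<lambda>x. skip_row n x (i, j)) \<in> borel_measurable (LC (?I - {?a}))"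
        using \<open>j < Suc n\<close> by (elim disjE conjE; simp only:) (auto intro!: LC_coordinate_measurable simp: sq_def)
    qed (rule borel_measurable_const)
    moreover have "(\<lambda>x. x ?w) \<in> borel_measurable (LC (?I - {?a}))"
      by (intro LC_coordinate_measurable) (auto simp: sq_def)
    ultimately show "Measurable.pred (LC (?I - {?a})) (\<lambda>x. \<forall>z. \<not> (cp (Suc n) x z = 0 \<and> ?\<beta> x z = 0))"
      by (intro pred_no_common_zero[where p = "cp (Suc n)" and q = ?\<beta>] continuous_cp cp_LC_measurable sub
          continuous_on_diff continuous_on_mult continuous_on_add continuous_on_id continuous_on_const
          borel_measurable_diff borel_measurable_times borel_measurable_add borel_measurable_const)
    show "AE x in LC (?I - {?a} - {?w}). finite {t. \<not> (\<forall>z. \<not> (cp (Suc n) (x(?w := t)) z = 0 \<and> ?\<beta> (x(?w := t)) z = 0))}"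
      using 0
    proof eventually_elim
      case (elim x)
      have eq: "cpol (Suc n) (x(?w := t)) = cpol (Suc n) x" "cpol n (x(?w := t)) = cpol n x"
        "cpol (Suc n) (skip_row n (x(?w := t))) = cpol (Suc n) (skip_row n x)" for t
        by (intro cp_cong; simp add: skip_row_def)+
      let ?f = "\<lambda>z. cp (Suc n) (skip_row n x) z / cp n x z - z"
      have "{t. \<not> (\<forall>z. \<not> (cp (Suc n) (x(?w := t)) z = 0 \<and> ?\<beta> (x(?w := t)) z = 0))} \<subseteq> ?f ` {z. cp (Suc n) x z = 0}"
      proof
        fix t assume "t \<in> {t. \<not> (\<forall>z. \<not> (cp (Suc n) (x(?w := t)) z = 0 \<and> ?\<beta> (x(?w := t)) z = 0))}"
        then obtain z where z: "cp (Suc n) x z = 0" "cp (Suc n) (skip_row n x) z - (z + t) * cp n x z = 0"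
          by (auto simp: eq)
        moreover from z(1) have "cp n x z \<noteq> 0" using elim by (auto simp: cpr)
        ultimately have "t = ?f z" by (simp add: field_simps)
        with z(1) show "t \<in> ?f ` {z. cp (Suc n) x z = 0}" by blast
      qed
      then show ?case by (rule finite_subset) (intro finite_imageI poly_roots_finite cpol_nonzero)
    qed
  qed (auto simp: sq_def)
  show ?case
  proof (rule AE_LC_coordinate[where i = ?a])
    show "Measurable.pred (LC ?I) (\<lambda>x. \<forall>z. \<not> (cp (Suc n) x z = 0 \<and> cp ?N x z = 0))"
      by (intro pred_no_common_zero[where p = "cp (Suc n)" and q = "cp ?N"] continuous_cp cp_LC_measurable sub order_refl)
    show "AE x in LC (?I - {?a}). finite {t. \<not> (\<forall>z. \<not> (cp (Suc n) (x(?a := t)) z = 0 \<and> cp ?N (x(?a := t)) z = 0))}"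
      using 1
    proof eventually_elim
      case (elim x)
      have eq: "cpol (Suc n) (x(?a := t)) = cpol (Suc n) x" for t
        by (intro cp_cong) simp
      let ?f = "\<lambda>z. - cp ?N (x(?a := 0)) z / ?\<beta> x z"
      have "{t. \<not> (\<forall>z. \<not> (cp (Suc n) (x(?a := t)) z = 0 \<and> cp ?N (x(?a := t)) z = 0))} \<subseteq> ?f ` {z. cp (Suc n) x z = 0}"
      proof
        fix t assume "t \<in> {t. \<not> (\<forall>z. \<not> (cp (Suc n) (x(?a := t)) z = 0 \<and> cp ?N (x(?a := t)) z = 0))}"
        then obtain z where z: "cp (Suc n) x z = 0" "cp ?N (x(?a := t)) z = 0"
          by (auto simp: eq)
        have "?\<beta> x z \<noteq> 0" using elim z(1) by auto
        moreover have "cp ?N (x(?a := 0)) z + t * ?\<beta> x z = 0"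
          using z(2) unfolding cp_two_entries[of n x t] .
        then have "t * ?\<beta> x z = - cp ?N (x(?a := 0)) z"
          by (simp only: eq_neg_iff_add_eq_0 add.commute)
        ultimately have "t = ?f z" by (rule eq_divide_imp)
        with z(1) show "t \<in> ?f ` {z. cp (Suc n) x z = 0}" by blast
      qed
      then show ?case by (rule finite_subset) (intro finite_imageI poly_roots_finite cpol_nonzero)
    qed
  qed (auto simp: sq_def)
qed

section \<open>The deflation formula\<close>

text \<open>The derivative is a limit of difference quotients with steps 1 / (k + 1), so
  measurability of the characteristic polynomial at a variable point is enough.\<close>

lemma pderiv_cp_measurable:
  assumes "\<And>i j. i < n \<Longrightarrow> j < n \<Longrightarrow> (\<lambda>w. x w (i, j)) \<in> borel_measurable M" "z \<in> borel_measurable M"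
  shows "(\<lambda>w. poly (pderiv (cpol n (x w))) (z w)) \<in> borel_measurable M"
proof (rule borel_measurable_LIMSEQ_metric)
  let ?h = "\<lambda>k. complex_of_real (1 / real (Suc k))"
  show "(\<lambda>w. (cp n (x w) (z w + ?h k) - cp n (x w) (z w)) / ?h k) \<in> borel_measurable M" for k
  proof (rule borel_measurable_divide[OF borel_measurable_diff borel_measurable_const])
    show "(\<lambda>w. cp n (x w) (z w + ?h k)) \<in> borel_measurable M"
      by (rule cp_measurable[where x = x and z = "\<lambda>w. z w + ?h k"])
        (erule (1) assms(1), rule borel_measurable_add[OF assms(2) borel_measurable_const])
    show "(\<lambda>w. cp n (x w) (z w)) \<in> borel_measurable M"
      by (rule cp_measurable[where x = x and z = z]) (erule (1) assms(1), rule assms(2))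
  qed
  fix w
  have "((\<lambda>h. (cp n (x w) (z w + h) - cp n (x w) (z w)) / h) \<longlongrightarrow> poly (pderiv (cpol n (x w))) (z w)) (at 0)"
    using poly_DERIV[of "cpol n (x w)" "z w"] by (simp add: DERIV_def)
  moreover have "filterlim ?h (at 0) sequentially"
    unfolding filterlim_at
  proof
    show "?h \<longlonglongrightarrow> 0"
      using tendsto_of_real[OF LIMSEQ_inverse_real_of_nat, where 'a = complex] by (simp add: inverse_eq_divide del: of_nat_Suc)
  qed (auto simp del: of_nat_Suc)
  ultimately show "(\<lambda>k. (cp n (x w) (z w + ?h k) - cp n (x w) (z w)) / ?h k) \<longlonglongrightarrow> poly (pderiv (cpol n (x w))) (z w)"
    by (rule filterlim_compose)
qed

text \<open>The corner of \<open>x\<close> holds a candidate eigenvalue \<open>\<lambda>\<close>, and \<open>corner_val\<close> is the corner entry that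
  turns \<open>\<lambda>\<close> into an eigenvalue; \<open>colsub\<close> is the substitution \<open>b = (\<lambda> - B) z\<close> in the last column \<open>b\<close>
  for the leading block \<open>B\<close>.\<close>

definition corner_val :: "nat \<Rightarrow> (nat \<times> nat \<Rightarrow> complex) \<Rightarrow> complex" where
  "corner_val n x = cp (Suc n) (x((n, n) := 0)) (x (n, n)) / cp n x (x (n, n))"

text \<open>The derivative of \<open>corner_val\<close> in the corner variable, by the quotient rule
  and in the shape of the fibre formula. It is 0 where the denominator vanishes.\<close>

definition corner_deriv :: "nat \<Rightarrow> (nat \<times> nat \<Rightarrow> complex) \<Rightarrow> complex" where
  "corner_deriv n x = (let P = cpol (Suc n) (x((n, n) := 0)); Q = cpol n x; z = x (n, n) in
     poly (pderiv P * Q - P * pderiv Q) z / (poly Q z)\<^sup>2)"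

definition colsub :: "nat \<Rightarrow> (nat \<times> nat \<Rightarrow> complex) \<Rightarrow> nat \<times> nat \<Rightarrow> complex" where
  "colsub n x = (\<lambda>p\<in>sq (Suc n). if p \<in> colset n n
     then \<Sum>k<n. ((if fst p = k then x (n, n) else 0) - x (fst p, k)) * x (k, n) else x p)"

text \<open>Adds the product of the last column and the last row to the leading block, as
  conjugation by the shear does. The factor 1 keeps the shape of a triangular update.\<close>

definition blockshift :: "nat \<Rightarrow> (nat \<times> nat \<Rightarrow> complex) \<Rightarrow> nat \<times> nat \<Rightarrow> complex" where
  "blockshift n x = (\<lambda>p\<in>sq (Suc n). if p \<in> sq n then 1 * x p + x (fst p, n) * x (n, snd p) else x p)"

lemma coord_sq: "i \<le> n \<Longrightarrow> j \<le> n \<Longrightarrow> (\<lambda>x. x (i, j)) \<in> borel_measurable (LC (sq (Suc n)))"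
  by (intro LC_coordinate_measurable) (auto simp: sq_def)

lemma corner_measurable:
  shows corner_val_measurable: "corner_val n \<in> borel_measurable (LC (sq (Suc n)))"
    and corner_deriv_measurable: "corner_deriv n \<in> borel_measurable (LC (sq (Suc n)))"
proof -
  let ?M = "LC (sq (Suc n))"
  have c: "(\<lambda>x. x (n, n)) \<in> borel_measurable ?M" by (rule coord_sq) auto
  have e0: "(\<lambda>x. (x((n, n) := 0)) (i, j)) \<in> borel_measurable ?M" if "i < Suc n" "j < Suc n" for i j
  proof (cases "i = n \<and> j = n")
    case True
    then have "(\<lambda>x. (x((n, n) := 0)) (i, j)) = (\<lambda>_. 0 :: complex)" by simp
    then show ?thesis by (simp only: borel_measurable_const)
  next
    case False
    then have eq: "(\<lambda>x. (x((n, n) := 0)) (i, j)) = (\<lambda>x. x (i, j))" by auto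
    show ?thesis unfolding eq using that by (intro coord_sq) simp_all
  qed
  have e: "(\<lambda>x. x (i, j)) \<in> borel_measurable ?M" if "i < n" "j < n" for i j
    using that by (intro coord_sq) simp_all
  have P: "(\<lambda>x. cp (Suc n) (x((n, n) := 0)) (x (n, n))) \<in> borel_measurable ?M"
    "(\<lambda>x. poly (pderiv (cpol (Suc n) (x((n, n) := 0)))) (x (n, n))) \<in> borel_measurable ?M"
    by (rule cp_measurable[where x = "\<lambda>x. x((n, n) := 0)" and z = "\<lambda>x. x (n, n)"]
        pderiv_cp_measurable[where x = "\<lambda>x. x((n, n) := 0)" and z = "\<lambda>x. x (n, n)"];
      (erule (1) e0 | rule c))+
  have Q: "(\<lambda>x. cp n x (x (n, n))) \<in> borel_measurable ?M"
    "(\<lambda>x. poly (pderiv (cpol n x)) (x (n, n))) \<in> borel_measurable ?M"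
    by (rule cp_measurable[where x = "\<lambda>x. x" and z = "\<lambda>x. x (n, n)"]
        pderiv_cp_measurable[where x = "\<lambda>x. x" and z = "\<lambda>x. x (n, n)"];
      (erule (1) e | rule c))+
  show "corner_val n \<in> borel_measurable ?M"
    unfolding corner_val_def[abs_def] by (rule borel_measurable_divide[OF P(1) Q(1)])
  show "corner_deriv n \<in> borel_measurable ?M"
    unfolding corner_deriv_def[abs_def] Let_def poly_diff poly_mult
    by (intro borel_measurable_divide borel_measurable_diff borel_measurable_times borel_measurable_power P Q)
qed

lemma corner_update_measurable:
  "(\<lambda>x. x((n, n) := corner_val n x)) \<in> measurable (LC (sq (Suc n))) (LC (sq (Suc n)))"
proof (rule measurable_fun_upd[where J = "sq (Suc n)"])
  show "sq (Suc n) = sq (Suc n) \<union> {(n, n)}" by (auto simp: sq_def)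
  show "corner_val n \<in> measurable (LC (sq (Suc n))) lborel"
    using corner_val_measurable[of n] by (rule measurable_cong_sets[OF refl sets_lborel, THEN equalityD2, THEN subsetD])
qed (rule measurable_ident_sets[OF refl])

text \<open>With the other entries frozen, \<open>corner_val\<close> is the quotient of a polynomial
  of degree n + 1 by one of degree n. They are coprime for almost every choice of these entries, and
  the fibre formula counts n + 1 preimages.\<close>

lemma nn_integral_corner:
  assumes F: "F \<in> borel_measurable (LC (sq (Suc n)))"
  shows "(\<integral>\<^sup>+x. F (x((n, n) := corner_val n x)) * ennreal ((cmod (corner_deriv n x))\<^sup>2) \<partial>LC (sq (Suc n)))
    = of_nat (Suc n) * integral\<^sup>N (LC (sq (Suc n))) F"
proof -
  let ?I = "sq (Suc n)" and ?c = "(n, n)"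
  have c: "?c \<in> ?I" by (simp add: sq_def)
  have ins: "insert ?c (?I - {?c}) = ?I" using c by auto
  have g: "(\<lambda>x. F (x(?c := corner_val n x)) * ennreal ((cmod (corner_deriv n x))\<^sup>2)) \<in> borel_measurable (LC ?I)"
    by (intro borel_measurable_times_ennreal measurable_compose[OF corner_update_measurable F]
      measurable_compose[OF _ measurable_ennreal] borel_measurable_power
      measurable_compose[OF corner_deriv_measurable borel_measurable_norm])
  have "(\<integral>\<^sup>+x. F (x(?c := corner_val n x)) * ennreal ((cmod (corner_deriv n x))\<^sup>2) \<partial>LC ?I)
    = (\<integral>\<^sup>+x. of_nat (Suc n) * F x \<partial>LC ?I)"
  proof (rule nn_integral_LC_coordinate[OF finite_sq c g])
    show "(\<lambda>x. of_nat (Suc n) * F x) \<in> borel_measurable (LC ?I)"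
      using F by (intro borel_measurable_times_ennreal borel_measurable_const)
    have "AE x in LC (?I - {?c}). \<forall>t z. \<not> (cp n (x(?c := t)) z = 0 \<and> cp (Suc n) (x(?c := t)) z = 0)"
    proof (rule AE_LC_drop_coordinate[OF finite_sq c _ AE_no_common_root])
      show "Measurable.pred (LC ?I) (\<lambda>x. \<forall>z. \<not> (cp n x z = 0 \<and> cp (Suc n) x z = 0))"
        by (intro pred_no_common_zero[where p = "cp n" and q = "cp (Suc n)"] continuous_cp cp_LC_measurable
          order_refl sq_mono) simp
      \<comment> \<open>A new corner changes the larger polynomial by a multiple of
        \<open>cpol n x\<close>. The common roots therefore do not depend on the corner, and the
        property descends to the remaining entries.\<close>
      have "cpol n (x(?c := s)) = cpol n x" for x s by (rule cp_cong) simp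
      then show "\<forall>z. \<not> (cp n (x(?c := t)) z = 0 \<and> cp (Suc n) (x(?c := t)) z = 0)"
        if "\<forall>z. \<not> (cp n (x(?c := s)) z = 0 \<and> cp (Suc n) (x(?c := s)) z = 0)" for x s t
        using that cp_corner_affine[of n x t] cp_corner_affine[of n x s] by auto
    qed
    then show "AE x in LC (?I - {?c}).
      (\<integral>\<^sup>+t. F ((x(?c := t))(?c := corner_val n (x(?c := t)))) * ennreal ((cmod (corner_deriv n (x(?c := t))))\<^sup>2) \<partial>lborel)
      = (\<integral>\<^sup>+t. of_nat (Suc n) * F (x(?c := t)) \<partial>lborel)"
      using AE_space
    proof eventually_elim
      case (elim x)
      have m: "(\<lambda>t. x(?c := t)) \<in> measurable lborel (LC ?I)"
        using measurable_component_update[of x "?I - {?c}" "\<lambda>_. lborel" ?c] elim(2) unfolding ins by simp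
      then have Fm: "(\<lambda>t. F (x(?c := t))) \<in> borel_measurable borel"
        using measurable_compose[OF m F] by simp
      let ?P = "cpol (Suc n) (x(?c := 0))" and ?Q = "cpol n x"
      have Q: "cpol n (x(?c := t)) = ?Q" for t by (rule cp_cong) simp
      have "poly ?Q z \<noteq> 0" if "poly ?P z = 0" for z
        using elim(1)[rule_format, of 0 z] that by (simp add: Q)
      from nn_integral_rational_fibre[OF _ this Fm]
      show ?case
        using nn_integral_cmult[of "\<lambda>t. F (x(?c := t))" lborel "of_nat (Suc n)"] Fm
        by (simp add: corner_val_def corner_deriv_def Let_def Q)
    qed
  qed
  also have "\<dots> = of_nat (Suc n) * integral\<^sup>N (LC ?I) F"
    by (rule nn_integral_cmult[OF F])
  finally show ?thesis .
qed

lemma colsub_measurable: "colsub n \<in> measurable (LC (sq (Suc n))) (LC (sq (Suc n)))"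
  unfolding colsub_def[abs_def]
proof (rule LC_restrictI)
  fix p assume p: "p \<in> sq (Suc n)"
  have e: "(\<lambda>x. if b then x (n, n) else 0) \<in> borel_measurable (LC (sq (Suc n)))" for b
    using coord_sq[OF order_refl order_refl, of n] by (cases b) (simp_all only: if_True if_False borel_measurable_const)
  show "(\<lambda>x. if p \<in> colset n n then \<Sum>k<n. ((if fst p = k then x (n, n) else 0) - x (fst p, k)) * x (k, n) else x p)
    \<in> borel_measurable (LC (sq (Suc n)))"
  proof (cases "p \<in> colset n n")
    case True
    then have "fst p < n" by (auto simp: colset_def)
    then have "(\<lambda>x. \<Sum>k<n. ((if fst p = k then x (n, n) else 0) - x (fst p, k)) * x (k, n)) \<in> borel_measurable (LC (sq (Suc n)))"
      by (intro borel_measurable_sum borel_measurable_times borel_measurable_diff e coord_sq) auto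
    then show ?thesis by (simp only: True if_True)
  next
    case False
    then show ?thesis using LC_coordinate_measurable[OF p] by (simp only: if_False)
  qed
qed

text \<open>For a frozen corner \<lambda> and leading block B the map multiplies the last column by
  \<lambda> - B, whose determinant is the weight. Where it is singular both inner integrals vanish,
  the right one by the assumption on \<open>G\<close>.\<close>

lemma nn_integral_colsub:
  assumes G: "G \<in> borel_measurable (LC (sq (Suc n)))"
    and G0: "\<And>x. cp n x (x (n, n)) = 0 \<Longrightarrow> G x = 0"
  shows "(\<integral>\<^sup>+x. G (colsub n x) * ennreal ((cmod (cp n x (x (n, n))))\<^sup>2) \<partial>LC (sq (Suc n)))
    = integral\<^sup>N (LC (sq (Suc n))) G"
proof -
  let ?I = "sq (Suc n)" and ?J = "colset n n"
  have J: "?J \<subseteq> ?I" by (auto simp: sq_def colset_def)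
  have cpm: "(\<lambda>x. cp n x (x (n, n))) \<in> borel_measurable (LC ?I)"
    by (rule cp_measurable[where x = "\<lambda>x. x" and z = "\<lambda>x. x (n, n)"]; rule coord_sq; simp)
  have g: "(\<lambda>x. G (colsub n x) * ennreal ((cmod (cp n x (x (n, n))))\<^sup>2)) \<in> borel_measurable (LC ?I)"
    by (intro borel_measurable_times_ennreal measurable_compose[OF colsub_measurable G]
      measurable_compose[OF _ measurable_ennreal] borel_measurable_power
      measurable_compose[OF cpm borel_measurable_norm])
  have inner: "(\<integral>\<^sup>+y. G (colsub n (merge (?I - ?J) ?J (x, y))) * ennreal ((cmod (cp n (merge (?I - ?J) ?J (x, y)) (merge (?I - ?J) ?J (x, y) (n, n))))\<^sup>2) \<partial>LC ?J)
    = (\<integral>\<^sup>+y. G (merge (?I - ?J) ?J (x, y)) \<partial>LC ?J)" if x: "x \<in> space (LC (?I - ?J))" for x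
  proof -
    define A where "A = Matrix.mat n n (\<lambda>(i, j). (if i = j then x (n, n) else 0) - x (i, j))"
    let ?m = "\<lambda>y. merge (?I - ?J) ?J (x, y)"
    have mrest: "?m y p = x p" if "p \<in> ?I" "p \<notin> ?J" for y p using that by (simp add: merge_def)
    have mcol: "?m y p = y p" if "p \<in> ?J" for y p using that by (simp add: merge_def)
    have corner: "?m y (n, n) = x (n, n)" for y by (rule mrest) (auto simp: sq_def colset_def)
    have cpm: "cpol n (?m y) = cpol n x" for y
      by (rule cp_cong, rule mrest) (auto simp: sq_def colset_def)
    have detA: "Determinant.det A = cp n x (x (n, n))" unfolding A_def cp_det ..
    have cs: "colsub n (?m y) = ?m (colmult n n A y)" for y
    proof
      fix p
      consider "p \<in> ?J" | "p \<in> ?I - ?J" | "p \<notin> ?I" by blast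
      then show "colsub n (?m y) p = ?m (colmult n n A y) p"
      proof cases
        case 1
        then obtain i where p: "p = (i, n)" "i < n" by (auto simp: colset_def)
        have "colsub n (?m y) p = (\<Sum>k<n. ((if i = k then x (n, n) else 0) - ?m y (i, k)) * ?m y (k, n))"
          using 1 J p by (auto simp: colsub_def corner cong: if_cong)
        also have "\<dots> = (\<Sum>k<n. A $$ (i, k) * y (k, n))"
        proof (rule sum.cong)
          fix k assume "k \<in> {..<n}"
          then have "?m y (i, k) = x (i, k)" "?m y (k, n) = y (k, n)"
            using p by (auto intro!: mrest mcol simp: sq_def colset_def)
          then show "((if i = k then x (n, n) else 0) - ?m y (i, k)) * ?m y (k, n) = A $$ (i, k) * y (k, n)"
            using p \<open>k \<in> {..<n}\<close> by (simp add: A_def)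
        qed simp
        also have "\<dots> = ?m (colmult n n A y) p"
          using 1 mcol[OF 1, of "colmult n n A y"] p by (simp add: colmult_def)
        finally show ?thesis .
      next
        case 2
        then show ?thesis by (simp add: colsub_def merge_def)
      next
        case 3
        then show ?thesis using J by (auto simp: colsub_def merge_def)
      qed
    qed
    show ?thesis
    proof (cases "Determinant.det A = 0")
      case True
      then have "G (?m y) = 0" for y by (intro G0) (simp add: cpm corner detA)
      then show ?thesis using True by (simp add: cpm corner detA)
    next
      case False
      have IJ: "(?I - ?J) \<union> ?J = ?I" using J by auto
      have "merge (?I - ?J) ?J \<in> measurable (LC (?I - ?J) \<Otimes>\<^sub>M LC ?J) (LC ?I)"
        using measurable_merge[of "?I - ?J" ?J "\<lambda>_. lborel :: complex measure"] unfolding IJ .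
      from measurable_compose[OF measurable_Pair1'[OF x] this]
      have "(\<lambda>y. ?m y) \<in> measurable (LC ?J) (LC ?I)" .
      from measurable_compose[OF this G]
      have Gm: "(\<lambda>y. G (?m y)) \<in> borel_measurable (LC ?J)" .
      have "(\<integral>\<^sup>+y. G (colsub n (?m y)) * ennreal ((cmod (cp n (?m y) (?m y (n, n))))\<^sup>2) \<partial>LC ?J)
        = (\<integral>\<^sup>+y. G (?m (colmult n n A y)) * ennreal ((cmod (Determinant.det A))\<^sup>2) \<partial>LC ?J)"
        by (simp add: cpm corner detA cs)
      also have "\<dots> = (\<integral>\<^sup>+y. G (?m (colmult n n A y)) \<partial>LC ?J) * ennreal ((cmod (Determinant.det A))\<^sup>2)"
        by (rule nn_integral_multc) (rule measurable_compose[OF colmult_measurable Gm])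
      also have "\<dots> = (\<integral>\<^sup>+y. G (?m y) \<partial>LC ?J)"
        by (rule nn_integral_colmult[OF _ False Gm]) (simp add: A_def)
      finally show ?thesis .
    qed
  qed
  show ?thesis
    unfolding nn_integral_LC_block[OF finite_sq J g] nn_integral_LC_block[OF finite_sq J G]
    by (rule nn_integral_cong) (rule inner)
qed

lemma blockshift_measurable: "blockshift n \<in> measurable (LC (sq (Suc n))) (LC (sq (Suc n)))"
  unfolding blockshift_def[abs_def]
proof (rule LC_restrictI)
  fix p assume p: "p \<in> sq (Suc n)"
  then have "fst p \<le> n" "snd p \<le> n" by (auto simp: sq_def)
  then have "(\<lambda>x. 1 * x p + x (fst p, n) * x (n, snd p)) \<in> borel_measurable (LC (sq (Suc n)))"
    by (intro borel_measurable_add borel_measurable_times borel_measurable_const coord_sq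
      LC_coordinate_measurable[OF p] order_refl)
  then show "(\<lambda>x. if p \<in> sq n then 1 * x p + x (fst p, n) * x (n, snd p) else x p) \<in> borel_measurable (LC (sq (Suc n)))"
    using LC_coordinate_measurable[OF p] by (cases "p \<in> sq n") (simp_all only: if_True if_False)
qed

text \<open>The added term reads only entries outside the leading block, so the triangularity
  condition holds for any enumeration of the block; \<open>prod_encode\<close> is one.\<close>

lemma nn_integral_blockshift:
  assumes H: "H \<in> borel_measurable (LC (sq (Suc n)))"
  shows "(\<integral>\<^sup>+x. H (blockshift n x) \<partial>LC (sq (Suc n))) = integral\<^sup>N (LC (sq (Suc n))) H"
proof -
  let ?g = "\<lambda>p x. x (fst p, n) * x (n, snd p)"
  have "(\<integral>\<^sup>+x. H (\<lambda>k\<in>sq (Suc n). if k \<in> sq n then 1 * x k + ?g k x else x k) \<partial>LC (sq (Suc n)))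
      * ennreal (\<Prod>k\<in>sq n. (cmod 1)\<^sup>2) = integral\<^sup>N (LC (sq (Suc n))) H"
  proof (rule nn_integral_LC_triangular[where ord = prod_encode])
    show "inj_on prod_encode (sq n)" by (rule inj_prod_encode)
    show "?g k \<in> borel_measurable (LC (sq (Suc n)))" if "k \<in> sq n" for k
      using that by (intro borel_measurable_times coord_sq) (auto simp: sq_def)
    show "?g k x = ?g k y"
      if "k \<in> sq n" "\<And>i. i \<in> sq (Suc n) \<Longrightarrow> i \<notin> sq n \<or> prod_encode k < prod_encode i \<Longrightarrow> x i = y i" for k x y
    proof -
      have "x (fst k, n) = y (fst k, n)" "x (n, snd k) = y (n, snd k)"
        using that(1) by (auto intro!: that(2) simp: sq_def)
      then show ?thesis by simp
    qed
  qed (use H in \<open>auto simp: sq_def\<close>)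
  then show ?thesis by (simp add: blockshift_def)
qed

text \<open>After \<open>blockshift\<close> and \<open>colsub\<close> only the corner differs from
  the deflated matrix: it still holds \<lambda> instead of the true value d. Factoring out the
  eigenvalue gives P - d Q' = (t - \<lambda>) * \<open>cpol n x\<close>. At t = \<lambda> this says
  P / Q' = d, and its derivative there supplies the numerator of
  \<open>corner_deriv\<close>.\<close>

lemma corner_fibre:
  assumes Q: "cp n (blockshift n x) (x (n, n)) \<noteq> 0"
  defines "v \<equiv> colsub n (blockshift n x)"
  shows "v((n, n) := corner_val n v) = deflate n x"
    and "corner_deriv n v = cp n x (x (n, n)) / cp n (blockshift n x) (x (n, n))"
proof -
  define z where "z = x (n, n)"
  define d where "d = deflate n x (n, n)"
  have vc: "v (n, n) = z"
    by (simp add: v_def colsub_def blockshift_def colset_def sq_def z_def)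
  have bs: "blockshift n x (i, k) = x (i, k) + x (i, n) * x (n, k)" if "i < n" "k < n" for i k
    using that by (simp add: blockshift_def sq_def)
  have bsn: "blockshift n x (k, n) = x (k, n)" "blockshift n x (n, k) = x (n, k)" if "k \<le> n" for k
    using that by (simp_all add: blockshift_def sq_def)
  have off: "v p = deflate n x p" if pn: "p \<noteq> (n, n)" for p
  proof -
    obtain i j where p: "p = (i, j)" by (cases p)
    consider "i < n" "j < n" | "i < n" "j = n" | "i = n" "j < n" | "\<not> (i \<le> n \<and> j \<le> n)"
      using pn p by (metis le_neq_implies_less)
    then show ?thesis
    proof cases
      case 1
      then show ?thesis
        by (simp add: p v_def colsub_def colset_def sq_def bs deflate_def Let_def)
    next
      case 2
      have "v p = (\<Sum>k<n. ((if i = k then z else 0) - (x (i, k) + x (i, n) * x (n, k))) * x (k, n))"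
        using 2 by (auto simp: p v_def colsub_def colset_def sq_def bs bsn z_def intro!: sum.cong)
      also have "\<dots> = (\<Sum>k<n. if i = k then z * x (k, n) else 0)
          - (\<Sum>k<n. (x (i, k) + x (i, n) * x (n, k)) * x (k, n))"
        unfolding sum_subtractf[symmetric] by (intro sum.cong) (auto simp: algebra_simps)
      finally show ?thesis
        using 2 by (simp add: p deflate_def Let_def z_def)
    next
      case 3
      then show ?thesis
        by (simp add: p v_def colsub_def colset_def sq_def bsn deflate_def Let_def)
    next
      case 4
      then show ?thesis
        by (auto simp: p v_def colsub_def sq_def deflate_def)
    qed
  qed
  define P where "P = cpol (Suc n) (v((n, n) := 0))"
  define Q' where "Q' = cpol n (blockshift n x)"
  have v0: "v((n, n) := 0) = (deflate n x)((n, n) := 0)" using off by auto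
  have Qv: "cpol n v = Q'"
    unfolding Q'_def by (rule cp_cong) (simp add: v_def colsub_def colset_def sq_def)
  have "cpol n (deflate n x) = cpol n v"
    by (rule cp_cong) (simp add: off)
  then have "[:- z, 1:] * cpol n x = P - Polynomial.smult d Q'"
    using cpol_corner_affine[of n "deflate n x" d] cpol_deflate[of n x]
    by (simp add: P_def v0 Qv d_def z_def)
  then have P: "P = [:- z, 1:] * cpol n x + Polynomial.smult d Q'" by simp
  have Qz: "poly Q' z \<noteq> 0" using Q by (simp add: Q'_def z_def)
  have Pz: "poly P z = d * poly Q' z" by (simp add: P)
  have dPz: "poly (pderiv P) z = cp n x z + d * poly (pderiv Q') z"
  proof -
    have "pderiv ([:- z, 1:] * cpol n x) = [:- z, 1:] * pderiv (cpol n x) + cpol n x * pderiv [:- z, 1:]"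
      by (rule pderiv_mult)
    then show ?thesis
      by (simp only: P pderiv_add pderiv_smult) (simp add: pderiv_pCons algebra_simps)
  qed
  have "corner_val n v = d"
    using Qz by (simp add: corner_val_def vc Qv P_def[symmetric] Pz)
  then show "v((n, n) := corner_val n v) = deflate n x"
    using off by (auto simp: d_def)
  have "corner_deriv n v = (cp n x z * poly Q' z) / (poly Q' z)\<^sup>2"
    by (simp add: corner_deriv_def Let_def vc Qv P_def[symmetric] Pz dPz algebra_simps)
  then show "corner_deriv n v = cp n x (x (n, n)) / cp n (blockshift n x) (x (n, n))"
    using Qz by (simp add: power2_eq_square Q'_def z_def)
qed

text \<open>Change of variables for the deflation of one eigenvalue: almost every matrix is reached exactly
  once for each of its \<open>n + 1\<close> eigenvalues.\<close>

theorem nn_integral_deflate: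
  assumes F: "F \<in> borel_measurable (LC (sq (Suc n)))"
  shows "(\<integral>\<^sup>+x. F (deflate n x) * ennreal ((cmod (cp n x (x (n, n))))\<^sup>2) \<partial>LC (sq (Suc n)))
    = of_nat (Suc n) * integral\<^sup>N (LC (sq (Suc n))) F"
proof -
  let ?M = "LC (sq (Suc n))" and ?c = "(n, n)"
  define G where "G x = F (x(?c := corner_val n x)) * ennreal ((cmod (corner_deriv n x))\<^sup>2)" for x
  define H where "H x = G (colsub n x) * ennreal ((cmod (cp n x (x ?c)))\<^sup>2)" for x
  have cpm: "(\<lambda>x. cp n x (x ?c)) \<in> borel_measurable ?M"
    by (rule cp_measurable[where x = "\<lambda>x. x" and z = "\<lambda>x. x ?c"]; rule coord_sq; simp)
  have G: "G \<in> borel_measurable ?M"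
    unfolding G_def[abs_def]
    by (intro borel_measurable_times_ennreal measurable_compose[OF corner_update_measurable F]
      measurable_compose[OF _ measurable_ennreal] borel_measurable_power
      measurable_compose[OF corner_deriv_measurable borel_measurable_norm])
  have H: "H \<in> borel_measurable ?M"
    unfolding H_def[abs_def]
    by (intro borel_measurable_times_ennreal measurable_compose[OF colsub_measurable G]
      measurable_compose[OF _ measurable_ennreal] borel_measurable_power
      measurable_compose[OF cpm borel_measurable_norm])
  have bsm: "(\<lambda>x. cp n (blockshift n x) (x ?c)) \<in> borel_measurable ?M"
  proof (rule cp_measurable[where x = "blockshift n" and z = "\<lambda>x. x ?c"])
    show "(\<lambda>x. blockshift n x (i, j)) \<in> borel_measurable ?M" if "i < n" "j < n" for i j
      using that by (intro measurable_compose[OF blockshift_measurable coord_sq]) auto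
  qed (rule coord_sq; simp)
  have AE: "AE x in ?M. cp n (blockshift n x) (x ?c) \<noteq> 0"
  proof (rule AE_LC_coordinate[where i = ?c])
    have "{x \<in> space ?M. cp n (blockshift n x) (x ?c) \<noteq> 0} = (\<lambda>x. cp n (blockshift n x) (x ?c)) -` (- {0}) \<inter> space ?M"
      by auto
    also have "\<dots> \<in> sets ?M"
      by (rule measurable_sets[OF bsm]) (rule borel_open, rule open_Compl[OF closed_singleton])
    finally show "Measurable.pred ?M (\<lambda>x. cp n (blockshift n x) (x ?c) \<noteq> 0)"
      unfolding pred_def .
    \<comment> \<open>The shifted leading block does not involve the corner, so \<lambda> has to
      avoid only the finitely many eigenvalues of a fixed matrix.\<close>
    show "AE x in LC (sq (Suc n) - {?c}). finite {t. \<not> cp n (blockshift n (x(?c := t))) ((x(?c := t)) ?c) \<noteq> 0}"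
    proof (rule AE_I2)
      fix x
      have "cpol n (blockshift n (x(?c := t))) = cpol n (blockshift n x)" for t
        by (rule cp_cong) (simp add: blockshift_def sq_def)
      then show "finite {t. \<not> cp n (blockshift n (x(?c := t))) ((x(?c := t)) ?c) \<noteq> 0}"
        using poly_roots_finite[of "cpol n (blockshift n x)"] by simp
    qed
  qed (auto simp: sq_def)
  have "of_nat (Suc n) * integral\<^sup>N ?M F = integral\<^sup>N ?M G"
    unfolding G_def by (rule nn_integral_corner[OF F, symmetric])
  also have "\<dots> = integral\<^sup>N ?M H"
    unfolding H_def by (rule nn_integral_colsub[OF G, symmetric])
      (simp add: G_def corner_deriv_def Let_def)
  also have "\<dots> = (\<integral>\<^sup>+x. H (blockshift n x) \<partial>?M)"
    by (rule nn_integral_blockshift[OF H, symmetric])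
  also have "\<dots> = (\<integral>\<^sup>+x. F (deflate n x) * ennreal ((cmod (cp n x (x ?c)))\<^sup>2) \<partial>?M)"
  proof (rule nn_integral_cong_AE, use AE in eventually_elim)
    fix x assume nz: "cp n (blockshift n x) (x ?c) \<noteq> 0"
    let ?q = "cp n (blockshift n x) (x ?c)"
    have c: "blockshift n x ?c = x ?c" by (simp add: blockshift_def sq_def)
    \<comment> \<open>The Jacobian |det (\<lambda> - B)|^2 of \<open>colsub\<close> cancels the
      squared denominator of \<open>corner_deriv\<close>.\<close>
    have "ennreal ((cmod (cp n x (x ?c) / ?q))\<^sup>2) * ennreal ((cmod ?q)\<^sup>2) = ennreal ((cmod (cp n x (x ?c)))\<^sup>2)"
      using nz by (subst ennreal_mult[symmetric]) (auto simp: norm_divide power_divide)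
    then show "H (blockshift n x) = F (deflate n x) * ennreal ((cmod (cp n x (x ?c)))\<^sup>2)"
      unfolding H_def G_def corner_fibre[OF nz] c by (simp add: mult.assoc)
  qed
  finally show ?thesis by simp
qed

section \<open>Frobenius norm and the Gaussian weight\<close>

text \<open>The square of the Frobenius norm, that is, the trace in the exponent of the
  density.\<close>

definition fro :: "nat \<Rightarrow> (nat \<times> nat \<Rightarrow> complex) \<Rightarrow> real" where
  "fro n x = (\<Sum>i<n. \<Sum>j<n. (cmod (x (i, j)))\<^sup>2)"

lemma isometry_sum:
  fixes m :: nat
  assumes "\<And>k l. k < m \<Longrightarrow> l < m \<Longrightarrow> (\<Sum>i<m. cnj (U i l) * U i k) = (if k = l then 1 else 0)"
  shows "(\<Sum>i<m. (cmod (\<Sum>k<m. U i k * y k))\<^sup>2) = (\<Sum>k<m. (cmod (y k))\<^sup>2)"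
proof -
  have "complex_of_real (\<Sum>i<m. (cmod (\<Sum>k<m. U i k * y k))\<^sup>2)
    = (\<Sum>i<m. (\<Sum>k<m. U i k * y k) * (\<Sum>l<m. cnj (U i l) * cnj (y l)))"
    by (simp add: complex_norm_square del: of_real_power)
  also have "\<dots> = (\<Sum>i<m. \<Sum>k<m. \<Sum>l<m. y k * cnj (y l) * (cnj (U i l) * U i k))"
    unfolding sum_product by (intro sum.cong refl) (simp add: mult_ac)
  also have "\<dots> = (\<Sum>k<m. \<Sum>i<m. \<Sum>l<m. y k * cnj (y l) * (cnj (U i l) * U i k))"
    by (rule sum.swap)
  also have "\<dots> = (\<Sum>k<m. \<Sum>l<m. \<Sum>i<m. y k * cnj (y l) * (cnj (U i l) * U i k))"
    by (intro sum.cong refl sum.swap)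
  also have "\<dots> = (\<Sum>k<m. \<Sum>l<m. y k * cnj (y l) * (if k = l then 1 else 0))"
    unfolding sum_distrib_left[symmetric] using assms by (intro sum.cong refl) auto
  also have "\<dots> = (\<Sum>k<m. \<Sum>l<m. if k = l then y k * cnj (y l) else 0)"
    by (intro sum.cong refl) simp
  also have "\<dots> = (\<Sum>k<m. y k * cnj (y k))"
    by (intro sum.cong refl) (subst sum.delta'; simp)
  also have "\<dots> = complex_of_real (\<Sum>k<m. (cmod (y k))\<^sup>2)"
    by (simp add: complex_norm_square del: of_real_power)
  finally show ?thesis by (simp only: of_real_eq_iff)
qed

context
  fixes n :: nat and x :: "nat \<times> nat \<Rightarrow> complex"
begin

text \<open>The length of the eigenvector (z, 1).\<close>

definition colnorm :: real where "colnorm = sqrt (1 + (\<Sum>k<n. (cmod (x (k, n)))\<^sup>2))"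

text \<open>For \<open>z\<close> the last column, \<open>Gm\<close> is the positive square root of \<open>1 - z z\<^sup>* / (1 + |z|\<^sup>2)\<close> and \<open>Hm\<close>
  is its inverse.\<close>

definition Gm :: "nat \<Rightarrow> nat \<Rightarrow> complex" where
  "Gm i j = (if i = j then 1 else 0) - of_real (1 / (colnorm * (colnorm + 1))) * x (i, n) * cnj (x (j, n))"

definition Hm :: "nat \<Rightarrow> nat \<Rightarrow> complex" where
  "Hm i j = (if i = j then 1 else 0) + of_real (1 / (colnorm + 1)) * x (i, n) * cnj (x (j, n))"

text \<open>The part of the last row of Rm M Ri that comes from the leading block and the corner of
  x. It becomes the centre of the Gaussian in the last row.\<close>

definition row_offset :: "nat \<Rightarrow> complex" where
  "row_offset j = (\<Sum>l<n. (\<Sum>k<n. cnj (x (k, n)) / of_real colnorm * x (k, l)) * Hm l j) - x (n, n) * cnj (x (j, n))"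

lemma colnorm_pos: "colnorm > 0"
  unfolding colnorm_def by (intro real_sqrt_gt_zero add_pos_nonneg sum_nonneg) auto

lemma colnorm_sq: "(\<Sum>k<n. x (k, n) * cnj (x (k, n))) = of_real (colnorm\<^sup>2 - 1)"
proof -
  have "colnorm\<^sup>2 - 1 = (\<Sum>k<n. (cmod (x (k, n)))\<^sup>2)"
    unfolding colnorm_def by (subst real_sqrt_pow2) (auto intro!: add_nonneg_nonneg sum_nonneg)
  then show ?thesis by (simp add: complex_norm_square del: of_real_power)
qed

text \<open>Matrices 1 + a z z^H multiply among themselves because z^H z is the scalar
  \<open>colnorm^2 - 1\<close>. This reduces the identities for \<open>Gm\<close> and
  \<open>Hm\<close> to scalar ones.\<close>

lemma rank_one_mult:
  assumes "i < n" "j < n"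
  shows "(\<Sum>k<n. ((if i = k then 1 else 0) + a * x (i, n) * cnj (x (k, n))) * ((if k = j then 1 else 0) + b * x (k, n) * cnj (x (j, n))))
    = (if i = j then 1 else 0) + (a + b + a * b * of_real (colnorm\<^sup>2 - 1)) * (x (i, n) * cnj (x (j, n)))"
proof -
  let ?z = "\<lambda>k. x (k, n)"
  have "(\<Sum>k<n. ((if i = k then 1 else 0) + a * ?z i * cnj (?z k)) * ((if k = j then 1 else 0) + b * ?z k * cnj (?z j)))
    = (\<Sum>k<n. (if k = i then (if i = j then 1 else 0) + b * ?z i * cnj (?z j) else 0)
        + (if k = j then a * ?z i * cnj (?z j) else 0) + a * b * ?z i * cnj (?z j) * (?z k * cnj (?z k)))"
    by (intro sum.cong refl) (auto simp: algebra_simps)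
  also have "\<dots> = (if i = j then 1 else 0) + b * ?z i * cnj (?z j) + a * ?z i * cnj (?z j)
      + a * b * ?z i * cnj (?z j) * of_real (colnorm\<^sup>2 - 1)"
    using assms unfolding colnorm_sq[symmetric] sum_distrib_left by (simp add: sum.distrib)
  finally show ?thesis by (simp add: algebra_simps)
qed

lemma Gm_alt: "Gm i j = (if i = j then 1 else 0) + (- of_real (1 / (colnorm * (colnorm + 1)))) * x (i, n) * cnj (x (j, n))"
  by (simp add: Gm_def)

text \<open>The scalar content, in this order, of Gm Hm = 1, of Gm Gm = 1 - z z^H / colnorm^2, of Gm
  z = z / colnorm, and of Gm + z z^H / colnorm = Hm.\<close>

lemma coeffs:
  defines "c \<equiv> 1 / (colnorm * (colnorm + 1))" and "d \<equiv> 1 / (colnorm + 1)"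
  shows "- c + d + (- c) * d * (colnorm\<^sup>2 - 1) = 0" "- c + - c + (- c) * (- c) * (colnorm\<^sup>2 - 1) = - (1 / colnorm\<^sup>2)"
    "1 - c * (colnorm\<^sup>2 - 1) = 1 / colnorm" "1 / colnorm - c = d"
proof -
  define e where "e = colnorm + 1"
  have p: "colnorm \<noteq> 0" "e \<noteq> 0" using colnorm_pos by (auto simp: e_def)
  have f: "colnorm\<^sup>2 - 1 = (colnorm - 1) * e" by (simp add: e_def algebra_simps power2_eq_square)
  note c_def = c_def[folded e_def] and d_def = d_def[folded e_def]
  have cs: "c * (colnorm\<^sup>2 - 1) = (colnorm - 1) / colnorm" unfolding c_def f using p by (simp add: field_simps)
  have ds: "d * (colnorm\<^sup>2 - 1) = colnorm - 1" unfolding d_def f using p by (simp add: field_simps)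
  have "1 / colnorm - c = (e - 1) / (colnorm * e)" unfolding c_def using p by (simp add: field_simps)
  also have "e - 1 = colnorm" by (simp add: e_def)
  finally show "1 / colnorm - c = d" unfolding d_def using p by simp
  have dc: "d = c * colnorm" unfolding c_def d_def using p by simp
  have "(- c) * d * (colnorm\<^sup>2 - 1) = - c * (d * (colnorm\<^sup>2 - 1))" by simp
  also have "\<dots> = - c * (colnorm - 1)" by (simp only: ds)
  finally show "- c + d + (- c) * d * (colnorm\<^sup>2 - 1) = 0" by (simp add: dc algebra_simps)
  show "1 - c * (colnorm\<^sup>2 - 1) = 1 / colnorm" unfolding cs using p by (simp add: field_simps)
  have "(- c) * (- c) * (colnorm\<^sup>2 - 1) = c * (c * (colnorm\<^sup>2 - 1))" by simp
  also have "\<dots> = c * (colnorm - 1) / colnorm" by (simp only: cs times_divide_eq_right)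
  finally have "- c + - c + (- c) * (- c) * (colnorm\<^sup>2 - 1) = - (c * e) / colnorm"
    using p by (simp add: field_simps e_def)
  also have "c * e = 1 / colnorm" unfolding c_def using p by simp
  finally show "- c + - c + (- c) * (- c) * (colnorm\<^sup>2 - 1) = - (1 / colnorm\<^sup>2)"
    by (simp add: power2_eq_square)
qed

lemma Gm_Hm:
  assumes "i < n" "j < n"
  shows "(\<Sum>k<n. Gm i k * Hm k j) = (if i = j then 1 else 0)" "(\<Sum>k<n. Hm i k * Gm k j) = (if i = j then 1 else 0)"
    "(\<Sum>k<n. Gm i k * Gm k j) = (if i = j then 1 else 0) - x (i, n) * cnj (x (j, n)) / (of_real colnorm)\<^sup>2"
proof -
  note c = coeffs[THEN arg_cong[where f = complex_of_real], unfolded of_real_add of_real_mult of_real_minus of_real_0]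
  show "(\<Sum>k<n. Gm i k * Hm k j) = (if i = j then 1 else 0)"
    unfolding Gm_alt Hm_def rank_one_mult[OF assms] c(1) by simp
  show "(\<Sum>k<n. Hm i k * Gm k j) = (if i = j then 1 else 0)"
    unfolding Gm_alt Hm_def rank_one_mult[OF assms] using c(1) by (simp add: add.commute mult.commute)
  show "(\<Sum>k<n. Gm i k * Gm k j) = (if i = j then 1 else 0) - x (i, n) * cnj (x (j, n)) / (of_real colnorm)\<^sup>2"
    unfolding Gm_alt rank_one_mult[OF assms] c(2) by simp
qed

lemma Gm_cnj: "cnj (Gm i j) = Gm j i" and Hm_cnj: "cnj (Hm i j) = Hm j i"
  by (simp_all add: Gm_def Hm_def mult_ac)

lemma Gm_vec: "i < n \<Longrightarrow> (\<Sum>k<n. Gm i k * x (k, n)) = x (i, n) / of_real colnorm"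
proof -
  assume i: "i < n"
  let ?c = "1 / (colnorm * (colnorm + 1))"
  have "(\<Sum>k<n. Gm i k * x (k, n))
    = (\<Sum>k<n. (if i = k then x (k, n) else 0) - of_real ?c * x (i, n) * (x (k, n) * cnj (x (k, n))))"
    by (intro sum.cong refl) (auto simp: Gm_def algebra_simps)
  also have "\<dots> = x (i, n) - of_real ?c * x (i, n) * of_real (colnorm\<^sup>2 - 1)"
  proof -
    have "(\<Sum>k<n. (if i = k then x (k, n) else 0) - of_real ?c * x (i, n) * (x (k, n) * cnj (x (k, n))))
      = (\<Sum>k<n. if i = k then x (k, n) else 0) - of_real ?c * x (i, n) * (\<Sum>k<n. x (k, n) * cnj (x (k, n)))"
      by (simp only: sum_subtractf sum_distrib_left)
    also have "(\<Sum>k<n. if i = k then x (k, n) else 0) = x (i, n)" using i by simp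
    finally show ?thesis by (simp only: colnorm_sq)
  qed
  also have "\<dots> = x (i, n) * of_real (1 - ?c * (colnorm\<^sup>2 - 1))" by (simp add: algebra_simps)
  also have "\<dots> = x (i, n) / of_real colnorm" unfolding coeffs(3) by simp
  finally show ?thesis .
qed

lemma vec_Gm: "j < n \<Longrightarrow> (\<Sum>k<n. cnj (x (k, n)) * Gm k j) = cnj (x (j, n)) / of_real colnorm"
proof -
  assume j: "j < n"
  have "(\<Sum>k<n. cnj (x (k, n)) * Gm k j) = cnj (\<Sum>k<n. Gm j k * x (k, n))"
    by (simp add: Gm_cnj mult.commute)
  also have "\<dots> = cnj (x (j, n)) / of_real colnorm" unfolding Gm_vec[OF j] by simp
  finally show ?thesis .
qed

text \<open>\<open>Qm\<close> is unitary and its last column is proportional to the eigenvector \<open>(z, 1)\<close>; hence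
  \<open>Rm = Qm\<^sup>* S\<close> and \<open>Ri = S\<inverse> Qm\<close> are block triangular, for \<open>S\<close> as in \<open>deflate\<close>.\<close>

definition Qm :: "complex mat" where
  "Qm = Matrix.mat (Suc n) (Suc n) (\<lambda>(i, j). if i < n then if j < n then Gm i j else x (i, n) / of_real colnorm
    else if j < n then - cnj (x (j, n)) / of_real colnorm else 1 / of_real colnorm)"

definition Qa :: "complex mat" where
  "Qa = Matrix.mat (Suc n) (Suc n) (\<lambda>(i, j). cnj (Qm $$ (j, i)))"

definition Rm :: "complex mat" where
  "Rm = Matrix.mat (Suc n) (Suc n) (\<lambda>(i, j). if i < n then if j < n then Gm i j else 0
    else if j < n then cnj (x (j, n)) / of_real colnorm else of_real colnorm)"

definition Ri :: "complex mat" where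
  "Ri = Matrix.mat (Suc n) (Suc n) (\<lambda>(i, j). if i < n then if j < n then Hm i j else 0
    else if j < n then - cnj (x (j, n)) / of_real colnorm else 1 / of_real colnorm)"

lemma QR_carrier [simp]:
  "Qm \<in> carrier_mat (Suc n) (Suc n)" "Qa \<in> carrier_mat (Suc n) (Suc n)"
  "Rm \<in> carrier_mat (Suc n) (Suc n)" "Ri \<in> carrier_mat (Suc n) (Suc n)"
  by (simp_all add: Qm_def Qa_def Rm_def Ri_def)

lemma mult_index_Suc:
  assumes "A \<in> carrier_mat (Suc n) (Suc n)" "B \<in> carrier_mat (Suc n) (Suc n)" "i \<le> n" "j \<le> n"
  shows "(A * B) $$ (i, j) = (\<Sum>k<n. A $$ (i, k) * B $$ (k, j)) + A $$ (i, n) * B $$ (n, j :: nat)"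
  using assms by (simp add: scalar_prod_def atLeast0LessThan[symmetric])

lemma Qa_Qm: "Qa * Qm = 1\<^sub>m (Suc n)"
proof (rule eq_matI)
  have a: "complex_of_real colnorm \<noteq> 0" using colnorm_pos by simp
  fix i j assume "i < dim_row (1\<^sub>m (Suc n) :: complex mat)" "j < dim_col (1\<^sub>m (Suc n) :: complex mat)"
  then have ij: "i \<le> n" "j \<le> n" by auto
  have nn: "(\<Sum>k<n. cnj (x (k, n)) * x (k, n) / (of_real colnorm)\<^sup>2) = 1 - 1 / (of_real colnorm)\<^sup>2"
    using colnorm_sq a by (simp add: sum_divide_distrib[symmetric] mult.commute diff_divide_distrib)
  have g: "(\<Sum>k<n. Gm i k * (x (k, n) / of_real colnorm)) = x (i, n) / (of_real colnorm)\<^sup>2" if "i < n" for i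
    using Gm_vec[OF that] by (simp add: sum_divide_distrib[symmetric] power2_eq_square)
  have g': "(\<Sum>k<n. cnj (x (k, n)) * Gm k j / of_real colnorm) = cnj (x (j, n)) / (of_real colnorm)\<^sup>2" if "j < n" for j
    using vec_Gm[OF that] by (simp add: sum_divide_distrib[symmetric] power2_eq_square)
  have "(Qa * Qm) $$ (i, j) = (\<Sum>k<n. cnj (Qm $$ (k, i)) * Qm $$ (k, j)) + cnj (Qm $$ (n, i)) * Qm $$ (n, j)"
    using ij by (subst mult_index_Suc) (auto simp: Qa_def)
  also have "\<dots> = (if i = j then 1 else 0)"
    using ij a Gm_Hm(3)[of i j] g[of i] g'[of j] nn
    by (cases "i < n"; cases "j < n") (auto simp: Qm_def Gm_cnj power2_eq_square)
  finally show "(Qa * Qm) $$ (i, j) = (1\<^sub>m (Suc n) :: complex mat) $$ (i, j)" using ij by simp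
qed (auto simp: Qa_def Qm_def)

lemma Qm_Qa: "Qm * Qa = 1\<^sub>m (Suc n)"
  using mat_mult_left_right_inverse[OF _ _ Qa_Qm] by simp

lemma Qm_Rm: "Qm * Rm = shear_mat n (\<lambda>i. x (i, n))"
proof (rule eq_matI)
  have a: "complex_of_real colnorm \<noteq> 0" using colnorm_pos by simp
  fix i j assume "i < dim_row (shear_mat n (\<lambda>i. x (i, n)))" "j < dim_col (shear_mat n (\<lambda>i. x (i, n)))"
  then have ij: "i \<le> n" "j \<le> n" by (auto simp: shear_mat_def)
  have g': "(\<Sum>k<n. cnj (x (k, n)) * Gm k j / of_real colnorm) = cnj (x (j, n)) / (of_real colnorm)\<^sup>2" if "j < n" for j
    using vec_Gm[OF that] by (simp add: sum_divide_distrib[symmetric] power2_eq_square)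
  show "(Qm * Rm) $$ (i, j) = shear_mat n (\<lambda>i. x (i, n)) $$ (i, j)"
    unfolding mult_index_Suc[OF QR_carrier(1,3) ij]
    using ij a Gm_Hm(3)[of i j] g'[of j]
    by (cases "i < n"; cases "j < n") (auto simp: Qm_def Rm_def shear_mat_def power2_eq_square sum_negf)
qed (auto simp: shear_mat_def Qm_def Rm_def)

lemma shear_Qm: "shear_mat n (\<lambda>i. - x (i, n)) * Qm = Ri"
proof (rule eq_matI)
  fix i j assume "i < dim_row Ri" "j < dim_col Ri"
  then have ij: "i \<le> n" "j \<le> n" by (auto simp: Ri_def)
  have "of_real (1 / colnorm) - of_real (1 / (colnorm * (colnorm + 1))) = (of_real (1 / (colnorm + 1)) :: complex)"
    using coeffs(4) by (metis of_real_diff)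
  then have "Gm i j + x (i, n) * cnj (x (j, n)) * of_real (1 / colnorm) = Hm i j"
    by (simp only: Gm_def Hm_def) (simp only: algebra_simps)
  then have "Gm i j + x (i, n) * (cnj (x (j, n)) / of_real colnorm) = Hm i j"
    by simp
  then show "(shear_mat n (\<lambda>i. - x (i, n)) * Qm) $$ (i, j) = Ri $$ (i, j)"
    unfolding shear_mat_mult_index[OF QR_carrier(1) ij]
    using ij by (cases "i < n"; cases "j < n") (auto simp: Qm_def Ri_def)
qed (auto simp: Ri_def shear_mat_def Qm_def)

text \<open>Since S = Qm Rm and the inverse of S times Qm is Ri, the deflated matrix X satisfies X
  Qm = Qm Y with Y = Rm M Ri. The rows and the columns of Qm are orthonormal, so X and Y have the
  same norm; Y has the conjugated block Gm A' Hm, zeros above its corner \<lambda>, and a last row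
  that is affine in the last row of x.\<close>

lemma fro_deflate:
  "fro (Suc n) (deflate n x) = fro n (conj_act n Gm Hm x) + (cmod (x (n, n)))\<^sup>2
    + (\<Sum>j<n. (cmod (of_real colnorm * (\<Sum>k<n. x (n, k) * Hm k j) + row_offset j))\<^sup>2)"
proof -
  let ?X = "Matrix.mat (Suc n) (Suc n) (deflate n x)" and ?M = "block_tri n x"
  let ?S = "shear_mat n (\<lambda>i. x (i, n))" and ?S' = "shear_mat n (\<lambda>i. - x (i, n))"
  have a: "complex_of_real colnorm \<noteq> 0" using colnorm_pos by simp
  define Y where "Y = Rm * ?M * Ri"
  have Y: "Y \<in> carrier_mat (Suc n) (Suc n)"
    unfolding Y_def by (intro mult_carrier_mat[of _ _ "Suc n"]) auto
  have X: "?X \<in> carrier_mat (Suc n) (Suc n)" by simp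
  have SM: "?S * ?M \<in> carrier_mat (Suc n) (Suc n)" and RM: "Rm * ?M \<in> carrier_mat (Suc n) (Suc n)"
    by (rule mult_carrier_mat[of _ _ "Suc n"]; simp)+
  have "?X * Qm = ?S * ?M * (?S' * Qm)"
    unfolding deflate_eq by (rule assoc_mult_mat[OF SM shear_mat_carrier QR_carrier(1)])
  also have "\<dots> = (Qm * Rm) * ?M * Ri" by (simp only: shear_Qm Qm_Rm)
  also have "\<dots> = Qm * Y"
    unfolding Y_def using assoc_mult_mat[OF QR_carrier(1,3), of ?M "Suc n"] assoc_mult_mat[OF QR_carrier(1) RM QR_carrier(4)]
    by simp
  finally have XQ: "?X * Qm = Qm * Y" .
  have ent: "(A * B) $$ (i, j) = (\<Sum>k<Suc n. A $$ (i, k) * B $$ (k, j))"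
    if "A \<in> carrier_mat (Suc n) (Suc n)" "B \<in> carrier_mat (Suc n) (Suc n)" "i < Suc n" "j < Suc n" for A B :: "complex mat" and i j
    using mult_index_Suc[of A B i j] that by simp
  have iso1: "(\<Sum>i<Suc n. cnj (Qm $$ (i, l)) * Qm $$ (i, k)) = (if k = l then 1 else 0)" if "k < Suc n" "l < Suc n" for k l
    using ent[OF QR_carrier(2,1) that(2,1)] that unfolding Qa_Qm by (auto simp: Qa_def simp del: sum.lessThan_Suc)
  have iso2: "(\<Sum>i<Suc n. cnj (Qm $$ (l, i)) * Qm $$ (k, i)) = (if k = l then 1 else 0)" if "k < Suc n" "l < Suc n" for k l
    using ent[OF QR_carrier(1,2) that] that unfolding Qm_Qa by (auto simp: Qa_def mult.commute simp del: sum.lessThan_Suc)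
  have "fro (Suc n) (deflate n x) = (\<Sum>i<Suc n. \<Sum>j<Suc n. (cmod (?X $$ (i, j)))\<^sup>2)"
    unfolding fro_def by (intro sum.cong refl) simp
  also have "\<dots> = (\<Sum>i<Suc n. \<Sum>j<Suc n. (cmod (\<Sum>k<Suc n. Qm $$ (k, j) * ?X $$ (i, k)))\<^sup>2)"
    by (intro sum.cong refl isometry_sum[where U = "\<lambda>j k. Qm $$ (k, j)", symmetric] iso2)
  also have "\<dots> = (\<Sum>i<Suc n. \<Sum>j<Suc n. (cmod ((?X * Qm) $$ (i, j)))\<^sup>2)"
    by (intro sum.cong refl arg_cong[where f = "\<lambda>z. (cmod z)\<^sup>2"], subst ent[OF X QR_carrier(1)])
      (auto simp: mult.commute simp del: sum.lessThan_Suc)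
  also have "\<dots> = (\<Sum>j<Suc n. \<Sum>i<Suc n. (cmod ((Qm * Y) $$ (i, j)))\<^sup>2)"
    unfolding XQ by (rule sum.swap)
  also have "\<dots> = (\<Sum>j<Suc n. \<Sum>i<Suc n. (cmod (\<Sum>k<Suc n. Qm $$ (i, k) * Y $$ (k, j)))\<^sup>2)"
    by (intro sum.cong refl arg_cong[where f = "\<lambda>z. (cmod z)\<^sup>2"] ent[OF QR_carrier(1) Y]) auto
  also have "\<dots> = (\<Sum>j<Suc n. \<Sum>k<Suc n. (cmod (Y $$ (k, j)))\<^sup>2)"
    by (intro sum.cong refl isometry_sum[where U = "\<lambda>i k. Qm $$ (i, k)"] iso1)
  also have "\<dots> = (\<Sum>k<Suc n. \<Sum>j<Suc n. (cmod (Y $$ (k, j)))\<^sup>2)"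
    by (rule sum.swap)
  finally have fX: "fro (Suc n) (deflate n x) = (\<Sum>k<Suc n. \<Sum>j<Suc n. (cmod (Y $$ (k, j)))\<^sup>2)" .
  have RM1: "(Rm * ?M) $$ (i, l) = (if l < n then \<Sum>k<n. Gm i k * x (k, l) else 0)" if "i < n" "l \<le> n" for i l
    unfolding mult_index_Suc[OF QR_carrier(3) block_tri_carrier less_imp_le[OF that(1)] that(2)]
    using that by (auto simp: Rm_def block_tri_def intro!: sum.cong)
  have RM2: "(Rm * ?M) $$ (n, l) = (if l < n then (\<Sum>k<n. cnj (x (k, n)) / of_real colnorm * x (k, l)) + of_real colnorm * x (n, l)
      else of_real colnorm * x (n, n))" if "l \<le> n" for l
    unfolding mult_index_Suc[OF QR_carrier(3) block_tri_carrier order_refl that]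
    using that by (auto simp: Rm_def block_tri_def intro!: sum.cong)
  have Y1: "Y $$ (i, j) = conj_act n Gm Hm x (i, j)" if "i < n" "j < n" for i j
  proof -
    have "Y $$ (i, j) = (\<Sum>l<n. (\<Sum>k<n. Gm i k * x (k, l)) * Hm l j)"
      unfolding Y_def mult_index_Suc[OF RM QR_carrier(4) less_imp_le[OF that(1)] less_imp_le[OF that(2)]]
      using that by (simp add: RM1 Ri_def del: index_mult_mat)
    also have "\<dots> = (\<Sum>k<n. \<Sum>l<n. Gm i k * x (k, l) * Hm l j)"
      unfolding sum_distrib_right by (rule sum.swap)
    finally show ?thesis using that by (simp add: conj_act_def sq_def)
  qed
  have Y2: "Y $$ (i, n) = 0" if "i < n" for i
    unfolding Y_def mult_index_Suc[OF RM QR_carrier(4) less_imp_le[OF that] order_refl]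
    using that by (simp add: RM1 Ri_def del: index_mult_mat)
  have Y3: "Y $$ (n, j) = of_real colnorm * (\<Sum>k<n. x (n, k) * Hm k j) + row_offset j" if "j < n" for j
    unfolding Y_def mult_index_Suc[OF RM QR_carrier(4) order_refl less_imp_le[OF that]]
    using that a by (simp add: RM2 Ri_def row_offset_def distrib_right sum.distrib sum_distrib_left mult.assoc del: index_mult_mat)
  have Y4: "Y $$ (n, n) = x (n, n)"
    unfolding Y_def mult_index_Suc[OF RM QR_carrier(4) order_refl order_refl]
    using a by (simp add: RM2 Ri_def del: index_mult_mat)
  have "(\<Sum>i<n. \<Sum>j<n. (cmod (Y $$ (i, j)))\<^sup>2) = fro n (conj_act n Gm Hm x)"
    unfolding fro_def by (intro sum.cong refl) (simp add: Y1)
  then show ?thesis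
    unfolding fX by (simp add: sum.distrib Y2 Y3 Y4)
qed

end

section \<open>Vandermonde determinants and radial weights\<close>

definition vdm :: "nat \<Rightarrow> (nat \<Rightarrow> complex) \<Rightarrow> complex" where
  "vdm n f = (\<Prod>j<n. \<Prod>i<j. (f j - f i))"

text \<open>As a function of its last node t, the determinant is a polynomial of degree at most n
  whose coefficient of t^n is the smaller determinant, and it vanishes at the other n nodes. For
  distinct nodes these facts determine it, since the difference \<open>R\<close> has too many roots
  for its degree; for repeated nodes both sides are 0.\<close>

lemma vdm_det: "vdm n f = Determinant.det (Matrix.mat n n (\<lambda>(i, j). f i ^ j))"
proof (induction n)
  case 0
  show ?case by (simp add: vdm_def)
next
  case (Suc n)
  let ?M = "\<lambda>t. Matrix.mat (Suc n) (Suc n) (\<lambda>(i, j). (if i < n then f i else t) ^ j)"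
  have vS: "vdm (Suc n) f = vdm n f * (\<Prod>i<n. (f n - f i))" by (simp add: vdm_def)
  have MS: "Matrix.mat (Suc n) (Suc n) (\<lambda>(i, j). f i ^ j) = ?M (f n)"
    by (rule eq_matI) (auto simp: less_Suc_eq)
  have ident: "Determinant.det (?M t) = 0" if "i < n" "j \<le> n" "i \<noteq> j" "f i = (if j < n then f j else t)" for i j t
    by (rule det_identical_rows[of _ "Suc n" i j]) (use that in \<open>auto intro!: eq_vecI\<close>)
  show ?case
  proof (cases "inj_on f {..<n}")
    case False
    then obtain i j where ij: "i < n" "j < n" "i \<noteq> j" "f i = f j" by (auto simp: inj_on_def)
    have "vdm n f = 0"
    proof -
      have "\<exists>i j. i < j \<and> j < n \<and> f j = f i"
        using ij by (metis linorder_neqE_nat)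
      then show ?thesis by (auto simp: vdm_def)
    qed
    moreover have "Determinant.det (?M (f n)) = 0" using ij by (intro ident[of i j]) auto
    ultimately show ?thesis unfolding MS vS by simp
  next
    case True
    define C where "C j = cofactor (?M 0) n j" for j
    have c: "cofactor (?M t) n j = C j" for j t
    proof -
      have "mat_delete (?M t) n j = mat_delete (?M 0) n j"
        by (rule eq_matI) (auto simp: mat_delete_def)
      then show ?thesis by (simp add: cofactor_def C_def)
    qed
    have det: "Determinant.det (?M t) = (\<Sum>j<Suc n. t ^ j * C j)" for t
    proof -
      have "Determinant.det (?M t) = (\<Sum>j<Suc n. ?M t $$ (n, j) * C j)"
        unfolding c[of t, symmetric] by (rule laplace_expansion_row) auto
      also have "\<dots> = (\<Sum>j<Suc n. t ^ j * C j)" by (rule sum.cong) auto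
      finally show ?thesis .
    qed
    have "mat_delete (?M 0) n n = Matrix.mat n n (\<lambda>(i, j). f i ^ j)"
      by (rule eq_matI) (auto simp: mat_delete_def)
    then have Cn: "C n = vdm n f" unfolding C_def cofactor_def Suc.IH by simp
    define P where "P = (\<Sum>j<Suc n. monom (C j) j)"
    define R where "R = P - Polynomial.smult (C n) (\<Prod>i<n. [:- f i, 1:])"
    have polyP: "poly P t = Determinant.det (?M t)" for t
      unfolding P_def det by (simp add: poly_sum poly_monom mult.commute)
    have prod: "degree (\<Prod>i<n. [:- f i, 1:]) = n" "coeff (\<Prod>i<n. [:- f i, 1:]) n = 1"
    proof -
      show d: "degree (\<Prod>i<n. [:- f i, 1:]) = n"
        by (subst degree_prod_sum_eq) auto
      have "lead_coeff (\<Prod>i<n. [:- f i, 1:]) = 1" by (simp add: lead_coeff_prod)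
      then show "coeff (\<Prod>i<n. [:- f i, 1:]) n = 1" unfolding d .
    qed
    have coP: "coeff P k = (if k < Suc n then C k else 0)" for k
      unfolding P_def by (simp add: coeff_sum coeff_monom del: sum.lessThan_Suc)
    have "degree P \<le> n" by (rule degree_le) (simp add: coP)
    then have dR: "degree R \<le> n"
      unfolding R_def using prod(1) by (intro degree_diff_le) (auto intro: order_trans[OF degree_smult_le])
    have cR: "coeff R n = 0" unfolding R_def by (simp add: coP prod)
    have root: "poly R (f i) = 0" if "i < n" for i
      unfolding R_def poly_diff polyP using ident[of i n "f i"] that
      by (simp add: poly_prod prod_zero[of "{..<n}"] bexI[of _ i])
    have "R = 0"
    proof (rule ccontr)
      assume R0: "R \<noteq> 0"
      then have "degree R \<noteq> n" using cR leading_coeff_neq_0[of R] by auto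
      then have "degree R < n" using dR by simp
      moreover have "card (f ` {..<n}) \<le> card {z. poly R z = 0}"
        using root by (intro card_mono poly_roots_finite R0) auto
      moreover have "card {z. poly R z = 0} \<le> degree R" by (rule poly_roots_degree[OF R0])
      ultimately show False using card_image[OF True] by simp
    qed
    then have "poly P (f n) = C n * (\<Prod>i<n. (f n - f i))"
      unfolding R_def by (simp add: poly_prod)
    then show ?thesis unfolding MS vS polyP Cn by simp
  qed
qed

lemma vdm_Leibniz: "vdm n f = (\<Sum>p | p permutes {0..<n}. of_int (sign p) * (\<Prod>i<n. f i ^ p i))"
proof -
  have "p i < n" if "p permutes {0..<n}" "i < n" for p i
    using permutes_in_image[OF that(1), of i] that(2) by simp
  then show ?thesis
    unfolding vdm_det by (subst det_def'[of _ n]) (auto intro!: sum.cong prod.cong simp: atLeast0LessThan)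
qed

section \<open>Orthogonality of monomials under a rotation-invariant weight\<close>

lemma distr_rotation:
  assumes "cmod u = 1"
  shows "distr lborel borel (\<lambda>z. u * z) = (lborel :: complex measure)"
proof (rule measure_eqI)
  fix A assume "A \<in> sets (distr lborel borel (\<lambda>z. u * z))"
  then have A: "A \<in> sets borel" by simp
  have u: "u \<noteq> 0" using assms by auto
  have "emeasure (distr lborel borel (\<lambda>z. u * z)) A = (\<integral>\<^sup>+z. indicator A z \<partial>distr lborel borel (\<lambda>z. u * z))"
    using A by simp
  also have "\<dots> = (\<integral>\<^sup>+z. indicator A (u * z) \<partial>lborel)"
    using A by (intro nn_integral_distr) auto
  also have "\<dots> = emeasure lborel A"
    using nn_integral_complex_affine[of "indicator A" u 0] A u assms by simp
  finally show "emeasure (distr lborel borel (\<lambda>z. u * z)) A = emeasure lborel A" .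
qed simp

definition mom :: "(complex \<Rightarrow> real) \<Rightarrow> nat \<Rightarrow> real" where
  "mom w k = (\<integral>z. (cmod z ^ k)\<^sup>2 * w z \<partial>lborel)"

definition gfun :: "(complex \<Rightarrow> real) \<Rightarrow> nat \<Rightarrow> nat \<Rightarrow> complex \<Rightarrow> complex" where
  "gfun w a b z = z ^ a * cnj z ^ b * of_real (w z)"

context
  fixes w :: "complex \<Rightarrow> real"
  assumes w_measurable: "w \<in> borel_measurable borel"
    and w_nonneg: "\<And>z. w z \<ge> 0"
    and w_radial: "\<And>u z. cmod u = 1 \<Longrightarrow> w (u * z) = w z"
    and w_moments: "\<And>k. integrable lborel (\<lambda>z. (cmod z ^ k)\<^sup>2 * w z)"
begin

lemma gfun_measurable: "gfun w a b \<in> borel_measurable borel"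
proof -
  have "(\<lambda>z::complex. z ^ a * cnj z ^ b) \<in> borel_measurable borel"
    by (intro borel_measurable_continuous_onI continuous_intros)
  then show ?thesis
    unfolding gfun_def[abs_def] using w_measurable by measurable
qed

text \<open>By s t <= s^2 + t^2 with s = |z|^a and t = |z|^b, the mixed moments are dominated by
  even ones.\<close>

lemma gfun_integrable: "integrable lborel (gfun w a b)"
proof (rule Bochner_Integration.integrable_bound)
  show "integrable lborel (\<lambda>z. (cmod z ^ a)\<^sup>2 * w z + (cmod z ^ b)\<^sup>2 * w z)"
    by (intro Bochner_Integration.integrable_add w_moments)
  show "gfun w a b \<in> borel_measurable lborel" 
    by (rule measurable_cong_sets[OF sets_lborel refl, THEN equalityD2, THEN subsetD, OF gfun_measurable])
  show "AE z in lborel. norm (gfun w a b z) \<le> norm ((cmod z ^ a)\<^sup>2 * w z + (cmod z ^ b)\<^sup>2 * w z)"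
  proof (rule AE_I2)
    fix z
    have st: "s * t \<le> s\<^sup>2 + t\<^sup>2" if "s \<ge> 0" "t \<ge> 0" for s t :: real
      using sum_squares_bound[of s t] mult_nonneg_nonneg[OF that] by linarith
    have "norm (gfun w a b z) = (cmod z ^ a * cmod z ^ b) * w z"
      using w_nonneg by (simp add: gfun_def norm_mult norm_power)
    also have "\<dots> \<le> ((cmod z ^ a)\<^sup>2 + (cmod z ^ b)\<^sup>2) * w z"
      by (intro mult_right_mono st w_nonneg) auto
    finally show "norm (gfun w a b z) \<le> norm ((cmod z ^ a)\<^sup>2 * w z + (cmod z ^ b)\<^sup>2 * w z)"
      using w_nonneg by (simp add: distrib_right)
  qed
qed

text \<open>Polar coordinates are avoided: for a \<noteq> b the rotation by the angle pi / (a - b)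
  multiplies the integrand by -1 and preserves the measure, so the integral equals its own
  negative.\<close>

lemma gfun_integral: "integral\<^sup>L lborel (gfun w a b) = (if a = b then of_real (mom w a) else 0)"
proof (cases "a = b")
  case True
  have "gfun w a a z = of_real ((cmod z ^ a)\<^sup>2 * w z)" for z
  proof -
    have "z ^ a * cnj z ^ a = of_real ((cmod z ^ a)\<^sup>2)"
      using complex_norm_square[of "z ^ a"] by (simp add: norm_power)
    then show ?thesis by (simp add: gfun_def)
  qed
  then have "gfun w a a = (\<lambda>z. of_real ((cmod z ^ a)\<^sup>2 * w z))" by (rule ext)
  then show ?thesis using True by (simp only: simp_thms if_True mom_def integral_complex_of_real)
next
  case False
  define \<theta> where "\<theta> = pi / (real a - real b)"
  define u where "u = cis \<theta>"
  have u1: "cmod u = 1" by (simp add: u_def)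
  have "u ^ a * cnj u ^ b = cis (real a * \<theta> - real b * \<theta>)"
    unfolding u_def cis_cnj Complex.DeMoivre cis_mult by simp
  also have "real a * \<theta> - real b * \<theta> = (real a - real b) * \<theta>" by (simp add: algebra_simps)
  also have "\<dots> = pi" using False by (simp add: \<theta>_def)
  finally have um: "u ^ a * cnj u ^ b = - 1" by simp
  have "integral\<^sup>L lborel (gfun w a b) = integral\<^sup>L (distr lborel borel (\<lambda>z. u * z)) (gfun w a b)"
    by (simp add: distr_rotation[OF u1])
  also have "\<dots> = (\<integral>z. gfun w a b (u * z) \<partial>lborel)"
    by (rule integral_distr[OF _ gfun_measurable]) simp
  also have "(\<lambda>z. gfun w a b (u * z)) = (\<lambda>z. - gfun w a b z)"
  proof
    fix z
    have "gfun w a b (u * z) = (u ^ a * cnj u ^ b) * gfun w a b z"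
      by (simp add: gfun_def w_radial[OF u1] power_mult_distrib mult_ac)
    then show "gfun w a b (u * z) = - gfun w a b z" by (simp add: um)
  qed
  also have "(\<integral>z. - gfun w a b z \<partial>lborel) = - integral\<^sup>L lborel (gfun w a b)" by simp
  finally show ?thesis using False by simp
qed

text \<open>Expanding both Vandermonde determinants, all mixed terms vanish by rotation invariance.\<close>

lemma nn_integral_vdm:
  "(\<integral>\<^sup>+x. ennreal ((cmod (vdm n x))\<^sup>2 * (\<Prod>i<n. w (x i))) \<partial>LC {..<n}) = ennreal (fact n * (\<Prod>k<n. mom w k))"
proof -
  let ?S = "{p. p permutes {0..<n}}"
  let ?h = "\<lambda>p q x. of_int (sign p) * of_int (sign q) * (\<Prod>i<n. gfun w (p i) (q i) (x i))"
  define H where "H x = (cmod (vdm n x))\<^sup>2 * (\<Prod>i<n. w (x i))" for x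
  have HC: "complex_of_real (H x) = (\<Sum>p\<in>?S. \<Sum>q\<in>?S. ?h p q x)" for x
  proof -
    have "complex_of_real (H x) = vdm n x * cnj (vdm n x) * (\<Prod>i<n. of_real (w (x i)))"
      by (simp add: H_def complex_norm_square del: of_real_power)
    also have "vdm n x * cnj (vdm n x)
      = (\<Sum>p\<in>?S. \<Sum>q\<in>?S. (of_int (sign p) * (\<Prod>i<n. x i ^ p i)) * (of_int (sign q) * (\<Prod>i<n. cnj (x i) ^ q i)))"
      unfolding vdm_Leibniz by (simp add: sum_product)
    finally show ?thesis
      unfolding sum_distrib_right gfun_def prod.distrib by (simp only: mult_ac)
  qed
  have hint: "integrable (LC {..<n}) (?h p q)" for p q
    by (intro integrable_mult_right LC.product_integrable_prod gfun_integrable) simp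
  have hval: "integral\<^sup>L (LC {..<n}) (?h p q) = (if p = q then of_real (\<Prod>k<n. mom w k) else 0)"
    if p: "p \<in> ?S" and q: "q \<in> ?S" for p q
  proof -
    have "integral\<^sup>L (LC {..<n}) (?h p q)
      = of_int (sign p) * of_int (sign q) * (\<Prod>i<n. if p i = q i then of_real (mom w (p i)) else 0)"
      using LC.product_integral_prod[of "{..<n}" "\<lambda>i. gfun w (p i) (q i)"] gfun_integrable
      by (simp add: gfun_integral)
    also have "\<dots> = (if p = q then of_real (\<Prod>k<n. mom w k) else 0)"
    proof (cases "p = q")
      case True
      have "(\<Prod>i<n. mom w (p i)) = (\<Prod>k<n. mom w k)"
        using p by (intro prod.permute[of p "{..<n}" "mom w", unfolded o_def, symmetric]) (simp add: atLeast0LessThan)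
      moreover have "of_int (sign p) * of_int (sign p) = (1 :: complex)"
        by (metis of_int_1 of_int_mult sign_idempotent)
      ultimately show ?thesis using True by (simp flip: of_real_prod)
    next
      case False
      then obtain i where i: "p i \<noteq> q i" by auto
      then have "i < n"
        using p q by (metis atLeast0LessThan lessThan_iff mem_Collect_eq permutes_not_in)
      then have "(\<Prod>i<n. if p i = q i then complex_of_real (mom w (p i)) else 0) = 0"
        using i by (intro prod_zero) auto
      then show ?thesis using False by simp
    qed
    finally show ?thesis .
  qed
  have fin: "finite ?S" by (rule finite_permutations) simp
  have "integrable (LC {..<n}) (\<lambda>x. complex_of_real (H x))"
    unfolding HC by (intro Bochner_Integration.integrable_sum hint)
  then have Hint: "integrable (LC {..<n}) H" by (simp only: complex_of_real_integrable_eq)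
  have "complex_of_real (integral\<^sup>L (LC {..<n}) H) = (\<integral>x. complex_of_real (H x) \<partial>LC {..<n})"
    by (rule integral_complex_of_real[symmetric])
  also have "\<dots> = (\<Sum>p\<in>?S. \<Sum>q\<in>?S. integral\<^sup>L (LC {..<n}) (?h p q))"
    unfolding HC by (simp add: Bochner_Integration.integral_sum Bochner_Integration.integrable_sum hint del: Bochner_Integration.integral_mult_right_zero)
  also have "\<dots> = (\<Sum>p\<in>?S. \<Sum>q\<in>?S. if p = q then of_real (\<Prod>k<n. mom w k) else 0)"
    by (intro sum.cong refl hval)
  also have "\<dots> = (\<Sum>p\<in>?S. of_real (\<Prod>k<n. mom w k))"
    using fin by (intro sum.cong refl) simp
  also have "\<dots> = complex_of_real (fact n * (\<Prod>k<n. mom w k))"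
    using card_permutations[of "{0..<n}" n] by simp
  finally have val: "integral\<^sup>L (LC {..<n}) H = fact n * (\<Prod>k<n. mom w k)"
    by (simp only: of_real_eq_iff)
  have "(\<integral>\<^sup>+x. ennreal (H x) \<partial>LC {..<n}) = ennreal (integral\<^sup>L (LC {..<n}) H)"
    by (rule nn_integral_eq_integral[OF Hint]) (auto simp: H_def intro!: mult_nonneg_nonneg prod_nonneg w_nonneg)
  then show ?thesis unfolding val H_def .
qed

end

section \<open>Splitting off one eigenvalue\<close>

text \<open>The weight of the spectrum is multiplicative along deflation; the list \<open>ms\<close> collects the
  eigenvalues that were split off before.\<close>

definition spec_weight :: "real \<Rightarrow> real \<Rightarrow> nat \<Rightarrow> complex list \<Rightarrow> (nat \<times> nat \<Rightarrow> complex) \<Rightarrow> real" where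
  "spec_weight r L n ms x = (if \<exists>z\<in>ball 0 r. cp n x z = 0 then 0 else 1)
     * (\<Prod>m\<leftarrow>ms. (cmod (cp n x m))\<^sup>2) * ((cmod (cp n x 0))\<^sup>2) powr L"

text \<open>The power is taken of the squared modulus, exactly as in \<open>spec_weight\<close>, so
  that the weights factor at every point, including the value 0 of \<open>0 powr 0\<close> when L =
  0.\<close>

definition pt_weight :: "real \<Rightarrow> real \<Rightarrow> complex \<Rightarrow> real" where
  "pt_weight r L z = (if cmod z < r then 0 else 1) * ((cmod z)\<^sup>2) powr L * exp (- (cmod z)\<^sup>2)"

text \<open>For the empty list this is, up to normalization, the probability that no eigenvalue lies
  in the open disc of radius r. In general it also averages the product of |det (m - A)|^2 over the
  list.\<close>

definition gauss_int :: "real \<Rightarrow> real \<Rightarrow> nat \<Rightarrow> complex list \<Rightarrow> ennreal" where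
  "gauss_int r L n ms = (\<integral>\<^sup>+x. ennreal (spec_weight r L n ms x * exp (- fro n x)) \<partial>LC (sq n))"

text \<open>The Gaussian of the last row after its centre has been removed; its shape depends on the
  last column through \<open>colnorm\<close> and \<open>Hm\<close>.\<close>

definition row_gauss :: "nat \<Rightarrow> (nat \<times> nat \<Rightarrow> complex) \<Rightarrow> ennreal" where
  "row_gauss n x = ennreal (exp (- (\<Sum>j<n. (cmod (of_real (colnorm n x) * (\<Sum>k<n. x (n, k) * Hm n x k j)))\<^sup>2)))"

lemma spec_weight_nonneg: "spec_weight r L n ms x \<ge> 0"
  by (auto simp: spec_weight_def intro!: mult_nonneg_nonneg prod_list_nonneg)

lemma pt_weight_nonneg: "pt_weight r L z \<ge> 0"
  by (simp add: pt_weight_def)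

lemma spec_weight_cong: "cpol n x = cpol n y \<Longrightarrow> spec_weight r L n ms x = spec_weight r L n ms y"
  by (simp add: spec_weight_def)

text \<open>The characteristic polynomial splits off the factor t - \<lambda>, so each factor of the
  weight becomes a product of a term in \<lambda> and a term in the smaller block. The Jacobian |det
  (\<lambda> - A')|^2 is exactly the factor that puts \<lambda> on the list.\<close>

lemma spec_weight_deflate:
  "spec_weight r L (Suc n) ms (deflate n x) * (cmod (cp n x (x (n, n))))\<^sup>2 * exp (- (cmod (x (n, n)))\<^sup>2)
    = pt_weight r L (x (n, n)) * (\<Prod>m\<leftarrow>ms. (cmod (m - x (n, n)))\<^sup>2) * spec_weight r L n (x (n, n) # ms) x"
proof -
  let ?l = "x (n, n)"
  have cp: "cp (Suc n) (deflate n x) z = (z - ?l) * cp n x z" for z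
    by (simp add: cpol_deflate algebra_simps)
  have "(\<exists>z\<in>ball 0 r. cp (Suc n) (deflate n x) z = 0) \<longleftrightarrow> cmod ?l < r \<or> (\<exists>z\<in>ball 0 r. cp n x z = 0)"
    by (auto simp: cp)
  moreover have "(\<Prod>m\<leftarrow>ms. (cmod (cp (Suc n) (deflate n x) m))\<^sup>2)
    = (\<Prod>m\<leftarrow>ms. (cmod (m - ?l))\<^sup>2) * (\<Prod>m\<leftarrow>ms. (cmod (cp n x m))\<^sup>2)"
    unfolding cp by (induction ms) (simp_all add: norm_mult power_mult_distrib mult_ac)
  moreover have "((cmod (cp (Suc n) (deflate n x) 0))\<^sup>2) powr L = ((cmod ?l)\<^sup>2) powr L * ((cmod (cp n x 0))\<^sup>2) powr L"
    unfolding cp by (simp add: norm_mult power_mult_distrib powr_mult)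
  ultimately show ?thesis
    unfolding spec_weight_def pt_weight_def by (auto simp: mult_ac)
qed

section \<open>Measurability of the spectral and Gaussian weights\<close>

lemma measurable_if_ex_root:
  "(\<lambda>x. if \<exists>z\<in>ball 0 r. cp n x z = 0 then 0 else 1 :: real) \<in> borel_measurable (LC (sq n))"
proof -
  have "Measurable.pred (LC (sq n)) (\<lambda>x. \<exists>z\<in>ball 0 r. cp n x z = 0)"
    unfolding pred_def by (rule sets_eigenvalue_ball)
  then show ?thesis by measurable
qed

lemma cp_pair_measurable:
  assumes "m \<in> borel_measurable M"
  shows "(\<lambda>p. cp n (snd p) (m (fst p))) \<in> borel_measurable (M \<Otimes>\<^sub>M LC (sq n))"
proof (rule cp_measurable[where x = snd and z = "\<lambda>p. m (fst p)"])
  fix i j assume "i < n" "j < n"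
  then have "(i, j) \<in> sq n" by (simp add: sq_def)
  then show "(\<lambda>p. snd p (i, j)) \<in> borel_measurable (M \<Otimes>\<^sub>M LC (sq n))"
    by (intro measurable_compose[OF measurable_snd LC_coordinate_measurable])
qed (rule measurable_compose[OF measurable_fst assms])

lemma spec_weight_pair_measurable:
  "(\<lambda>p. spec_weight r L n (fst p # ms) (snd p)) \<in> borel_measurable (lborel \<Otimes>\<^sub>M LC (sq n))"
proof -
  let ?M = "(lborel :: complex measure) \<Otimes>\<^sub>M LC (sq n)"
  have id: "(\<lambda>z. z) \<in> borel_measurable (lborel :: complex measure)"
    by (rule measurable_ident_sets[OF sets_lborel])
  have c1: "(\<lambda>p. cp n (snd p) (fst p)) \<in> borel_measurable ?M"
    by (rule cp_pair_measurable[OF id])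
  have c2: "(\<lambda>p. cp n (snd p) m) \<in> borel_measurable ?M" for m
    by (rule cp_pair_measurable[OF borel_measurable_const])
  have sq: "(\<lambda>p. (cmod (h p))\<^sup>2) \<in> borel_measurable ?M" if "h \<in> borel_measurable ?M" for h
    by (intro borel_measurable_power measurable_compose[OF that borel_measurable_norm])
  have pl: "(\<lambda>p. \<Prod>m\<leftarrow>ms. (cmod (cp n (snd p) m))\<^sup>2) \<in> borel_measurable ?M"
    by (induction ms) (simp_all only: list.map prod_list.Nil prod_list.Cons borel_measurable_const borel_measurable_times sq[OF c2])
  show ?thesis
    unfolding spec_weight_def list.map prod_list.Cons
    by (intro borel_measurable_times sq[OF c1] pl measurable_compose[OF measurable_snd measurable_if_ex_root]
        powr_real_measurable borel_measurable_const sq[OF c2])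
qed

lemma spec_weight_measurable: "(\<lambda>x. spec_weight r L n ms x) \<in> borel_measurable (LC (sq n))"
proof -
  have c: "(\<lambda>x. (cmod (cp n x m))\<^sup>2) \<in> borel_measurable (LC (sq n))" for m
    by (intro borel_measurable_power measurable_compose[OF cp_LC_measurable borel_measurable_norm] order_refl)
  have pl: "(\<lambda>x. \<Prod>m\<leftarrow>ms. (cmod (cp n x m))\<^sup>2) \<in> borel_measurable (LC (sq n))"
    by (induction ms) (simp_all only: list.map prod_list.Nil prod_list.Cons borel_measurable_const borel_measurable_times c)
  show ?thesis
    unfolding spec_weight_def
    by (intro borel_measurable_times c pl measurable_if_ex_root powr_real_measurable borel_measurable_const)
qed

lemma fro_measurable: "fro n \<in> borel_measurable (LC (sq n))"
  unfolding fro_def[abs_def]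
  by (intro borel_measurable_sum borel_measurable_power measurable_compose[OF LC_coordinate_measurable borel_measurable_norm])
    (auto simp: sq_def)

lemma ennreal_exp_measurable:
  "h \<in> borel_measurable M \<Longrightarrow> (\<lambda>x. ennreal (exp (- h x))) \<in> borel_measurable M"
  by (intro measurable_compose[OF _ measurable_ennreal] measurable_compose[OF _ borel_measurable_exp] borel_measurable_uminus)

lemma gauss_int_measurable:
  "(\<lambda>z. gauss_int r L n (z # ms)) \<in> borel_measurable lborel"
proof -
  interpret L: finite_product_sigma_finite "\<lambda>_. lborel :: complex measure" "sq n"
    by standard simp
  have m: "(\<lambda>p. ennreal (spec_weight r L n (fst p # ms) (snd p) * exp (- fro n (snd p)))) \<in> borel_measurable (lborel \<Otimes>\<^sub>M LC (sq n))"
    by (intro measurable_compose[OF _ measurable_ennreal] borel_measurable_times spec_weight_pair_measurable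
        measurable_compose[OF _ borel_measurable_exp] borel_measurable_uminus measurable_compose[OF measurable_snd fro_measurable])
  have eq: "case_prod (\<lambda>z x. ennreal (spec_weight r L n (z # ms) x * exp (- fro n x)))
    = (\<lambda>p. ennreal (spec_weight r L n (fst p # ms) (snd p) * exp (- fro n (snd p))))"
    by (simp add: fun_eq_iff)
  show ?thesis
    unfolding gauss_int_def by (rule L.borel_measurable_nn_integral) (simp only: eq m)
qed

lemma cpol_conj_act:
  assumes GH: "\<And>i j. i < n \<Longrightarrow> j < n \<Longrightarrow> (\<Sum>k<n. G i k * H k j) = (if i = j then 1 else 0)"
    and HG: "\<And>i j. i < n \<Longrightarrow> j < n \<Longrightarrow> (\<Sum>k<n. H i k * G k j) = (if i = j then 1 else 0)"
  shows "cpol n (conj_act n G H x) = cpol n x"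
proof -
  let ?G = "Matrix.mat n n (\<lambda>(i, j). G i j)" and ?H = "Matrix.mat n n (\<lambda>(i, j). H i j)"
  have "?G * ?H = 1\<^sub>m n" "?H * ?G = 1\<^sub>m n"
    using GH HG by (auto intro!: eq_matI simp: scalar_prod_def atLeast0LessThan)
  moreover have "Matrix.mat n n (conj_act n G H x) = ?G * Matrix.mat n n x * ?H"
  proof (rule eq_matI)
    fix i j assume "i < dim_row (?G * Matrix.mat n n x * ?H)" "j < dim_col (?G * Matrix.mat n n x * ?H)"
    then have ij: "i < n" "j < n" by auto
    have "(?G * Matrix.mat n n x * ?H) $$ (i, j) = (\<Sum>l<n. (\<Sum>k<n. G i k * x (k, l)) * H l j)"
      using ij by (simp add: scalar_prod_def atLeast0LessThan)
    also have "\<dots> = (\<Sum>k<n. \<Sum>l<n. G i k * x (k, l) * H l j)"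
      unfolding sum_distrib_right by (rule sum.swap)
    finally show "Matrix.mat n n (conj_act n G H x) $$ (i, j) = (?G * Matrix.mat n n x * ?H) $$ (i, j)"
      using ij by (simp add: conj_act_def sq_def)
  qed auto
  ultimately have "similar_mat (Matrix.mat n n (conj_act n G H x)) (Matrix.mat n n x)"
    by (intro similar_matI[of _ _ ?G ?H n]) auto
  then show ?thesis unfolding cpol_def by (rule char_poly_similar)
qed

text \<open>These quantities see only the last column, so they are constants while the block, the
  last row or the corner is integrated.\<close>

lemma column_cong:
  assumes "\<And>k. k < n \<Longrightarrow> x (k, n) = y (k, n)"
  shows "colnorm n x = colnorm n y" "i < n \<Longrightarrow> j < n \<Longrightarrow> Gm n x i j = Gm n y i j" "i < n \<Longrightarrow> j < n \<Longrightarrow> Hm n x i j = Hm n y i j"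
proof -
  have "(\<Sum>k<n. (cmod (x (k, n)))\<^sup>2) = (\<Sum>k<n. (cmod (y (k, n)))\<^sup>2)"
    by (intro sum.cong refl) (simp add: assms)
  then show c: "colnorm n x = colnorm n y" unfolding colnorm_def by (simp only:)
  show "i < n \<Longrightarrow> j < n \<Longrightarrow> Gm n x i j = Gm n y i j" "i < n \<Longrightarrow> j < n \<Longrightarrow> Hm n x i j = Hm n y i j"
    unfolding Gm_def Hm_def c by (simp_all add: assms)
qed

lemma column_measurable:
  assumes J: "\<And>k. k < n \<Longrightarrow> (k, n) \<in> J"
  shows colnorm_measurable: "colnorm n \<in> borel_measurable (LC J)"
    and Gm_measurable: "i < n \<Longrightarrow> j < n \<Longrightarrow> (\<lambda>x. Gm n x i j) \<in> borel_measurable (LC J)"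
    and Hm_measurable: "i < n \<Longrightarrow> j < n \<Longrightarrow> (\<lambda>x. Hm n x i j) \<in> borel_measurable (LC J)"
proof -
  let ?M = "LC J"
  have co: "(\<lambda>x. x (k, n)) \<in> borel_measurable ?M" if "k < n" for k
    by (rule LC_coordinate_measurable[OF J[OF that]])
  show c: "colnorm n \<in> borel_measurable ?M"
    unfolding colnorm_def[abs_def]
    by (intro measurable_compose[OF _ borel_measurable_sqrt] borel_measurable_add borel_measurable_const borel_measurable_sum
        borel_measurable_power measurable_compose[OF co borel_measurable_norm]) simp
  have cnj: "(\<lambda>x. cnj (x (k, n))) \<in> borel_measurable ?M" if "k < n" for k
    using that by (intro borel_measurable_continuous_on[where f = cnj] continuous_on_cnj continuous_on_id co)
  have of: "(\<lambda>x. complex_of_real (h x)) \<in> borel_measurable ?M" if "h \<in> borel_measurable ?M" for h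
    by (rule measurable_compose[OF that borel_measurable_of_real])
  show "i < n \<Longrightarrow> j < n \<Longrightarrow> (\<lambda>x. Gm n x i j) \<in> borel_measurable ?M"
    unfolding Gm_def
    by (intro borel_measurable_diff borel_measurable_const borel_measurable_times of borel_measurable_divide borel_measurable_add c cnj co)
  show "i < n \<Longrightarrow> j < n \<Longrightarrow> (\<lambda>x. Hm n x i j) \<in> borel_measurable ?M"
    unfolding Hm_def
    by (intro borel_measurable_diff borel_measurable_const borel_measurable_times of borel_measurable_divide borel_measurable_add c cnj co)
qed

lemma row_gauss_measurable:
  assumes J: "\<And>k. k < n \<Longrightarrow> (k, n) \<in> J" "\<And>k. k < n \<Longrightarrow> (n, k) \<in> J"
  shows "row_gauss n \<in> borel_measurable (LC J)"
  unfolding row_gauss_def[abs_def]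
  by (intro ennreal_exp_measurable borel_measurable_sum borel_measurable_power borel_measurable_times
      measurable_compose[OF _ borel_measurable_norm] measurable_compose[OF colnorm_measurable borel_measurable_of_real]
      Hm_measurable LC_coordinate_measurable J) (simp_all add: J)

definition rowset :: "nat \<Rightarrow> (nat \<times> nat) set" where "rowset n = {n} \<times> {..<n}"

text \<open>The part of the deflated integrand that does not involve the last row.\<close>

definition mod_weight :: "real \<Rightarrow> real \<Rightarrow> nat \<Rightarrow> complex list \<Rightarrow> (nat \<times> nat \<Rightarrow> complex) \<Rightarrow> real" where
  "mod_weight r L n ms x = pt_weight r L (x (n, n)) * (\<Prod>m\<leftarrow>ms. (cmod (m - x (n, n)))\<^sup>2)
     * spec_weight r L n (x (n, n) # ms) x * exp (- fro n (conj_act n (Gm n x) (Hm n x) x))"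

text \<open>The integral over the last column and the last row without the corner. Being an
  \<open>ennreal\<close>, it can be carried along before anything is known about its
  finiteness.\<close>

definition row_const :: "nat \<Rightarrow> ennreal" where
  "row_const n = (\<integral>\<^sup>+x. row_gauss n x \<partial>LC (sq (Suc n) - sq n - {(n, n)}))"

lemma pt_weight_measurable: "pt_weight r L \<in> borel_measurable borel"
proof -
  have "Measurable.pred borel (\<lambda>z::complex. cmod z < r)"
    unfolding pred_def by (intro borel_open) (simp add: open_Collect_less continuous_on_norm continuous_on_id)
  then show ?thesis
    unfolding pt_weight_def[abs_def] by measurable
qed

lemma prod_list_diff_measurable: "(\<lambda>z. \<Prod>m\<leftarrow>ms. (cmod (m - z))\<^sup>2) \<in> borel_measurable borel"
proof (induction ms)
  case (Cons m ms)
  have "(\<lambda>z. (cmod (m - z))\<^sup>2) \<in> borel_measurable borel"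
    by (intro borel_measurable_continuous_onI continuous_intros)
  then show ?case unfolding list.map prod_list.Cons by (rule borel_measurable_times) (rule Cons.IH)
qed (simp only: list.map prod_list.Nil borel_measurable_const)

lemma mod_weight_nonneg: "mod_weight r L n ms x \<ge> 0"
  unfolding mod_weight_def
  by (intro mult_nonneg_nonneg pt_weight_nonneg spec_weight_nonneg prod_list_nonneg) auto

lemma conj_act_cong:
  assumes "\<And>i j. i < n \<Longrightarrow> j < n \<Longrightarrow> G i j = G' i j" "\<And>i j. i < n \<Longrightarrow> j < n \<Longrightarrow> H i j = H' i j"
    "\<And>i j. i < n \<Longrightarrow> j < n \<Longrightarrow> x (i, j) = y (i, j)"
  shows "conj_act n G H x = conj_act n G' H' y"
  unfolding conj_act_def
proof (rule restrict_ext)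
  fix p assume "p \<in> sq n"
  then obtain i j where "p = (i, j)" "i < n" "j < n" by (auto simp: sq_def)
  moreover from this have "(\<Sum>k<n. \<Sum>l<n. G i k * x (k, l) * H l j) = (\<Sum>k<n. \<Sum>l<n. G' i k * y (k, l) * H' l j)"
    by (intro sum.cong refl) (simp add: assms)
  ultimately show "(case p of (i, j) \<Rightarrow> \<Sum>k<n. \<Sum>l<n. G i k * x (k, l) * H l j)
    = (case p of (i, j) \<Rightarrow> \<Sum>k<n. \<Sum>l<n. G' i k * y (k, l) * H' l j)" by simp
qed

lemma fro_conj_act_measurable:
  "(\<lambda>x. fro n (conj_act n (Gm n x) (Hm n x) x)) \<in> borel_measurable (LC (sq (Suc n)))"
proof -
  have eq: "fro n (conj_act n (Gm n x) (Hm n x) x)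
    = (\<Sum>i<n. \<Sum>j<n. (cmod (\<Sum>k<n. \<Sum>l<n. Gm n x i k * x (k, l) * Hm n x l j))\<^sup>2)" for x
    unfolding fro_def by (intro sum.cong refl) (simp add: conj_act_def sq_def)
  have J: "(k, n) \<in> sq (Suc n)" if "k < n" for k using that by (simp add: sq_def)
  show ?thesis
    unfolding eq
    by (intro borel_measurable_sum borel_measurable_power measurable_compose[OF _ borel_measurable_norm] borel_measurable_times
        Gm_measurable Hm_measurable J coord_sq) simp_all
qed

lemma mod_weight_measurable: "mod_weight r L n ms \<in> borel_measurable (LC (sq (Suc n)))"
proof -
  let ?M = "LC (sq (Suc n))"
  have c: "(\<lambda>x. x (n, n)) \<in> borel_measurable ?M" by (rule coord_sq) auto
  have c': "(\<lambda>x. x (n, n)) \<in> measurable ?M lborel"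
    by (rule measurable_cong_sets[OF refl sets_lborel, THEN equalityD2, THEN subsetD, OF c])
  have res: "(\<lambda>x. restrict x (sq n)) \<in> measurable ?M (LC (sq n))"
    by (rule measurable_restrict_subset) (auto simp: sq_def)
  have "(\<lambda>x. spec_weight r L n (x (n, n) # ms) (restrict x (sq n))) \<in> borel_measurable ?M"
    using measurable_compose[OF measurable_Pair[OF c' res] spec_weight_pair_measurable] by (simp only: fst_conv snd_conv)
  moreover have "spec_weight r L n l (restrict x (sq n)) = spec_weight r L n l x" for l x
    by (intro spec_weight_cong cp_cong) (simp add: sq_def)
  ultimately have sw: "(\<lambda>x. spec_weight r L n (x (n, n) # ms) x) \<in> borel_measurable ?M" by (simp only:)
  show ?thesis
    unfolding mod_weight_def[abs_def]
    by (intro borel_measurable_times sw measurable_compose[OF c pt_weight_measurable] measurable_compose[OF c prod_list_diff_measurable]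
        measurable_compose[OF _ borel_measurable_exp] borel_measurable_uminus fro_conj_act_measurable)
qed

text \<open>The exponential turns the three terms of \<open>fro_deflate\<close> into a product, of
  which exp (-|\<lambda>|^2) goes to the one-point weight.\<close>

lemma deflate_integrand:
  "ennreal (spec_weight r L (Suc n) ms (deflate n x) * exp (- fro (Suc n) (deflate n x))) * ennreal ((cmod (cp n x (x (n, n))))\<^sup>2)
    = ennreal (mod_weight r L n ms x)
      * ennreal (exp (- (\<Sum>j<n. (cmod (of_real (colnorm n x) * (\<Sum>k<n. x (n, k) * Hm n x k j) + row_offset n x j))\<^sup>2)))"
  (is "_ = _ * ennreal (exp (- ?R))")
proof -
  have "spec_weight r L (Suc n) ms (deflate n x) * exp (- fro (Suc n) (deflate n x)) * (cmod (cp n x (x (n, n))))\<^sup>2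
    = (spec_weight r L (Suc n) ms (deflate n x) * (cmod (cp n x (x (n, n))))\<^sup>2 * exp (- (cmod (x (n, n)))\<^sup>2))
      * exp (- fro n (conj_act n (Gm n x) (Hm n x) x)) * exp (- ?R)"
    unfolding fro_deflate by (simp add: exp_add[symmetric] mult_ac)
  also have "\<dots> = mod_weight r L n ms x * exp (- ?R)"
    unfolding spec_weight_deflate mod_weight_def by simp
  finally show ?thesis
    by (simp add: ennreal_mult[symmetric] spec_weight_nonneg mod_weight_nonneg)
qed

text \<open>The last row occurs only through a Gaussian whose centre depends on the other entries, and a
  translation of the row removes the centre.\<close>

lemma nn_integral_row_centre:
  fixes r L ms n
  defines "B \<equiv> \<lambda>x. ennreal (mod_weight r L n ms x) * row_gauss n x"
  shows "(\<integral>\<^sup>+x. ennreal (mod_weight r L n ms x)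
      * ennreal (exp (- (\<Sum>j<n. (cmod (of_real (colnorm n x) * (\<Sum>k<n. x (n, k) * Hm n x k j) + row_offset n x j))\<^sup>2))) \<partial>LC (sq (Suc n)))
    = integral\<^sup>N (LC (sq (Suc n))) B"
proof -
  let ?I = "sq (Suc n)" and ?J = "rowset n"
  \<comment> \<open>The shift v of the last row that solves colnorm * (v Hm) =
    \<open>row_offset\<close>, using Gm Hm = 1.\<close>
  let ?g = "\<lambda>p x. (\<Sum>l<n. row_offset n x l * Gm n x l (snd p)) / of_real (colnorm n x)"
  define T where "T x = (\<lambda>p\<in>?I. if p \<in> ?J then 1 * x p + ?g p x else x p)" for x
  have J: "(k, n) \<in> sq (Suc n)" "(n, k) \<in> sq (Suc n)" if "k < n" for k using that by (simp_all add: sq_def)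
  have B: "B \<in> borel_measurable (LC ?I)"
    unfolding B_def
    by (intro borel_measurable_times_ennreal measurable_compose[OF mod_weight_measurable measurable_ennreal] row_gauss_measurable J)
  have off: "(\<lambda>x. row_offset n x j) \<in> borel_measurable (LC ?I)" if "j < n" for j
    unfolding row_offset_def using that
    by (intro borel_measurable_diff borel_measurable_sum borel_measurable_times borel_measurable_divide coord_sq
        Hm_measurable J borel_measurable_continuous_on[where f = cnj] continuous_on_cnj continuous_on_id
        measurable_compose[OF colnorm_measurable borel_measurable_of_real]) simp_all
  have Bshift: "B (T x) = ennreal (mod_weight r L n ms x)
      * ennreal (exp (- (\<Sum>j<n. (cmod (of_real (colnorm n x) * (\<Sum>k<n. x (n, k) * Hm n x k j) + row_offset n x j))\<^sup>2)))" for x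
  proof -
    have a: "complex_of_real (colnorm n x) \<noteq> 0" using colnorm_pos[of n x] by simp
    have Tcol: "T x (k, n) = x (k, n)" if "k \<le> n" for k using that by (auto simp: T_def rowset_def sq_def)
    have Tblock: "T x (i, j) = x (i, j)" if "i < n" "j < n" for i j using that by (auto simp: T_def rowset_def sq_def)
    have Trow: "T x (n, k) = x (n, k) + (\<Sum>l<n. row_offset n x l * Gm n x l k) / of_real (colnorm n x)" if "k < n" for k
      using that by (auto simp: T_def rowset_def sq_def)
    note cc = column_cong[of n "T x" x, OF Tcol[OF less_imp_le]]
    have "conj_act n (Gm n (T x)) (Hm n (T x)) (T x) = conj_act n (Gm n x) (Hm n x) x"
      by (rule conj_act_cong) (auto simp: cc Tblock)
    moreover have "cpol n (T x) = cpol n x" by (rule cp_cong) (simp add: Tblock)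
    ultimately have m: "mod_weight r L n ms (T x) = mod_weight r L n ms x"
      using spec_weight_cong[of n "T x" x r L] by (simp add: mod_weight_def Tcol)
    have "of_real (colnorm n (T x)) * (\<Sum>k<n. T x (n, k) * Hm n (T x) k j)
      = of_real (colnorm n x) * (\<Sum>k<n. x (n, k) * Hm n x k j) + row_offset n x j" if j: "j < n" for j
    proof -
      have "of_real (colnorm n (T x)) * (\<Sum>k<n. T x (n, k) * Hm n (T x) k j)
        = of_real (colnorm n x) * (\<Sum>k<n. x (n, k) * Hm n x k j + (\<Sum>l<n. row_offset n x l * Gm n x l k) / of_real (colnorm n x) * Hm n x k j)"
        unfolding cc(1) using j by (intro arg_cong2[where f = "(*)"] sum.cong refl) (simp_all add: cc Trow distrib_right)
      also have "\<dots> = of_real (colnorm n x) * (\<Sum>k<n. x (n, k) * Hm n x k j)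
          + (\<Sum>k<n. (\<Sum>l<n. row_offset n x l * Gm n x l k) * Hm n x k j)"
        using a by (simp add: sum.distrib distrib_left sum_distrib_left)
      also have "(\<Sum>k<n. (\<Sum>l<n. row_offset n x l * Gm n x l k) * Hm n x k j)
        = (\<Sum>l<n. row_offset n x l * (\<Sum>k<n. Gm n x l k * Hm n x k j))"
        unfolding sum_distrib_right sum_distrib_left by (subst sum.swap) (simp add: mult.assoc)
      also have "\<dots> = (\<Sum>l<n. row_offset n x l * (if l = j then 1 else 0))"
        using j by (intro sum.cong refl) (simp add: Gm_Hm)
      also have "\<dots> = (\<Sum>l<n. if l = j then row_offset n x l else 0)"
        by (intro sum.cong refl) simp
      also have "\<dots> = row_offset n x j" using j by simp
      finally show ?thesis .
    qed
    then have "row_gauss n (T x)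
      = ennreal (exp (- (\<Sum>j<n. (cmod (of_real (colnorm n x) * (\<Sum>k<n. x (n, k) * Hm n x k j) + row_offset n x j))\<^sup>2)))"
      unfolding row_gauss_def by (intro arg_cong[where f = "\<lambda>s. ennreal (exp (- s))"] sum.cong refl) simp
    then show ?thesis unfolding B_def m by simp
  qed
  have "(\<integral>\<^sup>+x. B (\<lambda>p\<in>?I. if p \<in> ?J then 1 * x p + ?g p x else x p) \<partial>LC ?I) * ennreal (\<Prod>p\<in>?J. (cmod 1)\<^sup>2)
    = integral\<^sup>N (LC ?I) B"
  proof (rule nn_integral_LC_triangular[where ord = snd])
    show "?J \<subseteq> ?I" by (auto simp: rowset_def sq_def)
    show "inj_on snd ?J" by (auto simp: rowset_def inj_on_def)
    show "?g p \<in> borel_measurable (LC ?I)" if "p \<in> ?J" for p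
      using that
      by (intro borel_measurable_divide borel_measurable_sum borel_measurable_times off Gm_measurable J
        measurable_compose[OF colnorm_measurable borel_measurable_of_real]) (auto simp: rowset_def)
    show "?g p x = ?g p y"
      if p: "p \<in> ?J" and xy: "\<And>i. i \<in> ?I \<Longrightarrow> i \<notin> ?J \<or> snd p < snd i \<Longrightarrow> x i = y i" for p x y
    proof -
      have col: "x (k, n) = y (k, n)" if "k \<le> n" for k using that by (intro xy) (auto simp: rowset_def sq_def)
      have blk: "x (i, j) = y (i, j)" if "i < n" "j < n" for i j using that by (intro xy) (auto simp: rowset_def sq_def)
      note cc = column_cong[of n x y, OF col[OF less_imp_le]]
      have "row_offset n x l = row_offset n y l" if "l < n" for l
        unfolding row_offset_def cc(1) using that
        by (intro arg_cong2[where f = "(-)"] arg_cong2[where f = "(*)"] sum.cong refl) (simp_all add: cc col blk)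
      then show ?thesis
        unfolding cc(1) using p by (intro arg_cong2[where f = "(/)"] sum.cong refl) (auto simp: cc rowset_def)
    qed
  qed (use B in simp_all)
  then have "(\<integral>\<^sup>+x. B (T x) \<partial>LC ?I) = integral\<^sup>N (LC ?I) B" by (simp add: T_def)
  then show ?thesis unfolding Bshift .
qed

text \<open>The leading block is integrated innermost: for a frozen last column the conjugation by
  \<open>Gm\<close> and \<open>Hm\<close> preserves both Lebesgue measure and the spectrum, and thus
  disappears. What remains is a function of the corner times a function of the last column and
  row.\<close>

theorem gauss_int_Suc:
  "of_nat (Suc n) * gauss_int r L (Suc n) ms
    = row_const n * (\<integral>\<^sup>+z. ennreal (pt_weight r L z * (\<Prod>m\<leftarrow>ms. (cmod (m - z))\<^sup>2)) * gauss_int r L n (z # ms) \<partial>lborel)"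
proof -
  let ?I = "sq (Suc n)" and ?c = "(n, n)"
  define K where "K = ?I - sq n - {?c}"
  define p where "p z = ennreal (pt_weight r L z * (\<Prod>m\<leftarrow>ms. (cmod (m - z))\<^sup>2)) * gauss_int r L n (z # ms)" for z
  let ?F = "\<lambda>x. ennreal (spec_weight r L (Suc n) ms x * exp (- fro (Suc n) x))"
  let ?B = "\<lambda>x. ennreal (mod_weight r L n ms x) * row_gauss n x"
  have F: "?F \<in> borel_measurable (LC ?I)"
    by (intro measurable_compose[OF _ measurable_ennreal] borel_measurable_times spec_weight_measurable
        measurable_compose[OF _ borel_measurable_exp] borel_measurable_uminus fro_measurable)
  have J: "(k, n) \<in> ?I" "(n, k) \<in> ?I" if "k < n" for k using that by (simp_all add: sq_def)
  have B: "?B \<in> borel_measurable (LC ?I)"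
    by (intro borel_measurable_times_ennreal measurable_compose[OF mod_weight_measurable measurable_ennreal] row_gauss_measurable J)
  have insK: "insert ?c K = ?I - sq n" "?c \<notin> K" "finite K" by (auto simp: K_def sq_def)
  have pm: "p \<in> borel_measurable borel"
    unfolding p_def[abs_def]
    by (intro borel_measurable_times_ennreal measurable_compose[OF _ measurable_ennreal] borel_measurable_times
        pt_weight_measurable prod_list_diff_measurable
        measurable_cong_sets[OF sets_lborel refl, THEN equalityD1, THEN subsetD, OF gauss_int_measurable])
  have inner: "(\<integral>\<^sup>+y. ?B (merge (?I - sq n) (sq n) (x, y)) \<partial>LC (sq n)) = p (x ?c) * row_gauss n x" for x
  proof -
    let ?u = "\<lambda>y. merge (?I - sq n) (sq n) (x, y)"
    have ucol: "?u y (k, n) = x (k, n)" "?u y (n, k) = x (n, k)" if "k \<le> n" for k y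
      using that by (simp_all add: merge_def sq_def)
    have ublk: "?u y (i, j) = y (i, j)" if "i < n" "j < n" for i j y
      using that by (simp add: merge_def sq_def)
    note cc = column_cong[of n "?u y" x for y, OF ucol(1)[OF less_imp_le]]
    have rg: "row_gauss n (?u y) = row_gauss n x" for y
      unfolding row_gauss_def cc(1)
      by (intro arg_cong[where f = "\<lambda>s. ennreal (exp (- s))"] sum.cong refl arg_cong[where f = "\<lambda>z. (cmod z)\<^sup>2"]
          arg_cong2[where f = "(*)"]) (simp_all add: cc ucol)
    have ca: "conj_act n (Gm n (?u y)) (Hm n (?u y)) (?u y) = conj_act n (Gm n x) (Hm n x) y" for y
      by (rule conj_act_cong) (auto simp: cc ublk)
    have cpu: "cpol n (?u y) = cpol n y" for y by (rule cp_cong) (simp add: ublk)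
    have cpc: "cpol n (conj_act n (Gm n x) (Hm n x) y) = cpol n y" for y
      by (intro cpol_conj_act Gm_Hm)
    let ?E = "\<lambda>y. ennreal (spec_weight r L n (x ?c # ms) y * exp (- fro n y))"
    let ?k = "ennreal (pt_weight r L (x ?c) * (\<Prod>m\<leftarrow>ms. (cmod (m - x ?c))\<^sup>2)) * row_gauss n x"
    have E: "?E \<in> borel_measurable (LC (sq n))"
      by (intro measurable_compose[OF _ measurable_ennreal] borel_measurable_times spec_weight_measurable
        measurable_compose[OF _ borel_measurable_exp] borel_measurable_uminus fro_measurable)
    have "?B (?u y) = ?k * ?E (conj_act n (Gm n x) (Hm n x) y)" for y
    proof -
      have "mod_weight r L n ms (?u y) = pt_weight r L (x ?c) * (\<Prod>m\<leftarrow>ms. (cmod (m - x ?c))\<^sup>2)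
        * (spec_weight r L n (x ?c # ms) (conj_act n (Gm n x) (Hm n x) y) * exp (- fro n (conj_act n (Gm n x) (Hm n x) y)))"
        unfolding mod_weight_def ca ucol(1)[OF order_refl]
        using spec_weight_cong[of n "?u y" "conj_act n (Gm n x) (Hm n x) y" r L] by (simp add: cpu cpc)
      then have "ennreal (mod_weight r L n ms (?u y)) = ennreal (pt_weight r L (x ?c) * (\<Prod>m\<leftarrow>ms. (cmod (m - x ?c))\<^sup>2))
        * ?E (conj_act n (Gm n x) (Hm n x) y)"
        by (simp only:, intro ennreal_mult mult_nonneg_nonneg pt_weight_nonneg prod_list_nonneg spec_weight_nonneg) auto
      then show ?thesis unfolding rg by (simp only: mult_ac)
    qed
    then have "(\<integral>\<^sup>+y. ?B (?u y) \<partial>LC (sq n)) = (\<integral>\<^sup>+y. ?k * ?E (conj_act n (Gm n x) (Hm n x) y) \<partial>LC (sq n))"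
      by (simp only:)
    also have "\<dots> = ?k * (\<integral>\<^sup>+y. ?E (conj_act n (Gm n x) (Hm n x) y) \<partial>LC (sq n))"
      by (rule nn_integral_cmult) (rule measurable_compose[OF conj_act_measurable E])
    also have "(\<integral>\<^sup>+y. ?E (conj_act n (Gm n x) (Hm n x) y) \<partial>LC (sq n)) = gauss_int r L n (x ?c # ms)"
      unfolding gauss_int_def by (intro nn_integral_conj_act Gm_Hm Gm_cnj Hm_cnj E)
    finally show ?thesis unfolding p_def by (simp only: mult_ac)
  qed
  have "of_nat (Suc n) * gauss_int r L (Suc n) ms = (\<integral>\<^sup>+x. ?F (deflate n x) * ennreal ((cmod (cp n x (x ?c)))\<^sup>2) \<partial>LC ?I)"
    unfolding gauss_int_def by (rule nn_integral_deflate[OF F, symmetric])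
  also have "\<dots> = integral\<^sup>N (LC ?I) ?B"
    unfolding deflate_integrand by (rule nn_integral_row_centre)
  also have "\<dots> = (\<integral>\<^sup>+x. p (x ?c) * row_gauss n x \<partial>LC (?I - sq n))"
    using nn_integral_LC_block[OF finite_sq sq_mono[of n "Suc n"] B] unfolding inner by simp
  also have "\<dots> = (\<integral>\<^sup>+x. p (x ?c) * row_gauss n x \<partial>LC (insert ?c K))"
    by (simp only: insK)
  also have "\<dots> = (\<integral>\<^sup>+x. \<integral>\<^sup>+z. p ((x(?c := z)) ?c) * row_gauss n (x(?c := z)) \<partial>lborel \<partial>LC K)"
  proof (rule LC.product_nn_integral_insert[OF insK(3,2)])
    show "(\<lambda>x. p (x ?c) * row_gauss n x) \<in> borel_measurable (LC (insert ?c K))"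
      by (intro borel_measurable_times_ennreal measurable_compose[OF LC_coordinate_measurable pm] row_gauss_measurable)
        (auto simp: insK(1) sq_def)
  qed
  also have "\<dots> = (\<integral>\<^sup>+x. integral\<^sup>N lborel p * row_gauss n x \<partial>LC K)"
  proof (rule nn_integral_cong)
    fix x
    have "row_gauss n (x(?c := z)) = row_gauss n x" for z
    proof -
      note cc = column_cong[of n "x(?c := z)" x]
      have "colnorm n (x(?c := z)) = colnorm n x" by (rule cc(1)) simp
      moreover have "Hm n (x(?c := z)) i j = Hm n x i j" if "i < n" "j < n" for i j by (rule cc(3)) (use that in auto)
      ultimately show ?thesis unfolding row_gauss_def by simp
    qed
    then show "(\<integral>\<^sup>+z. p ((x(?c := z)) ?c) * row_gauss n (x(?c := z)) \<partial>lborel) = integral\<^sup>N lborel p * row_gauss n x"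
      using nn_integral_multc[of p lborel "row_gauss n x"] pm by simp
  qed
  also have "\<dots> = integral\<^sup>N lborel p * row_const n"
    unfolding row_const_def K_def[symmetric]
    by (rule nn_integral_cmult) (rule row_gauss_measurable; auto simp: K_def sq_def)
  finally show ?thesis unfolding p_def[abs_def] by (simp only: mult.commute)
qed

section \<open>Kostlan factors\<close>

text \<open>The counterpart of \<open>gauss_int\<close> on the side of the eigenvalues: a list
  element m contributes |m - x i|^2 for each variable in place of |det (m - A)|^2.\<close>

definition vint :: "real \<Rightarrow> real \<Rightarrow> nat \<Rightarrow> complex list \<Rightarrow> ennreal" where
  "vint r L n ms = (\<integral>\<^sup>+x. ennreal ((cmod (vdm n x))\<^sup>2 * (\<Prod>i<n. pt_weight r L (x i) * (\<Prod>m\<leftarrow>ms. (cmod (m - x i))\<^sup>2))) \<partial>LC {..<n})"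

lemma vdm_measurable:
  assumes "\<And>i. i < n \<Longrightarrow> (\<lambda>w. f w i) \<in> borel_measurable M"
  shows "(\<lambda>w. vdm n (f w)) \<in> borel_measurable M"
  unfolding vdm_def by (intro borel_measurable_prod borel_measurable_diff assms) auto

lemma vint_integrand_pair_measurable:
  "(\<lambda>p. ennreal ((cmod (vdm n (snd p)))\<^sup>2 * (\<Prod>i<n. pt_weight r L (snd p i) * (\<Prod>m\<leftarrow>fst p # ms. (cmod (m - snd p i))\<^sup>2))))
    \<in> borel_measurable (lborel \<Otimes>\<^sub>M LC {..<n})"
proof -
  let ?M = "(lborel :: complex measure) \<Otimes>\<^sub>M LC {..<n}"
  have c: "(\<lambda>p. snd p i) \<in> borel_measurable ?M" if "i < n" for i
    using that by (intro measurable_compose[OF measurable_snd LC_coordinate_measurable]) simp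
  have z: "(\<lambda>p. fst p) \<in> borel_measurable ?M"
    by (rule measurable_compose[OF measurable_fst measurable_ident_sets[OF sets_lborel]])
  show ?thesis
    unfolding list.map prod_list.Cons
    by (intro measurable_compose[OF _ measurable_ennreal] borel_measurable_times borel_measurable_prod borel_measurable_power
        measurable_compose[OF _ borel_measurable_norm] vdm_measurable borel_measurable_diff z c
        measurable_compose[OF c pt_weight_measurable] measurable_compose[OF c prod_list_diff_measurable]) simp_all
qed

lemma vint_integrand_measurable:
  "(\<lambda>x. ennreal ((cmod (vdm n x))\<^sup>2 * (\<Prod>i<n. pt_weight r L (x i) * (\<Prod>m\<leftarrow>ms. (cmod (m - x i))\<^sup>2))))
    \<in> borel_measurable (LC {..<n})"
proof -
  have c: "(\<lambda>x. x i) \<in> borel_measurable (LC {..<n})" if "i < n" for i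
    using that by (intro LC_coordinate_measurable) simp
  show ?thesis
    by (intro measurable_compose[OF _ measurable_ennreal] borel_measurable_times borel_measurable_prod borel_measurable_power
        measurable_compose[OF _ borel_measurable_norm] vdm_measurable c
        measurable_compose[OF c pt_weight_measurable] measurable_compose[OF c prod_list_diff_measurable]) simp_all
qed

lemma vint_measurable: "(\<lambda>z. vint r L n (z # ms)) \<in> borel_measurable lborel"
proof -
  interpret L: finite_product_sigma_finite "\<lambda>_. lborel :: complex measure" "{..<n}"
    by standard simp
  have eq: "case_prod (\<lambda>z x. ennreal ((cmod (vdm n x))\<^sup>2 * (\<Prod>i<n. pt_weight r L (x i) * (\<Prod>m\<leftarrow>z # ms. (cmod (m - x i))\<^sup>2))))
    = (\<lambda>p. ennreal ((cmod (vdm n (snd p)))\<^sup>2 * (\<Prod>i<n. pt_weight r L (snd p i) * (\<Prod>m\<leftarrow>fst p # ms. (cmod (m - snd p i))\<^sup>2))))"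
    by (simp add: fun_eq_iff)
  show ?thesis
    unfolding vint_def by (rule L.borel_measurable_nn_integral) (simp only: eq vint_integrand_pair_measurable)
qed

text \<open>Splitting off the last variable z, the Vandermonde product loses the factors z - x i,
  and their squared moduli are those of the list element z. Up to a constant this is the recursion
  of \<open>gauss_int_Suc\<close>.\<close>

lemma vint_Suc:
  "vint r L (Suc n) ms = (\<integral>\<^sup>+z. ennreal (pt_weight r L z * (\<Prod>m\<leftarrow>ms. (cmod (m - z))\<^sup>2)) * vint r L n (z # ms) \<partial>lborel)"
proof -
  let ?q = "\<lambda>z. pt_weight r L z * (\<Prod>m\<leftarrow>ms. (cmod (m - z))\<^sup>2)"
  let ?g = "\<lambda>x. ennreal ((cmod (vdm (Suc n) x))\<^sup>2 * (\<Prod>i<Suc n. ?q (x i)))"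
  let ?h = "\<lambda>z x. ennreal ((cmod (vdm n x))\<^sup>2 * (\<Prod>i<n. pt_weight r L (x i) * (\<Prod>m\<leftarrow>z # ms. (cmod (m - x i))\<^sup>2)))"
  have q0: "?q z \<ge> 0" for z
    by (intro mult_nonneg_nonneg pt_weight_nonneg prod_list_nonneg) auto
  have ins: "{..<Suc n} = insert n {..<n}" by auto
  have step: "?g (x(n := z)) = ennreal (?q z) * ?h z x" for x z
  proof -
    have v: "vdm n (x(n := z)) = vdm n x" by (simp add: vdm_def)
    have "vdm (Suc n) (x(n := z)) = vdm n x * (\<Prod>i<n. (z - x i))"
      using v by (simp add: vdm_def)
    then have "(cmod (vdm (Suc n) (x(n := z))))\<^sup>2 * (\<Prod>i<Suc n. ?q ((x(n := z)) i))
      = ?q z * ((cmod (vdm n x))\<^sup>2 * (\<Prod>i<n. pt_weight r L (x i) * (\<Prod>m\<leftarrow>z # ms. (cmod (m - x i))\<^sup>2)))"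
      by (simp add: norm_mult power_mult_distrib prod_norm[symmetric] prod_power_distrib[symmetric] prod.distrib mult_ac)
    moreover have "0 \<le> (cmod (vdm n x))\<^sup>2 * (\<Prod>i<n. pt_weight r L (x i) * (\<Prod>m\<leftarrow>z # ms. (cmod (m - x i))\<^sup>2))"
      by (intro mult_nonneg_nonneg prod_nonneg pt_weight_nonneg prod_list_nonneg ballI) auto
    ultimately show ?thesis using q0[of z] by (simp only: ennreal_mult)
  qed
  have "vint r L (Suc n) ms = integral\<^sup>N (LC (insert n {..<n})) ?g"
    unfolding vint_def ins ..
  also have "\<dots> = (\<integral>\<^sup>+z. \<integral>\<^sup>+x. ?g (x(n := z)) \<partial>LC {..<n} \<partial>lborel)"
    by (rule LC.product_nn_integral_insert_rev) (simp_all only: finite_lessThan lessThan_iff less_irrefl not_False_eq_True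
        vint_integrand_measurable ins[symmetric])
  also have "\<dots> = (\<integral>\<^sup>+z. ennreal (?q z) * vint r L n (z # ms) \<partial>lborel)"
    unfolding step vint_def by (intro nn_integral_cong nn_integral_cmult vint_integrand_measurable)
  finally show ?thesis .
qed

lemma gauss_int_0: "gauss_int r L 0 ms = 1" and vint_0: "vint r L 0 ms = 1"
proof -
  have sq0: "sq 0 = {}" by (simp add: sq_def)
  have cp0: "cpol 0 x = 1" for x
    using degree_cpol[of 0 x] lead_coeff_cpol[of 0 x] by (metis degree_0_id one_pCons)
  have pl: "(\<Prod>m\<leftarrow>ms. (1::real)) = 1" by (induction ms) auto
  show "gauss_int r L 0 ms = 1"
    unfolding gauss_int_def sq0 by (subst LC.nn_integral_empty) (simp_all add: spec_weight_def fro_def cp0 pl)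
  show "vint r L 0 ms = 1"
    unfolding vint_def lessThan_0 by (subst LC.nn_integral_empty) (simp_all add: vdm_def)
qed

text \<open>The division by n + 1 accounts for the n + 1 ways to deflate a matrix.\<close>

fun deflation_const :: "nat \<Rightarrow> ennreal" where
  "deflation_const 0 = 1"
| "deflation_const (Suc n) = row_const n * deflation_const n / of_nat (Suc n)"

text \<open>The constant may be ignored: it does not depend on \<open>r\<close>, and \<open>r = 0\<close> gives the normalization.\<close>

theorem gauss_int_vint: "gauss_int r L n ms = deflation_const n * vint r L n ms"
proof (induction n arbitrary: ms)
  case 0
  show ?case by (simp add: gauss_int_0 vint_0)
next
  case (Suc n)
  let ?q = "\<lambda>z. ennreal (pt_weight r L z * (\<Prod>m\<leftarrow>ms. (cmod (m - z))\<^sup>2))"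
  have m: "(\<lambda>z. ?q z * vint r L n (z # ms)) \<in> borel_measurable lborel"
    by (intro borel_measurable_times_ennreal vint_measurable measurable_compose[OF _ measurable_ennreal]
        measurable_cong_sets[OF sets_lborel refl, THEN equalityD2, THEN subsetD] borel_measurable_times
        pt_weight_measurable prod_list_diff_measurable)
  have "of_nat (Suc n) * gauss_int r L (Suc n) ms
    = row_const n * (\<integral>\<^sup>+z. deflation_const n * (?q z * vint r L n (z # ms)) \<partial>lborel)"
    unfolding gauss_int_Suc Suc.IH by (simp only: mult_ac)
  also have "\<dots> = row_const n * (deflation_const n * vint r L (Suc n) ms)"
    unfolding nn_integral_cmult[OF m] vint_Suc ..
  finally have *: "of_nat (Suc n) * gauss_int r L (Suc n) ms = row_const n * deflation_const n * vint r L (Suc n) ms"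
    by (simp only: mult_ac)
  have n0: "(of_nat (Suc n) :: ennreal) \<noteq> 0" "(of_nat (Suc n) :: ennreal) \<noteq> \<top>"
    by (simp_all del: of_nat_Suc)
  have "gauss_int r L (Suc n) ms = gauss_int r L (Suc n) ms * of_nat (Suc n) / of_nat (Suc n)"
    using n0 by (simp add: ennreal_mult_divide_eq del: of_nat_Suc)
  also have "gauss_int r L (Suc n) ms * of_nat (Suc n) = row_const n * deflation_const n * vint r L (Suc n) ms"
    using * by (simp only: mult.commute)
  also have "\<dots> / of_nat (Suc n) = row_const n * deflation_const n / of_nat (Suc n) * vint r L (Suc n) ms"
    by (simp only: divide_ennreal_def mult_ac)
  finally show ?case by (simp only: deflation_const.simps)
qed

text \<open>The image of planar Lebesgue measure under |z|^2 has the constant density pi on the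
  half-line, the area of a disc being linear in the squared radius. The sign is reversed so that the
  half-lines \<open>{x<..}\<close> pull back to discs and have finite measure, as the uniqueness
  theorem requires.\<close>

lemma nn_integral_radial:
  fixes f :: "real \<Rightarrow> ennreal"
  assumes f[measurable]: "f \<in> borel_measurable borel"
  shows "(\<integral>\<^sup>+z. f ((cmod z)\<^sup>2) \<partial>lborel) = ennreal pi * (\<integral>\<^sup>+t. f t * indicator {0..} t \<partial>lborel)"
proof -
  let ?M = "distr (lborel :: complex measure) borel (\<lambda>z. - (cmod z)\<^sup>2)"
  let ?N = "density lborel (\<lambda>t. ennreal pi * indicator {..0} t)"
  have tail: "emeasure ?M {x<..} = ennreal (pi * max 0 (- x))" for x
  proof -
    have "(\<lambda>z. - (cmod z)\<^sup>2) -` {x<..} = ball (0::complex) (sqrt (max 0 (- x)))"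
    proof (rule Set.set_eqI)
      fix z :: complex
      have "x < - (cmod z)\<^sup>2 \<longleftrightarrow> cmod z < sqrt (max 0 (- x))"
      proof (cases "x < 0")
        case True
        then show ?thesis
          using real_less_rsqrt[of "cmod z" "- x"] real_sqrt_less_iff[of "(cmod z)\<^sup>2" "- x"] by (auto simp: max_def)
      next
        case False
        have "0 \<le> (cmod z)\<^sup>2" by simp
        then have "\<not> x < - (cmod z)\<^sup>2" using False by linarith
        moreover have "max 0 (- x) = 0" using False by simp
        ultimately show ?thesis by simp
      qed
      then show "z \<in> (\<lambda>z. - (cmod z)\<^sup>2) -` {x<..} \<longleftrightarrow> z \<in> ball 0 (sqrt (max 0 (- x)))" by simp
    qed
    then have "emeasure ?M {x<..} = emeasure lborel (ball (0::complex) (sqrt (max 0 (- x))))"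
      by (subst emeasure_distr) auto
    also have "\<dots> = ennreal (unit_ball_vol (real DIM(complex)) * sqrt (max 0 (- x)) ^ DIM(complex))"
      by (rule emeasure_ball) simp
    also have "unit_ball_vol (real DIM(complex)) * sqrt (max 0 (- x)) ^ DIM(complex) = pi * max 0 (- x)"
      by (simp add: unit_ball_vol_2)
    finally show ?thesis .
  qed
  have "?M = ?N"
  proof (rule measure_eqI_lessThan)
    show "emeasure ?M {x<..} < \<infinity>" for x unfolding tail by simp
    show "emeasure ?M {x<..} = emeasure ?N {x<..}" for x
    proof -
      have "emeasure ?N {x<..} = (\<integral>\<^sup>+t. ennreal pi * indicator {x<..0} t \<partial>lborel)"
        by (subst emeasure_density) (auto intro!: nn_integral_cong simp: indicator_def)
      also have "\<dots> = ennreal pi * emeasure lborel {x<..0}" by (subst nn_integral_cmult) auto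
      also have "\<dots> = ennreal (pi * max 0 (- x))"
        by (cases "x \<le> 0") (simp_all add: ennreal_mult[symmetric] max_def)
      finally show ?thesis by (simp add: tail)
    qed
  qed simp_all
  have "(\<integral>\<^sup>+z. f ((cmod z)\<^sup>2) \<partial>lborel) = (\<integral>\<^sup>+s. f (- s) \<partial>?M)"
    by (subst nn_integral_distr) auto
  also have "\<dots> = (\<integral>\<^sup>+s. ennreal pi * (f (- s) * indicator {0..} (- s)) \<partial>lborel)"
    unfolding \<open>?M = ?N\<close> by (subst nn_integral_density) (auto intro!: nn_integral_cong simp: indicator_def)
  also have "\<dots> = ennreal pi * (\<integral>\<^sup>+s. f (- s) * indicator {0..} (- s) \<partial>lborel)"
    by (rule nn_integral_cmult) measurable
  also have "(\<integral>\<^sup>+s. f (- s) * indicator {0..} (- s) \<partial>lborel) = (\<integral>\<^sup>+t. f t * indicator {0..} t \<partial>lborel)"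
    using nn_integral_real_affine[of "\<lambda>t. f t * indicator {0..} t" "-1" 0] by simp
  finally show ?thesis .
qed

section \<open>Bounds for the lower incomplete gamma function\<close>

definition low_gamma :: "real \<Rightarrow> real \<Rightarrow> ennreal" where
  "low_gamma a x = (\<integral>\<^sup>+t. ennreal (t powr a * exp (- t)) * indicator {0..<x} t \<partial>lborel)"

lemma gamma_split:
  assumes "a \<ge> 0" "x \<ge> 0"
  shows "low_gamma a x + (\<integral>\<^sup>+t. ennreal (t powr a * exp (- t)) * indicator {x..} t \<partial>lborel) = ennreal (Gamma (a + 1))"
proof -
  have "low_gamma a x + (\<integral>\<^sup>+t. ennreal (t powr a * exp (- t)) * indicator {x..} t \<partial>lborel)
    = (\<integral>\<^sup>+t. ennreal (t powr a * exp (- t)) * indicator {0..<x} t + ennreal (t powr a * exp (- t)) * indicator {x..} t \<partial>lborel)"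
    unfolding low_gamma_def by (rule nn_integral_add[symmetric]) measurable
  also have "\<dots> = (\<integral>\<^sup>+t. ennreal (indicator {0..} t * t powr (a + 1 - 1) / exp t) \<partial>lborel)"
    using assms by (intro nn_integral_cong) (auto simp: indicator_def exp_minus divide_inverse)
  also have "\<dots> = ennreal (Gamma (a + 1))"
    using assms by (intro Gamma_conv_nn_integral_real[symmetric]) auto
  finally show ?thesis .
qed

lemma nn_integral_powr_interval:
  assumes "a \<ge> 0" "x \<ge> 0"
  shows "(\<integral>\<^sup>+t. ennreal (t powr a) * indicator {0..<x} t \<partial>lborel) = ennreal (x powr (a + 1) / (a + 1))"
proof -
  have "((\<lambda>t. t powr a) has_integral (x powr (a + 1) / (a + 1))) {0..x}"
    using assms by (intro has_integral_powr_from_0) auto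
  then have h: "((\<lambda>t. if t \<in> {0..x} then t powr a else 0) has_integral (x powr (a + 1) / (a + 1))) UNIV"
    by (simp only: has_integral_restrict_UNIV)
  have "(\<integral>\<^sup>+t. ennreal (if t \<in> {0..x} then t powr a else 0) \<partial>lborel) = ennreal (x powr (a + 1) / (a + 1))"
  proof (rule nn_integral_has_integral_lborel[OF _ _ h])
    show "(\<lambda>t. if t \<in> {0..x} then t powr a else 0) \<in> borel_measurable borel" by measurable
  qed simp
  moreover have "(\<integral>\<^sup>+t. ennreal (if t \<in> {0..x} then t powr a else 0) \<partial>lborel) = (\<integral>\<^sup>+t. ennreal (indicator {0..x} t * t powr a) \<partial>lborel)"
    by (intro nn_integral_cong) (simp add: indicator_def)
  ultimately have "(\<integral>\<^sup>+t. ennreal (indicator {0..x} t * t powr a) \<partial>lborel) = ennreal (x powr (a + 1) / (a + 1))"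
    by simp
  moreover have "(\<integral>\<^sup>+t. ennreal (t powr a) * indicator {0..<x} t \<partial>lborel) = (\<integral>\<^sup>+t. ennreal (indicator {0..x} t * t powr a) \<partial>lborel)"
    by (intro nn_integral_cong_AE, use AE_lborel_singleton[of x] in eventually_elim) (auto simp: indicator_def)
  ultimately show ?thesis by simp
qed

text \<open>From 1 - t <= exp (-t) <= 1 under the integral. The parameter a is the exponent of t, so
  the Gamma shape is a + 1.\<close>

lemma low_gamma_bounds:
  assumes "a \<ge> 0" "x \<ge> 0"
  shows "low_gamma a x \<le> ennreal (x powr (a + 1) / (a + 1))"
    and "ennreal (x powr (a + 1) / (a + 1)) \<le> low_gamma a x + ennreal (x powr (a + 2) / (a + 2))"
proof -
  have "low_gamma a x \<le> (\<integral>\<^sup>+t. ennreal (t powr a) * indicator {0..<x} t \<partial>lborel)"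
    unfolding low_gamma_def
    by (intro nn_integral_mono) (auto simp: indicator_def intro!: ennreal_leI mult_left_le)
  then show "low_gamma a x \<le> ennreal (x powr (a + 1) / (a + 1))"
    by (simp only: nn_integral_powr_interval[OF assms])
  have "ennreal (x powr (a + 1) / (a + 1))
    \<le> (\<integral>\<^sup>+t. ennreal (t powr a * exp (- t)) * indicator {0..<x} t + ennreal (t powr (a + 1)) * indicator {0..<x} t \<partial>lborel)"
    unfolding nn_integral_powr_interval[OF assms, symmetric]
  proof (intro nn_integral_mono)
    fix t
    show "ennreal (t powr a) * indicator {0..<x} t
      \<le> ennreal (t powr a * exp (- t)) * indicator {0..<x} t + ennreal (t powr (a + 1)) * indicator {0..<x} t"
    proof (cases "t \<in> {0..<x}")
      case True
      have "1 \<le> exp (- t) + t" using exp_ge_add_one_self[of "- t"] by simp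
      then have "t powr a * 1 \<le> t powr a * (exp (- t) + t)" by (intro mult_left_mono) auto
      also have "\<dots> = t powr a * exp (- t) + t powr (a + 1)"
        using True by (auto simp: distrib_left powr_add)
      finally show ?thesis using True by (simp add: ennreal_plus[symmetric] del: ennreal_plus)
    qed simp
  qed
  also have "\<dots> = low_gamma a x + (\<integral>\<^sup>+t. ennreal (t powr (a + 1)) * indicator {0..<x} t \<partial>lborel)"
    unfolding low_gamma_def by (rule nn_integral_add) measurable
  also have "(\<integral>\<^sup>+t. ennreal (t powr (a + 1)) * indicator {0..<x} t \<partial>lborel) = ennreal (x powr (a + 2) / (a + 2))"
    using nn_integral_powr_interval[of "a + 1" x] assms by (simp add: add.assoc)
  finally show "ennreal (x powr (a + 1) / (a + 1)) \<le> low_gamma a x + ennreal (x powr (a + 2) / (a + 2))" .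
qed

lemma moment_integral:
  assumes "L \<ge> 0" "r \<ge> 0"
  shows "(\<integral>\<^sup>+z. ennreal ((cmod z ^ k)\<^sup>2 * pt_weight r L z) \<partial>lborel)
    = ennreal pi * (\<integral>\<^sup>+t. ennreal (t powr (real k + L) * exp (- t)) * indicator {r\<^sup>2..} t \<partial>lborel)"
proof -
  let ?f = "\<lambda>t. ennreal (t ^ k * t powr L * exp (- t)) * indicator {r\<^sup>2..} t"
  have "(\<integral>\<^sup>+z. ennreal ((cmod z ^ k)\<^sup>2 * pt_weight r L z) \<partial>lborel) = (\<integral>\<^sup>+z. ?f ((cmod z)\<^sup>2) \<partial>lborel)"
  proof (rule nn_integral_cong)
    fix z :: complex
    have "cmod z < r \<longleftrightarrow> (cmod z)\<^sup>2 < r\<^sup>2"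
      using assms(2) by (metis abs_le_square_iff abs_norm_cancel abs_of_nonneg not_le)
    then show "ennreal ((cmod z ^ k)\<^sup>2 * pt_weight r L z) = ?f ((cmod z)\<^sup>2)"
      by (auto simp: pt_weight_def indicator_def power_mult[symmetric] mult.commute mult.left_commute)
  qed
  also have "\<dots> = ennreal pi * (\<integral>\<^sup>+t. ?f t * indicator {0..} t \<partial>lborel)"
    by (rule nn_integral_radial) measurable
  also have "(\<integral>\<^sup>+t. ?f t * indicator {0..} t \<partial>lborel)
    = (\<integral>\<^sup>+t. ennreal (t powr (real k + L) * exp (- t)) * indicator {r\<^sup>2..} t \<partial>lborel)"
  proof (intro nn_integral_cong_AE, use AE_lborel_singleton[of "0::real"] in eventually_elim)
    fix t :: real assume "t \<noteq> 0"
    then consider "t < 0" | "t > 0" by linarith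
    then show "?f t * indicator {0..} t = ennreal (t powr (real k + L) * exp (- t)) * indicator {r\<^sup>2..} t"
    proof cases
      case 1
      then have "\<not> r\<^sup>2 \<le> t" using zero_le_power2[of r] by linarith
      then show ?thesis by simp
    next
      case 2
      then show ?thesis by (simp add: powr_add powr_realpow)
    qed
  qed
  finally show ?thesis .
qed

section \<open>Asymptotics of the infinite product\<close>

text \<open>The Weierstrass product inequality, which is the union bound for independent
  events.\<close>

lemma prod_one_minus_ge:
  fixes p :: "nat \<Rightarrow> real"
  assumes "\<And>k. 0 \<le> p k" "\<And>k. p k \<le> 1"
  shows "1 - (\<Sum>k<N. p k) \<le> (\<Prod>k<N. (1 - p k))"
proof (induction N)
  case (Suc N)
  have "(\<Prod>k<N. (1 - p k)) \<le> 1" using assms by (intro prod_le_1) auto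
  then have "p N * (\<Prod>k<N. (1 - p k)) \<le> p N" using assms[of N] by (intro mult_left_le) auto
  with Suc show ?case by (simp add: algebra_simps)
qed simp

text \<open>In the recursion of Gamma every factor from L + 2 on is at least 2. This makes the
  contributions of the indices k >= 1 summable as a geometric series, uniformly in the number of
  factors.\<close>

lemma Gamma_growth:
  assumes "L \<ge> (0::real)"
  shows "2 ^ k * Gamma (L + 2) \<le> Gamma (real k + L + 2)"
proof (induction k)
  case 0
  show ?case by (simp add: add.commute)
next
  case (Suc k)
  have G: "Gamma (real k + L + 2) > 0" using assms by (intro Gamma_real_pos) auto
  have "2 ^ Suc k * Gamma (L + 2) \<le> 2 * Gamma (real k + L + 2)" using Suc by simp
  also have "\<dots> \<le> (real k + L + 2) * Gamma (real k + L + 2)" using G assms by (intro mult_right_mono) auto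
  also have "\<dots> = Gamma ((real k + L + 2) + 1)"
    using assms by (intro Gamma_plus1[symmetric]) (auto elim!: nonpos_Ints_cases)
  also have "(real k + L + 2) + 1 = real (Suc k) + L + 2" by simp
  finally show ?case .
qed

text \<open>Both sides follow from 1 + t <= exp t, at t = -y and at t = y; the second gives exp (-y)
  <= 1 / (1 + y) <= 1 - y + y^2.\<close>

lemma exp_quadratic_bound:
  assumes "(y::real) \<ge> 0"
  shows "\<bar>y - (1 - exp (- y))\<bar> \<le> y\<^sup>2"
proof -
  have 1: "1 - y \<le> exp (- y)" using exp_ge_add_one_self[of "- y"] by simp
  have "1 + y \<le> exp y" using exp_ge_add_one_self[of y] by simp
  then have "exp (- y) \<le> 1 / (1 + y)" using assms by (simp add: exp_minus inverse_eq_divide frac_le)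
  moreover have "1 / (1 + y) \<le> 1 - y + y\<^sup>2"
  proof -
    have "1 \<le> (1 - y + y\<^sup>2) * (1 + y)"
      using assms by (simp add: algebra_simps power2_eq_square)
    then show ?thesis using assms by (simp add: divide_le_eq)
  qed
  ultimately show ?thesis using 1 by (simp add: abs_if)
qed

lemma sq_powr: "r > 0 \<Longrightarrow> (r\<^sup>2) powr b = r powr (2 * b)" for r b :: real
  by (simp add: powr_powr flip: powr_numeral)

text \<open>The sequence increases and is bounded by 1, so the limit exists for each r. The union
  bound controls it from above, the factor k = 0 alone from below; both bounds are uniform in N and
  pass to the limit.\<close>

lemma limit_asymptotics:
  fixes p :: "real \<Rightarrow> nat \<Rightarrow> real"
  assumes L: "L \<ge> 0"
    and p01: "\<And>r k. 0 < r \<Longrightarrow> 0 \<le> p r k" "\<And>r k. 0 < r \<Longrightarrow> p r k \<le> 1"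
    and up: "\<And>r k. 0 < r \<Longrightarrow> p r k \<le> (r\<^sup>2) powr (real k + L + 1) / Gamma (real k + L + 2)"
    and lo: "\<And>r. 0 < r \<Longrightarrow> (r\<^sup>2) powr (L + 1) / Gamma (L + 2) \<le> p r 0 + C * (r\<^sup>2) powr (L + 2)"
  defines "F \<equiv> \<lambda>r. lim (\<lambda>N. 1 - (\<Prod>k<N. (1 - p r k)))"
  shows "0 < r \<Longrightarrow> (\<lambda>N. 1 - (\<Prod>k<N. (1 - p r k))) \<longlonglongrightarrow> F r"
    and "(\<lambda>r. F r - (1 - exp (- (r powr (2 * (L + 1)) / Gamma (L + 2))))) \<in> O[at_right 0](\<lambda>r. r powr (2 * (L + 2)))"
proof -
  let ?a = "\<lambda>r N. 1 - (\<Prod>k<N. (1 - p r k))"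
  have conv: "?a r \<longlonglongrightarrow> F r" if r: "0 < r" for r
  proof -
    have pr: "0 \<le> (\<Prod>k<N. (1 - p r k))" for N using p01[OF r] by (intro prod_nonneg) auto
    have "incseq (?a r)"
    proof (rule incseq_SucI)
      fix N
      have "(\<Prod>k<N. (1 - p r k)) * (1 - p r N) \<le> (\<Prod>k<N. (1 - p r k))"
        using p01[OF r, of N] pr[of N] by (intro mult_left_le) auto
      then show "?a r N \<le> ?a r (Suc N)" by simp
    qed
    moreover have "\<forall>N. ?a r N \<le> 1" using pr by simp
    ultimately obtain l where "?a r \<longlonglongrightarrow> l" using incseq_convergent by blast
    then show ?thesis unfolding F_def by (simp add: limI)
  qed
  then show "0 < r \<Longrightarrow> ?a r \<longlonglongrightarrow> F r" .
  define g where "g = Gamma (L + 2)"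
  have g: "g > 0" unfolding g_def using L by (intro Gamma_real_pos) auto
  \<comment> \<open>\<open>\<bar>C\<bar>\<close> comes from the lower bound at k = 0,
    \<open>2 / g\<close> from the factors k >= 1, and \<open>1 / g^2\<close> from replacing y by 1 -
    exp (-y).\<close>
  define K where "K = \<bar>C\<bar> + 2 / g + 1 / g\<^sup>2"
  have bound: "\<bar>F r - (1 - exp (- (r powr (2 * (L + 1)) / g)))\<bar> \<le> K * r powr (2 * (L + 2))" if r: "0 < r" "r < 1" for r
  proof -
    define x where "x = r\<^sup>2"
    have x: "0 < x" "x \<le> 1" using r by (auto simp: x_def power_le_one)
    define e where "e = x powr (L + 2)"
    have e0: "e \<ge> 0" by (simp add: e_def)
    define y where "y = x powr (L + 1) / g"
    have y0: "y \<ge> 0" using g by (simp add: y_def)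
    have pk: "p r (Suc k) \<le> e / g * (1 / 2) ^ Suc k" for k
    proof -
      have "p r (Suc k) \<le> x powr (real (Suc k) + L + 1) / Gamma (real (Suc k) + L + 2)"
        using up[OF r(1), of "Suc k"] by (simp add: x_def)
      also have "\<dots> \<le> e / (2 ^ Suc k * g)"
      proof (rule frac_le)
        show "x powr (real (Suc k) + L + 1) \<le> e" unfolding e_def using x by (intro powr_mono') auto
        show "2 ^ Suc k * g \<le> Gamma (real (Suc k) + L + 2)" unfolding g_def by (rule Gamma_growth[OF L])
      qed (use g e0 in auto)
      finally show ?thesis using g by (simp add: power_divide field_simps)
    qed
    have upper: "?a r N \<le> y + 2 * e / g" for N
    proof (cases N)
      case 0
      then show ?thesis using y0 e0 g by simp
    next
      case (Suc M)
      have "?a r N \<le> (\<Sum>k<N. p r k)" using prod_one_minus_ge[of "p r" N] p01[OF r(1)] by simp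
      also have "\<dots> = p r 0 + (\<Sum>k<M. p r (Suc k))" unfolding Suc by (rule sum.lessThan_Suc_shift)
      also have "\<dots> \<le> y + (\<Sum>k<M. e / g * (1 / 2) ^ Suc k)"
      proof (rule add_mono)
        show "p r 0 \<le> y" using up[OF r(1), of 0] by (simp add: y_def g_def x_def)
      qed (rule sum_mono[OF pk])
      also have "(\<Sum>k<M. e / g * (1 / 2) ^ Suc k) = e / g * (1 / 2) * (\<Sum>k<M. (1 / 2) ^ k)"
        by (simp add: sum_distrib_left mult_ac)
      also have "\<dots> \<le> e / g * (1 / 2) * 2"
      proof (rule mult_left_mono)
        have "(\<Sum>k<M. (1 / 2 :: real) ^ k) = (1 - (1 / 2) ^ M) / (1 - 1 / 2)"
          by (subst sum_gp_strict) auto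
        then show "(\<Sum>k<M. (1 / 2 :: real) ^ k) \<le> 2" by simp
      qed (use e0 g in auto)
      also have "y + e / g * (1 / 2) * 2 \<le> y + 2 * e / g" using e0 g by (simp add: field_simps)
      finally show ?thesis by simp
    qed
    have lower: "y - \<bar>C\<bar> * e \<le> ?a r (Suc N)" for N
    proof -
      have "(\<Prod>k<Suc N. (1 - p r k)) = (1 - p r 0) * (\<Prod>k<N. (1 - p r (Suc k)))"
        by (rule prod.lessThan_Suc_shift)
      also have "\<dots> \<le> (1 - p r 0) * 1"
        using p01[OF r(1)] by (intro mult_left_mono prod_le_1) auto
      finally have "p r 0 \<le> ?a r (Suc N)" by simp
      moreover have "y \<le> p r 0 + C * e"
        using lo[OF r(1)] by (simp add: y_def g_def x_def e_def)
      moreover have "C * e \<le> \<bar>C\<bar> * e" using e0 by (intro mult_right_mono) auto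
      ultimately show ?thesis by linarith
    qed
    have "F r \<le> y + 2 * e / g"
      by (rule LIMSEQ_le_const2[OF conv[OF r(1)]]) (use upper in auto)
    moreover have "y - \<bar>C\<bar> * e \<le> F r"
      by (rule LIMSEQ_le_const[OF LIMSEQ_Suc[OF conv[OF r(1)]]]) (use lower in auto)
    \<comment> \<open>The error y^2 is of the required order because 2 (L + 1) >= L + 2 for L >= 0,
      and smaller exponents give larger powers of x <= 1.\<close>
    moreover have "y\<^sup>2 \<le> e / g\<^sup>2"
    proof -
      have "(x powr (L + 1))\<^sup>2 = x powr (2 * (L + 1))" using x by (simp add: power2_eq_square powr_add[symmetric])
      also have "\<dots> \<le> e" unfolding e_def using x L by (intro powr_mono') auto
      finally show ?thesis unfolding y_def power_divide by (intro divide_right_mono) auto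
    qed
    moreover note exp_quadratic_bound[OF y0]
    moreover have "K * e = \<bar>C\<bar> * e + 2 * e / g + e / g\<^sup>2" unfolding K_def by (simp add: algebra_simps)
    moreover have "0 \<le> \<bar>C\<bar> * e" "0 \<le> 2 * e / g" using e0 g by auto
    ultimately have "\<bar>F r - (1 - exp (- y))\<bar> \<le> K * e" by linarith
    then show ?thesis unfolding y_def e_def x_def by (simp only: sq_powr[OF r(1)])
  qed
  show "(\<lambda>r. F r - (1 - exp (- (r powr (2 * (L + 1)) / Gamma (L + 2))))) \<in> O[at_right 0](\<lambda>r. r powr (2 * (L + 2)))"
  proof (rule bigoI[of _ K])
    show "\<forall>\<^sub>F r in at_right 0. norm (F r - (1 - exp (- (r powr (2 * (L + 1)) / Gamma (L + 2))))) \<le> K * norm (r powr (2 * (L + 2)))"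
      unfolding eventually_at_right_field by (rule exI[of _ 1]) (use bound in \<open>auto simp: g_def\<close>)
  qed
qed

section \<open>The minimum modulus\<close>

text \<open>The distribution function at r^2 of the Gamma law with shape k + L + 1.\<close>

definition low_prob :: "real \<Rightarrow> real \<Rightarrow> nat \<Rightarrow> real" where
  "low_prob L r k = enn2real (low_gamma (real k + L) (r\<^sup>2)) / Gamma (real k + L + 1)"

lemma low_gamma_real:
  assumes "a \<ge> 0" "x \<ge> 0"
  obtains l where "low_gamma a x = ennreal l" "0 \<le> l" "l \<le> x powr (a + 1) / (a + 1)"
    "x powr (a + 1) / (a + 1) \<le> l + x powr (a + 2) / (a + 2)"
    "l \<le> Gamma (a + 1)"
    "(\<integral>\<^sup>+t. ennreal (t powr a * exp (- t)) * indicator {x..} t \<partial>lborel) = ennreal (Gamma (a + 1) - l)"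
proof -
  define T where "T = (\<integral>\<^sup>+t. ennreal (t powr a * exp (- t)) * indicator {x..} t \<partial>lborel)"
  note s = gamma_split[OF assms, folded T_def]
  have G: "Gamma (a + 1) > 0" using assms by (intro Gamma_real_pos) auto
  have "low_gamma a x \<noteq> \<top>" "T \<noteq> \<top>" using s by auto
  then obtain l t where l: "low_gamma a x = ennreal l" "0 \<le> l" and t: "T = ennreal t" "0 \<le> t"
    by (metis ennreal_cases)
  have lt: "l + t = Gamma (a + 1)"
    using s l t G by (simp add: ennreal_plus[symmetric] del: ennreal_plus)
  show thesis
  proof (rule that[OF l])
    show "l \<le> x powr (a + 1) / (a + 1)"
      using low_gamma_bounds(1)[OF assms] l assms by (simp add: ennreal_le_iff)
    show "x powr (a + 1) / (a + 1) \<le> l + x powr (a + 2) / (a + 2)"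
      using low_gamma_bounds(2)[OF assms] l assms
      by (simp add: ennreal_plus[symmetric] ennreal_le_iff del: ennreal_plus)
    show "l \<le> Gamma (a + 1)" using lt t by simp
    show "(\<integral>\<^sup>+t. ennreal (t powr a * exp (- t)) * indicator {x..} t \<partial>lborel) = ennreal (Gamma (a + 1) - l)"
    proof -
      have "t = Gamma (a + 1) - l" using lt by simp
      then show ?thesis unfolding T_def[symmetric] t(1) by (rule arg_cong)
    qed
  qed
qed

lemma low_prob_bounds:
  assumes "L \<ge> 0" "r \<ge> 0"
  shows "0 \<le> low_prob L r k" "low_prob L r k \<le> 1"
    and "low_prob L r k \<le> (r\<^sup>2) powr (real k + L + 1) / Gamma (real k + L + 2)"
    and "(r\<^sup>2) powr (real k + L + 1) / Gamma (real k + L + 2) \<le> low_prob L r k + 1 / Gamma (real k + L + 1) * (r\<^sup>2) powr (real k + L + 2)"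
    and "(\<integral>\<^sup>+z. ennreal ((cmod z ^ k)\<^sup>2 * pt_weight r L z) \<partial>lborel)
      = ennreal (pi * Gamma (real k + L + 1) * (1 - low_prob L r k))"
proof -
  let ?a = "real k + L" and ?x = "r\<^sup>2"
  have a: "?a \<ge> 0" "?x \<ge> 0" using assms by auto
  obtain l where l: "low_gamma ?a ?x = ennreal l" "0 \<le> l" "l \<le> ?x powr (?a + 1) / (?a + 1)"
    "?x powr (?a + 1) / (?a + 1) \<le> l + ?x powr (?a + 2) / (?a + 2)"
    "l \<le> Gamma (?a + 1)"
    "(\<integral>\<^sup>+t. ennreal (t powr ?a * exp (- t)) * indicator {?x..} t \<partial>lborel) = ennreal (Gamma (?a + 1) - l)"
    using low_gamma_real[OF a] .
  define g where "g = Gamma (?a + 1)"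
  have g: "g > 0" unfolding g_def using a by (intro Gamma_real_pos) auto
  have lp: "low_prob L r k = l / g" unfolding low_prob_def l(1) g_def using l(2) by simp
  have "Gamma ((?a + 1) + 1) = (?a + 1) * Gamma (?a + 1)"
    using a by (intro Gamma_plus1) (auto elim!: nonpos_Ints_cases)
  then have g2: "Gamma (?a + 2) = (?a + 1) * g" by (simp add: g_def add.assoc)
  show "0 \<le> low_prob L r k" "low_prob L r k \<le> 1" unfolding lp using l g by (auto simp: g_def)
  show "low_prob L r k \<le> ?x powr (?a + 1) / Gamma (?a + 2)"
    unfolding lp g2 using divide_right_mono[OF l(3), of g] g by (simp add: field_simps)
  have "?x powr (?a + 2) * 1 \<le> ?x powr (?a + 2) * (?a + 2)" using a by (intro mult_left_mono) auto
  then have "?x powr (?a + 2) / (?a + 2) \<le> ?x powr (?a + 2)" using a by (simp add: divide_le_eq)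
  then have "?x powr (?a + 1) / (?a + 1) \<le> l + ?x powr (?a + 2)" using l(4) by linarith
  from divide_right_mono[OF this, of g]
  show "?x powr (?a + 1) / Gamma (?a + 2) \<le> low_prob L r k + 1 / Gamma (?a + 1) * ?x powr (?a + 2)"
    unfolding lp g2 g_def[symmetric] using g by (simp add: add_divide_distrib)
  show "(\<integral>\<^sup>+z. ennreal ((cmod z ^ k)\<^sup>2 * pt_weight r L z) \<partial>lborel) = ennreal (pi * Gamma (?a + 1) * (1 - low_prob L r k))"
  proof -
    have "g * (1 - l / g) = g - l" using g by (simp add: algebra_simps)
    then have m: "pi * g * (1 - l / g) = pi * (g - l)" by (simp only: mult.assoc)
    show ?thesis
      unfolding moment_integral[OF assms] l(6) lp g_def[symmetric] m
      by (rule ennreal_mult[symmetric]) (use l(5) in \<open>simp_all add: g_def\<close>)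
  qed
qed

lemma low_prob_0: "low_prob L 0 k = 0"
  by (simp add: low_prob_def low_gamma_def)

lemma vint_closed_form:
  assumes "L \<ge> 0" "r \<ge> 0"
  shows "vint r L n [] = ennreal (fact n * (\<Prod>k<n. pi * Gamma (real k + L + 1) * (1 - low_prob L r k)))"
proof -
  let ?w = "pt_weight r L"
  have G: "Gamma (real k + L + 1) > 0" for k using assms by (intro Gamma_real_pos) auto
  have has: "has_bochner_integral lborel (\<lambda>z. (cmod z ^ k)\<^sup>2 * ?w z) (pi * Gamma (real k + L + 1) * (1 - low_prob L r k))" for k
  proof (rule has_bochner_integral_nn_integral)
    have "(\<lambda>z::complex. (cmod z ^ k)\<^sup>2) \<in> borel_measurable borel"
      by (intro borel_measurable_continuous_onI continuous_intros)
    from borel_measurable_times[OF this pt_weight_measurable]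
    show "(\<lambda>z. (cmod z ^ k)\<^sup>2 * ?w z) \<in> borel_measurable lborel"
      by (rule measurable_cong_sets[OF sets_lborel refl, THEN equalityD2, THEN subsetD])
    show "AE z in lborel. 0 \<le> (cmod z ^ k)\<^sup>2 * ?w z" by (simp add: pt_weight_nonneg)
    show "0 \<le> pi * Gamma (real k + L + 1) * (1 - low_prob L r k)"
      using G[of k] low_prob_bounds(2)[OF assms, of k] by (intro mult_nonneg_nonneg) auto
  qed (rule low_prob_bounds(5)[OF assms])
  have rad: "?w (u * z) = ?w z" if "cmod u = 1" for u z
    using that by (simp add: pt_weight_def norm_mult)
  have mom: "mom ?w k = pi * Gamma (real k + L + 1) * (1 - low_prob L r k)" for k
    unfolding mom_def
    by (rule has_bochner_integral_integral_eq[OF has])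
  show ?thesis
    using nn_integral_vdm[OF pt_weight_measurable pt_weight_nonneg rad integrable.intros[OF has], of n]
    by (simp add: vint_def mom)
qed

section \<open>The matrix density in terms of the characteristic polynomial\<close>

lemma mat_adjoint_index:
  assumes "A \<in> carrier_mat n n" "i < n" "j < n"
  shows "mat_adjoint A $$ (i, j) = cnj (A $$ (j, i))"
  using assms unfolding mat_adjoint_def by (simp add: mat_of_rows_index conjugate_complex_def)

lemma mat_adjoint_carrier: "A \<in> carrier_mat n n \<Longrightarrow> mat_adjoint A \<in> carrier_mat n n"
  unfolding mat_adjoint_def by auto

lemma det_mat_adjoint:
  assumes A: "(A :: complex mat) \<in> carrier_mat n n"
  shows "Determinant.det (mat_adjoint A) = cnj (Determinant.det A)"
proof -
  have "p i < n" if "p permutes {0..<n}" "i < n" for p i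
    using permutes_in_image[OF that(1), of i] that(2) by simp
  then have "Determinant.det (mat_adjoint A) = cnj (Determinant.det (transpose_mat A))"
    unfolding det_def'[OF mat_adjoint_carrier[OF A]] det_def'[OF transpose_carrier_mat[THEN iffD2, OF A]]
    using A by (auto intro!: sum.cong prod.cong simp: mat_adjoint_index[OF A])
  then show ?thesis by (simp only: det_transpose[OF A])
qed

text \<open>The determinant of the adjoint times A is |det A|^2, and det A is up to sign the value
  of the characteristic polynomial at 0. The density thus becomes a function of the spectrum times a
  Gaussian, which is the form that deflation preserves.\<close>

lemma ginibre_weight_eq:
  "induced_ginibre_weight L (Matrix.mat n n x) = ((cmod (cp n x 0))\<^sup>2) powr L * exp (- fro n x)"
proof -
  let ?A = "Matrix.mat n n x"
  have A: "?A \<in> carrier_mat n n" by simp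
  have "Determinant.det (mat_adjoint ?A * ?A) = cnj (Determinant.det ?A) * Determinant.det ?A"
    using det_mult[OF mat_adjoint_carrier[OF A] A] by (simp only: det_mat_adjoint[OF A])
  also have "\<dots> = of_real ((cmod (Determinant.det ?A))\<^sup>2)"
    using complex_norm_square[of "Determinant.det ?A"] by (simp add: mult.commute)
  finally have d: "Re (Determinant.det (mat_adjoint ?A * ?A)) = (cmod (cp n x 0))\<^sup>2"
    by (simp only: Re_complex_of_real norm_det_cp)
  have "mat_trace (mat_adjoint ?A * ?A) = (\<Sum>j<n. (mat_adjoint ?A * ?A) $$ (j, j))"
    using mat_adjoint_carrier[OF A] by (simp add: mat_trace_def)
  also have "\<dots> = (\<Sum>j<n. \<Sum>i<n. of_real ((cmod (x (i, j)))\<^sup>2))"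
  proof (intro sum.cong refl)
    fix j assume "j \<in> {..<n}"
    then have j: "j < n" by simp
    have "(mat_adjoint ?A * ?A) $$ (j, j) = (\<Sum>i<n. mat_adjoint ?A $$ (j, i) * ?A $$ (i, j))"
      using j mat_adjoint_carrier[OF A] by (auto simp: scalar_prod_def atLeast0LessThan intro!: sum.cong)
    also have "\<dots> = (\<Sum>i<n. of_real ((cmod (x (i, j)))\<^sup>2))"
      using j by (intro sum.cong refl) (simp add: mat_adjoint_index[OF A] complex_norm_square mult.commute del: of_real_power)
    finally show "(mat_adjoint ?A * ?A) $$ (j, j) = (\<Sum>i<n. of_real ((cmod (x (i, j)))\<^sup>2))" .
  qed
  also have "\<dots> = of_real (\<Sum>j<n. \<Sum>i<n. (cmod (x (i, j)))\<^sup>2)" by simp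
  also have "(\<Sum>j<n. \<Sum>i<n. (cmod (x (i, j)))\<^sup>2) = fro n x"
    unfolding fro_def by (rule sum.swap)
  finally have "Re (mat_trace (mat_adjoint ?A * ?A)) = fro n x" by simp
  then show ?thesis unfolding induced_ginibre_weight_def d by simp
qed

text \<open>The complementary event has probability A v(r), where A collects the unknown
  normalization and deflation constants. Comparing with r = 0 leaves the quotient v(r) / v(0), in
  which the Gamma factors cancel.\<close>

lemma min_modulus_prob:
  assumes L: "L \<ge> 0" and r: "r \<ge> 0" and n: "n \<ge> 1" and ig: "induced_ginibre L n M G"
  shows "measure M {\<omega> \<in> space M. min_modulus (G \<omega>) < r} = 1 - (\<Prod>k<n. (1 - low_prob L r k))"
proof -
  interpret prob_space M using ig by (simp add: induced_ginibre_def)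
  have car: "G \<omega> \<in> carrier_mat n n" if "\<omega> \<in> space M" for \<omega> using ig that by (simp add: induced_ginibre_def)
  obtain c where c: "c > 0" and dist: "distributed M (entry_lebesgue n) (\<lambda>\<omega>. entries n (G \<omega>))
        (\<lambda>x. ennreal (c * induced_ginibre_weight L (Matrix.mat n n x)))"
    using ig by (auto simp: induced_ginibre_def)
  have el: "entry_lebesgue n = LC (sq n)" by (simp add: entry_lebesgue_def sq_def)
  define X where "X \<omega> = entries n (G \<omega>)" for \<omega>
  define B where "B r = {x \<in> space (LC (sq n)). \<exists>z\<in>ball 0 r. cp n x z = 0}" for r
  have BS: "B r \<in> sets (LC (sq n))" for r unfolding B_def by (rule sets_eigenvalue_ball)
  have X: "X \<in> measurable M (LC (sq n))"
    using distributed_measurable[OF dist] unfolding el X_def .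
  have law: "distr M (LC (sq n)) X = density (LC (sq n)) (\<lambda>x. ennreal (c * induced_ginibre_weight L (Matrix.mat n n x)))"
    using distributed_distr_eq_density[OF dist] unfolding el X_def .
  have dm: "(\<lambda>x. ennreal (c * induced_ginibre_weight L (Matrix.mat n n x))) \<in> borel_measurable (LC (sq n))"
    using distributed_borel_measurable[OF dist] unfolding el .
  have E: "emeasure M (X -` (space (LC (sq n)) - B r) \<inter> space M) = ennreal c * gauss_int r L n []" for r
  proof -
    have S: "space (LC (sq n)) - B r \<in> sets (LC (sq n))" using BS by auto
    have "emeasure M (X -` (space (LC (sq n)) - B r) \<inter> space M)
      = emeasure (distr M (LC (sq n)) X) (space (LC (sq n)) - B r)"
      by (rule emeasure_distr[OF X S, symmetric])
    also have "\<dots> = (\<integral>\<^sup>+x. ennreal (c * induced_ginibre_weight L (Matrix.mat n n x)) * indicator (space (LC (sq n)) - B r) x \<partial>LC (sq n))"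
      unfolding law by (rule emeasure_density[OF dm S])
    also have "\<dots> = (\<integral>\<^sup>+x. ennreal c * ennreal (spec_weight r L n [] x * exp (- fro n x)) \<partial>LC (sq n))"
    proof (rule nn_integral_cong)
      fix x assume "x \<in> space (LC (sq n))"
      then show "ennreal (c * induced_ginibre_weight L (Matrix.mat n n x)) * indicator (space (LC (sq n)) - B r) x
        = ennreal c * ennreal (spec_weight r L n [] x * exp (- fro n x))"
        using c unfolding ginibre_weight_eq B_def spec_weight_def
        by (auto simp: indicator_def ennreal_mult)
    qed
    also have "\<dots> = ennreal c * gauss_int r L n []"
      unfolding gauss_int_def
      by (intro nn_integral_cmult measurable_compose[OF _ measurable_ennreal] borel_measurable_times spec_weight_measurable
        measurable_compose[OF _ borel_measurable_exp] borel_measurable_uminus fro_measurable)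
    finally show ?thesis .
  qed
  define v where "v r = fact n * (\<Prod>k<n. pi * Gamma (real k + L + 1) * (1 - low_prob L r k))" for r
  have G: "Gamma (real k + L + 1) > 0" for k using L by (intro Gamma_real_pos) auto
  have v0: "v 0 > 0" unfolding v_def low_prob_0 using G by (intro mult_pos_pos prod_pos) auto
  have vr: "v r = v 0 * (\<Prod>k<n. (1 - low_prob L r k))"
    unfolding v_def low_prob_0 prod.distrib by simp
  define A where "A = ennreal c * deflation_const n"
  have EA: "emeasure M (X -` (space (LC (sq n)) - B r) \<inter> space M) = A * ennreal (v r)" if "r \<ge> 0" for r
    unfolding E gauss_int_vint vint_closed_form[OF L that] A_def v_def by (simp only: mult_ac)
  \<comment> \<open>The open disc of radius 0 is empty, so for r = 0 the event is the whole space,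
    even if 0 is an eigenvalue.\<close>
  have "B 0 = {}" by (simp add: B_def)
  then have "X -` (space (LC (sq n)) - B 0) \<inter> space M = space M"
    using measurable_space[OF X] by auto
  then have one: "A * ennreal (v 0) = 1" using EA[of 0] emeasure_space_1 by simp
  let ?q = "\<Prod>k<n. (1 - low_prob L r k)"
  have q0: "0 \<le> ?q" using low_prob_bounds(2)[OF L r] by (intro prod_nonneg) auto
  have "A * ennreal (v r) = (A * ennreal (v 0)) * ennreal ?q"
    unfolding vr using v0 q0 by (simp add: ennreal_mult mult.assoc)
  then have Eq: "emeasure M (X -` (space (LC (sq n)) - B r) \<inter> space M) = ennreal ?q"
    unfolding EA[OF r] one by simp
  have iff: "min_modulus (G \<omega>) < r \<longleftrightarrow> X \<omega> \<in> B r" if w: "\<omega> \<in> space M" for \<omega>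
  proof -
    have "Matrix.mat n n (X \<omega>) = G \<omega>"
      using car[OF w] by (intro eq_matI) (auto simp: X_def entries_def)
    then have cpG: "cpol n (X \<omega>) = char_poly (G \<omega>)" by (simp add: cpol_def)
    \<comment> \<open>A matrix of size at least 1 has an eigenvalue, so that \<open>Min\<close> in
      \<open>min_modulus\<close> is attained.\<close>
    have "finite (spectrum (G \<omega>))" "spectrum (G \<omega>) \<noteq> {}"
      using card_finite_spectrum(1)[OF car[OF w]] spectrum_non_empty[OF car[OF w]] n by auto
    then have "min_modulus (G \<omega>) < r \<longleftrightarrow> (\<exists>z\<in>spectrum (G \<omega>). cmod z < r)"
      unfolding min_modulus_def by (subst Min_less_iff) auto
    also have "\<dots> \<longleftrightarrow> (\<exists>z\<in>ball 0 r. cp n (X \<omega>) z = 0)"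
      unfolding spectrum_root_char_poly[OF car[OF w]] cpG by auto
    finally show ?thesis unfolding B_def using measurable_space[OF X w] by simp
  qed
  have Bev: "X -` B r \<inter> space M \<in> events" by (rule measurable_sets[OF X BS])
  have "{\<omega> \<in> space M. min_modulus (G \<omega>) < r} = X -` B r \<inter> space M" using iff by auto
  moreover have "X -` (space (LC (sq n)) - B r) \<inter> space M = space M - (X -` B r \<inter> space M)"
    using measurable_space[OF X] by auto
  then have "prob (space M - (X -` B r \<inter> space M)) = ?q"
    using Eq q0 by (simp add: measure_def)
  ultimately show ?thesis using prob_compl[OF Bev] by simp
qed

theorem theorem12:
  fixes L :: real
    and M :: "nat \<Rightarrow> 'a measure"
    and G :: "nat \<Rightarrow> 'a \<Rightarrow> complex mat"
    and k s :: real
  assumes "L \<ge> 0"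
    and "\<And>N. N \<ge> 1 \<Longrightarrow> induced_ginibre L N (M N) (G N)"
    and "k = 2 * (L + 1)"
    and "s = Gamma (L + 2) powr (1 / k)"
  shows "(\<forall>r\<ge>0. weibull_cdf k s r = 1 - exp (- (r powr (2 * (L + 1)) / Gamma (L + 2)))) \<and>
    (\<exists>F :: real \<Rightarrow> real.
       (\<forall>r>0. (\<lambda>N. measure (M N) {\<omega> \<in> space (M N). min_modulus (G N \<omega>) < r})
                 \<longlonglongrightarrow> F r) \<and>
       (\<lambda>r. F r - (1 - exp (- (r powr (2 * (L + 1)) / Gamma (L + 2)))))
         \<in> O[at_right 0](\<lambda>r. r powr (2 * (L + 2))))"
proof (intro conjI exI allI impI)
  fix r :: real assume r: "r \<ge> 0"
  have G: "Gamma (L + 2) > 0" using assms(1) by (intro Gamma_real_pos) auto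
  have k: "k > 0" using assms(1,3) by simp
  have "s powr k = Gamma (L + 2)" unfolding assms(4) powr_powr using k G by simp
  moreover have "s \<ge> 0" unfolding assms(4) by simp
  ultimately have "(r / s) powr k = r powr (2 * (L + 1)) / Gamma (L + 2)"
    using r by (simp add: powr_divide assms(3))
  then show "weibull_cdf k s r = 1 - exp (- (r powr (2 * (L + 1)) / Gamma (L + 2)))"
    using r by (simp add: weibull_cdf_def)
next
  \<comment> \<open>The limit of the explicit products, which involves neither the probability
    spaces nor the random matrices.\<close>
  let ?F = "\<lambda>r. lim (\<lambda>N. 1 - (\<Prod>k<N. (1 - low_prob L r k)))"
  have lo: "(r\<^sup>2) powr (L + 1) / Gamma (L + 2) \<le> low_prob L r 0 + 1 / Gamma (L + 1) * (r\<^sup>2) powr (L + 2)" if "0 < r" for r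
    using low_prob_bounds(4)[OF assms(1), of r 0] that by simp
  have b1: "0 \<le> low_prob L r k" and b2: "low_prob L r k \<le> 1"
    and b3: "low_prob L r k \<le> (r\<^sup>2) powr (real k + L + 1) / Gamma (real k + L + 2)" if "0 < r" for r k
    by (rule low_prob_bounds(1-3)[OF assms(1) less_imp_le[OF that]])+
  note as = limit_asymptotics[of L "low_prob L" "1 / Gamma (L + 1)"]
  show "(\<lambda>r. ?F r - (1 - exp (- (r powr (2 * (L + 1)) / Gamma (L + 2))))) \<in> O[at_right 0](\<lambda>r. r powr (2 * (L + 2)))"
    by (rule as(2)) (rule assms(1) b1 b2 b3 lo; assumption?)+
  fix r :: real assume r: "0 < r"
  \<comment> \<open>Only N >= 1 is compared: a matrix of size 0 has no eigenvalues.\<close>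
  have "\<forall>\<^sub>F N in sequentially. 1 - (\<Prod>k<N. (1 - low_prob L r k)) = measure (M N) {\<omega> \<in> space (M N). min_modulus (G N \<omega>) < r}"
    using eventually_ge_at_top[of 1]
    by eventually_elim (rule min_modulus_prob[OF assms(1) less_imp_le[OF r] _ assms(2), symmetric])
  then show "(\<lambda>N. measure (M N) {\<omega> \<in> space (M N). min_modulus (G N \<omega>) < r}) \<longlonglongrightarrow> ?F r"
  proof (rule Lim_transform_eventually[rotated])
    show "(\<lambda>N. 1 - (\<Prod>k<N. (1 - low_prob L r k))) \<longlonglongrightarrow> ?F r"
      by (rule as(1)) (rule assms(1) b1 b2 b3 lo r; assumption?)+
  qed
qed

end
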